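(* Let $M$ be a hypersurface in $\mathbb{E}^4_1$ with diagonalizable shape operator and exactly two distinct principal curvatures at every point, and suppose that $\nabla H$ vanishes nowhere on $M$. If $M$ is biconservative, then $M$ is (locally) congruent to one of the hypersurfaces $$x_1(s,t,u)=(f_1(s),\ s\cos t\sin u,\ s\sin t\sin u,\ s\cos u),$$ $$x_2(s,t,u)=(s\sinh u\sin t,\ s\cosh u\sin t,\ s\cos t,\ f_2(s)),$$ $$x_3(s,t,u)=(s\cosh t,\ s\sinh t\sin u,\ s\sinh t\cos u,\ f_3(s)),$$ $$x_4(s,t,u)=\left(\tfrac12 s(t^2+u^2)+s+f_4(s),\ st,\ su,\ \tfrac12 s(t^2+u^2)+f_4(s)\right)$$ for some smooth functions $f_1,f_2,f_3,f_4$ of one variable.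
   Context: $\mathbb{E}^4_1$ is $\mathbb{R}^4$ with the metric $\langle\cdot,\cdot\rangle=-dx_1^2+dx_2^2+dx_3^2+dx_4^2$ and Levi-Civita connection $\widetilde\nabla$. A hypersurface $M$ is smooth, oriented, with non-degenerate induced metric, and with unit normal field $N$; put $\varepsilon=\langle N,N\rangle$ (so $\varepsilon=-1$ if $M$ is Riemannian, $\varepsilon=1$ if $M$ is Lorentzian). The shape operator is $SX=-\widetilde\nabla_XN$; it is diagonalizable if every tangent space has an orthonormal basis of eigenvectors of $S$, and the eigenvalues are the principal curvatures. The mean curvature is $H=\frac13\mathrm{tr}\,S$, with gradient $\nabla H$ on $M$. $M$ is biconservative if $S(\nabla H)+\varepsilon\frac{3H}{2}\nabla H=0$. "(Locally) congruent to one of the hypersurfaces" means: there is an open dense subset of $M$ each point of which has a neighbourhood in $M$ that is mapped by an isometry of $\mathbb{E}^4_1$ onto an open part of one of the listed hypersurfaces (for a suitable choice of the function $f_i$). *)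

theory Defs
  imports "HOL-Analysis.Analysis"
begin

subsection \<open>Smooth maps between normed spaces\<close>

text \<open>Class $C^k$ on a set that is meant to be open. In finite dimension, differentiating the
  derivative in every fixed direction is the same as differentiating it as an operator-valued map.\<close>

primrec Ck_on :: "nat \<Rightarrow> ('a::real_normed_vector \<Rightarrow> 'b::real_normed_vector) \<Rightarrow> 'a set \<Rightarrow> bool" where
  "Ck_on 0 f U \<longleftrightarrow> continuous_on U f"
| "Ck_on (Suc k) f U \<longleftrightarrow>
     (\<forall>u\<in>U. f differentiable (at u)) \<and> (\<forall>w. Ck_on k (\<lambda>u. frechet_derivative f (at u) w) U)"

definition smooth_on :: "('a::real_normed_vector \<Rightarrow> 'b::real_normed_vector) \<Rightarrow> 'a set \<Rightarrow> bool" where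
  "smooth_on f U \<longleftrightarrow> (\<forall>k. Ck_on k f U)"


subsection \<open>Minkowski 4-space\<close>

definition minkowski :: "real^4 \<Rightarrow> real^4 \<Rightarrow> real" where
  "minkowski v w = - (v$1 * w$1) + v$2 * w$2 + v$3 * w$3 + v$4 * w$4"

text \<open>Isometries in the sense of pseudo-Riemannian geometry: diffeomorphisms that preserve the
  metric tensor.\<close>

definition minkowski_isometry :: "(real^4 \<Rightarrow> real^4) \<Rightarrow> bool" where
  "minkowski_isometry F \<longleftrightarrow>
     bij F \<and> smooth_on F UNIV \<and> smooth_on (inv F) UNIV \<and>
     (\<forall>p v w. minkowski (frechet_derivative F (at p) v) (frechet_derivative F (at p) w) = minkowski v w)"


subsection \<open>Immersed hypersurfaces\<close>

text \<open>A hypersurface is a 3-manifold \<open>M\<close>, given by its underlying topological space, with an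
  immersion \<open>x\<close> into $\mathbb{R}^4$; embedded hypersurfaces are the case in which \<open>M\<close> is a subspace
  of $\mathbb{R}^4$ and \<open>x\<close> the inclusion. There is no need for a separate smooth
  atlas: the local parametrizations \<open>\<phi>\<close> of \<open>M\<close> are the topological ones for which \<open>x \<circ> \<phi>\<close> is a smooth
  immersion, and the changes of coordinates between these are smooth because they are continuous
  and an immersion locally has a smooth left inverse.\<close>

definition local_param :: "'m topology \<Rightarrow> ('m \<Rightarrow> real^4) \<Rightarrow> (real^3) set \<Rightarrow> (real^3 \<Rightarrow> 'm) \<Rightarrow> bool" where
  "local_param M x U \<phi> \<longleftrightarrow>
     open U \<and> openin M (\<phi> ` U) \<and>
     homeomorphic_map (top_of_set U) (subtopology M (\<phi> ` U)) \<phi> \<and>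
     smooth_on (x \<circ> \<phi>) U \<and> (\<forall>u\<in>U. inj (frechet_derivative (x \<circ> \<phi>) (at u)))"

text \<open>The tangent space at \<open>p\<close>, identified with its image under $dx_p$.\<close>

definition tangent_space :: "'m topology \<Rightarrow> ('m \<Rightarrow> real^4) \<Rightarrow> 'm \<Rightarrow> (real^4) set" where
  "tangent_space M x p =
     {v. \<exists>U \<phi> u w. local_param M x U \<phi> \<and> u \<in> U \<and> \<phi> u = p \<and>
           v = frechet_derivative (x \<circ> \<phi>) (at u) w}"

definition nondegenerate_hypersurface :: "'m topology \<Rightarrow> ('m \<Rightarrow> real^4) \<Rightarrow> bool" where
  "nondegenerate_hypersurface M x \<longleftrightarrow>
     Hausdorff_space M \<and> second_countable M \<and>
     (\<forall>p\<in>topspace M. \<exists>U \<phi>. local_param M x U \<phi> \<and> p \<in> \<phi> ` U) \<and>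
     (\<forall>p\<in>topspace M. \<forall>v\<in>tangent_space M x p.
        (\<forall>w\<in>tangent_space M x p. minkowski v w = 0) \<longrightarrow> v = 0)"

definition smooth_map :: "'m topology \<Rightarrow> ('m \<Rightarrow> real^4) \<Rightarrow> ('m \<Rightarrow> 'b::real_normed_vector) \<Rightarrow> bool" where
  "smooth_map M x g \<longleftrightarrow> (\<forall>U \<phi>. local_param M x U \<phi> \<longrightarrow> smooth_on (g \<circ> \<phi>) U)"

text \<open>The derivative of \<open>g\<close> along the tangent vector \<open>v\<close> at \<open>p\<close>. As the Levi-Civita connection of
  Minkowski space is flat, this is the ambient covariant derivative when \<open>g\<close> is a vector
  field along \<open>x\<close>.\<close>

definition tangent_deriv ::
  "'m topology \<Rightarrow> ('m \<Rightarrow> real^4) \<Rightarrow> ('m \<Rightarrow> 'b::real_normed_vector) \<Rightarrow> 'm \<Rightarrow> real^4 \<Rightarrow> 'b" where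
  "tangent_deriv M x g p v =
     (THE d. \<exists>U \<phi> u w. local_param M x U \<phi> \<and> u \<in> U \<and> \<phi> u = p \<and>
         frechet_derivative (x \<circ> \<phi>) (at u) w = v \<and> frechet_derivative (g \<circ> \<phi>) (at u) w = d)"

definition gradient :: "'m topology \<Rightarrow> ('m \<Rightarrow> real^4) \<Rightarrow> ('m \<Rightarrow> real) \<Rightarrow> 'm \<Rightarrow> real^4" where
  "gradient M x g p =
     (THE G. G \<in> tangent_space M x p \<and>
        (\<forall>v\<in>tangent_space M x p. minkowski G v = tangent_deriv M x g p v))"

text \<open>A global unit normal field also fixes the orientation. The constant \<open>\<epsilon>\<close> is \<open>-1\<close> for a
  Riemannian and \<open>1\<close> for a Lorentzian hypersurface.\<close>

definition unit_normal :: "'m topology \<Rightarrow> ('m \<Rightarrow> real^4) \<Rightarrow> ('m \<Rightarrow> real^4) \<Rightarrow> real \<Rightarrow> bool" where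
  "unit_normal M x N \<epsilon> \<longleftrightarrow>
     \<epsilon> \<in> {-1, 1} \<and> smooth_map M x N \<and>
     (\<forall>p\<in>topspace M. minkowski (N p) (N p) = \<epsilon> \<and>
        (\<forall>v\<in>tangent_space M x p. minkowski (N p) v = 0))"


subsection \<open>Shape operator and mean curvature\<close>

definition shape_op ::
  "'m topology \<Rightarrow> ('m \<Rightarrow> real^4) \<Rightarrow> ('m \<Rightarrow> real^4) \<Rightarrow> 'm \<Rightarrow> real^4 \<Rightarrow> real^4" where
  "shape_op M x N p v = - tangent_deriv M x N p v"

definition diagonalizable_shape :: "'m topology \<Rightarrow> ('m \<Rightarrow> real^4) \<Rightarrow> ('m \<Rightarrow> real^4) \<Rightarrow> bool" where
  "diagonalizable_shape M x N \<longleftrightarrow>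
     (\<forall>p\<in>topspace M. \<exists>B. independent B \<and> span B = tangent_space M x p \<and>
        (\<forall>b\<in>B. \<bar>minkowski b b\<bar> = 1 \<and> (\<exists>k. shape_op M x N p b = k *\<^sub>R b)) \<and>
        (\<forall>b\<in>B. \<forall>c\<in>B. b \<noteq> c \<longrightarrow> minkowski b c = 0))"

definition principal_curvatures ::
  "'m topology \<Rightarrow> ('m \<Rightarrow> real^4) \<Rightarrow> ('m \<Rightarrow> real^4) \<Rightarrow> 'm \<Rightarrow> real set" where
  "principal_curvatures M x N p =
     {k. \<exists>v\<in>tangent_space M x p. v \<noteq> 0 \<and> shape_op M x N p v = k *\<^sub>R v}"

text \<open>The trace of an endomorphism \<open>A\<close> of the subspace \<open>T\<close>; it does not depend on the basis.\<close>

definition trace_on :: "'a::real_vector set \<Rightarrow> ('a \<Rightarrow> 'a) \<Rightarrow> real" where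
  "trace_on T A =
     (let B = (SOME B. independent B \<and> span B = T) in \<Sum>b\<in>B. representation B (A b) b)"

definition mean_curvature ::
  "'m topology \<Rightarrow> ('m \<Rightarrow> real^4) \<Rightarrow> ('m \<Rightarrow> real^4) \<Rightarrow> 'm \<Rightarrow> real" where
  "mean_curvature M x N p = trace_on (tangent_space M x p) (shape_op M x N p) / 3"

definition grad_H ::
  "'m topology \<Rightarrow> ('m \<Rightarrow> real^4) \<Rightarrow> ('m \<Rightarrow> real^4) \<Rightarrow> 'm \<Rightarrow> real^4" where
  "grad_H M x N = gradient M x (mean_curvature M x N)"

definition biconservative ::
  "'m topology \<Rightarrow> ('m \<Rightarrow> real^4) \<Rightarrow> ('m \<Rightarrow> real^4) \<Rightarrow> real \<Rightarrow> bool" where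
  "biconservative M x N \<epsilon> \<longleftrightarrow>
     (\<forall>p\<in>topspace M. shape_op M x N p (grad_H M x N p)
        + (\<epsilon> * (3 * mean_curvature M x N p / 2)) *\<^sub>R grad_H M x N p = 0)"


subsection \<open>The model hypersurfaces\<close>

definition model1 :: "(real \<Rightarrow> real) \<Rightarrow> real \<Rightarrow> real \<Rightarrow> real \<Rightarrow> real^4" where
  "model1 f s t u = vector [f s, s * cos t * sin u, s * sin t * sin u, s * cos u]"

definition model2 :: "(real \<Rightarrow> real) \<Rightarrow> real \<Rightarrow> real \<Rightarrow> real \<Rightarrow> real^4" where
  "model2 f s t u = vector [s * sinh u * sin t, s * cosh u * sin t, s * cos t, f s]"

definition model3 :: "(real \<Rightarrow> real) \<Rightarrow> real \<Rightarrow> real \<Rightarrow> real \<Rightarrow> real^4" where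
  "model3 f s t u = vector [s * cosh t, s * sinh t * sin u, s * sinh t * cos u, f s]"

definition model4 :: "(real \<Rightarrow> real) \<Rightarrow> real \<Rightarrow> real \<Rightarrow> real \<Rightarrow> real^4" where
  "model4 f s t u =
     vector [s * (t\<^sup>2 + u\<^sup>2) / 2 + s + f s, s * t, s * u, s * (t\<^sup>2 + u\<^sup>2) / 2 + f s]"

text \<open>\<open>vector\<close> is only supported by library rewrite rules up to length three.\<close>

lemma vector_4_nth [simp]:
  "(vector [a, b, c, d] :: ('a::zero)^4) $ 1 = a"
  "(vector [a, b, c, d] :: ('a::zero)^4) $ 2 = b"
  "(vector [a, b, c, d] :: ('a::zero)^4) $ 3 = c"
  "(vector [a, b, c, d] :: ('a::zero)^4) $ 4 = d"
  unfolding vector_def by simp_all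

text \<open>Some neighbourhood \<open>V = \<phi> ` U\<close> of \<open>p\<close> in \<open>M\<close> is mapped by an isometry onto the open part
  \<open>Y ` U\<close> of the hypersurface with parametrization \<open>Y\<close>, where \<open>s\<close> ranges over \<open>I\<close>. Stating this through a local
  parametrization \<open>\<phi>\<close> says that the two agree as hypersurfaces and not merely as sets of
  points; in particular \<open>Y\<close> is an immersion on \<open>U\<close>.\<close>

definition congruent_near ::
  "'m topology \<Rightarrow> ('m \<Rightarrow> real^4) \<Rightarrow> 'm \<Rightarrow> real set \<Rightarrow> (real \<Rightarrow> real \<Rightarrow> real \<Rightarrow> real^4) \<Rightarrow> bool" where
  "congruent_near M x p I Y \<longleftrightarrow>
     (\<exists>F U \<phi>. minkowski_isometry F \<and> local_param M x U \<phi> \<and> p \<in> \<phi> ` U \<and>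
        (\<forall>u\<in>U. u$1 \<in> I \<and> F (x (\<phi> u)) = Y (u$1) (u$2) (u$3)))"

definition locally_congruent_to_model :: "'m topology \<Rightarrow> ('m \<Rightarrow> real^4) \<Rightarrow> bool" where
  "locally_congruent_to_model M x \<longleftrightarrow>
     (\<exists>D. openin M D \<and> M closure_of D = topspace M \<and>
        (\<forall>p\<in>D. \<exists>f I. open I \<and> is_interval I \<and> smooth_on f I \<and>
           (\<exists>Y\<in>{model1 f, model2 f, model3 f, model4 f}. congruent_near M x p I Y)))"

end

theory Submission
  imports Defs
begin

text \<open>The hypersurface is shown to be rotational. Write \<open>N\<close> for the normal, \<open>H\<close> for the mean curvature,
  and call the leaves the surfaces tangent to the plane of the double principal curvature \<open>\<kappa>\<close>.

  The equation says that \<open>\<nabla>H\<close> is a principal direction for the curvature \<open>- (3 \<epsilon> / 2) H\<close>. This cannot be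
  the double curvature: by Codazzi's equation a double curvature is constant along its own plane, and
  \<open>\<nabla>H\<close> would vanish (\<open>gradient_in_simple_direction\<close>). So \<open>\<nabla>H\<close> spans the direction of the simple
  curvature, \<open>H\<close> is constant along the leaves, and since \<open>3 H\<close> is the trace of the shape operator, both
  curvatures are constant multiples \<open>a H\<close> and \<open>b H\<close> of \<open>H\<close> with \<open>a \<noteq> b\<close> and \<open>b \<noteq> 0\<close>.

  Consequently the focal point \<open>c = x + N / \<kappa>\<close> is constant along the leaves and moves with \<open>H\<close> only:
  \<open>dc = dH V\<close>. Equality of mixed second derivatives shows that \<open>V\<close> and its derivative \<open>V'\<close> with respect
  to \<open>H\<close> are constant along the leaves, too, and differentiating the identity \<open>\<langle>V, N\<rangle> = - \<epsilon> / (b H\<^sup>2)\<close>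
  twice, first across and then along the leaves, shows that \<open>V'\<close> is orthogonal to the leaves, like \<open>V\<close>. As the leaves are curved, this forces \<open>V'\<close> to be a
  multiple of \<open>V\<close> (\<open>V'_parallel_V\<close>). So the focal points move on a line, the axis, with a direction \<open>A\<close>
  that is orthogonal to all leaves (\<open>rotation_axis\<close>). Each leaf lies on a pseudosphere centred on the
  axis and in a hyperplane orthogonal to the axis, and the hypersurface is rotational. By the same
  identity \<open>A\<close> is nowhere tangent to it, and since \<open>a \<noteq> b\<close> it is nowhere normal to it either. Therefore
  the distance \<open>s\<close> from the axis (for a null axis, the null coordinate) is a regular function near every point, and the position along the axis is a smooth function of \<open>s\<close>
  (\<open>factor_through_submersion\<close>). The causal characters of \<open>A\<close> and of the component of the position vector
  orthogonal to it decide between the four models (\<open>congruent_to_model\<close>), and the dense open set is \<open>M\<close> itself.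

  Everything is computed in a chart. The definitions quantify over all charts, so one first has to see
  that coordinate changes are differentiable (\<open>chart_change\<close>), and that the mean curvature is smooth because
  in coordinates the shape operator solves a linear system with smooth coefficients (\<open>smooth_h\<close>). Closure
  properties of \<open>smooth_on\<close>, the symmetry of second derivatives and the smoothness of inverse functions of
  one variable are derived from the definition of \<open>Ck_on\<close>.\<close>

section \<open>Calculus of smooth maps\<close>

abbreviation Der :: "('a::real_normed_vector \<Rightarrow> 'b::real_normed_vector) \<Rightarrow> 'a \<Rightarrow> 'a \<Rightarrow> 'b" where
  "Der f u \<equiv> frechet_derivative f (at u)"

lemma Der_eqI: "(f has_derivative f') (at u) \<Longrightarrow> Der f u = f'"
  by (rule frechet_derivative_at[symmetric])

lemma Der_works: "f differentiable (at u) \<Longrightarrow> (f has_derivative Der f u) (at u)"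
  by (simp add: frechet_derivative_works)

lemma Ck_on_subset: "Ck_on k f U \<Longrightarrow> V \<subseteq> U \<Longrightarrow> Ck_on k f V"
  by (induction k arbitrary: f) (auto intro: continuous_on_subset)

text \<open>\<open>Ck_on\<close> refers to derivatives in the ambient space, so agreement on an open set suffices;
  this is what allows a derivative to be replaced by a formula for it.\<close>

lemma Ck_on_cong:
  assumes "open U" "\<And>u. u \<in> U \<Longrightarrow> f u = g u"
  shows "Ck_on k f U \<longleftrightarrow> Ck_on k g U"
  using assms(2)
proof (induction k arbitrary: f g)
  case 0
  then show ?case by (simp cong: continuous_on_cong)
next
  case (Suc k)
  have hd: "(f has_derivative D) (at u) \<longleftrightarrow> (g has_derivative D) (at u)" if "u \<in> U" for u D
    using has_derivative_transform_within_open[OF _ assms(1) that, of f D UNIV g]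
      has_derivative_transform_within_open[OF _ assms(1) that, of g D UNIV f] Suc.prems by auto
  then have "Der f u = Der g u" if "u \<in> U" for u
    using that by (simp add: frechet_derivative_def)
  moreover have "f differentiable (at u) \<longleftrightarrow> g differentiable (at u)" if "u \<in> U" for u
    using hd[OF that] by (simp add: differentiable_def)
  ultimately show ?case
    using Suc.IH[of "\<lambda>u. Der f u _" "\<lambda>u. Der g u _"] by simp
qed

text \<open>The working form of the definition: it is enough to name a derivative and to see that it is of
  class $C^k$ in every fixed direction. The closure properties below all follow by induction on \<open>k\<close>.\<close>

lemma Ck_on_SucI:
  assumes "open U" "\<And>u. u \<in> U \<Longrightarrow> (f has_derivative f' u) (at u)" "\<And>w. Ck_on k (\<lambda>u. f' u w) U"
  shows "Ck_on (Suc k) f U"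
proof -
  have "Der f u = f' u" if "u \<in> U" for u
    using assms(2)[OF that] by (rule Der_eqI)
  then have "Ck_on k (\<lambda>u. Der f u w) U" for w
    using assms(3)[of w] Ck_on_cong[OF assms(1), of "\<lambda>u. Der f u w" "\<lambda>u. f' u w"] by simp
  then show ?thesis
    using assms(2) by (auto simp: differentiable_def)
qed

lemma Ck_on_Suc_derivative: "Ck_on (Suc k) f U \<Longrightarrow> u \<in> U \<Longrightarrow> (f has_derivative Der f u) (at u)"
  by (simp add: Der_works)

lemma Ck_on_Suc_Der: "Ck_on (Suc k) f U \<Longrightarrow> Ck_on k (\<lambda>u. Der f u w) U"
  by simp

lemma Ck_on_imp_continuous_on:
  assumes "Ck_on k f U"
  shows "continuous_on U f"
proof (cases k)
  case (Suc j)
  then have "f differentiable (at u)" if "u \<in> U" for u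
    using assms that by simp
  then show ?thesis
    by (blast intro: continuous_at_imp_continuous_on differentiable_imp_continuous_within)
qed (use assms in simp)

lemma Ck_on_SucD: "Ck_on (Suc k) f U \<Longrightarrow> Ck_on k f U"
proof (induction k arbitrary: f)
  case 0
  then show ?case using Ck_on_imp_continuous_on[OF 0] by simp
next
  case (Suc k)
  then show ?case unfolding Ck_on.simps(2)[of "Suc k" f U] Ck_on.simps(2)[of k f U]
    by (intro conjI allI) auto
qed

lemma Ck_on_const: "Ck_on k (\<lambda>u. c) U"
  by (induction k arbitrary: c) simp_all

lemma Ck_on_bounded_linear_comp:
  assumes L: "bounded_linear L" and U: "open U"
  shows "Ck_on k f U \<Longrightarrow> Ck_on k (\<lambda>u. L (f u)) U"
proof (induction k arbitrary: f)
  case 0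
  then show ?case by (simp add: bounded_linear.continuous_on[OF L])
next
  case (Suc k)
  show ?case
  proof (rule Ck_on_SucI[OF U])
    show "((\<lambda>u. L (f u)) has_derivative (\<lambda>w. L (Der f u w))) (at u)" if "u \<in> U" for u
      by (rule bounded_linear.has_derivative[OF L Ck_on_Suc_derivative[OF Suc.prems that]])
    show "Ck_on k (\<lambda>u. L (Der f u w)) U" for w
      using Suc.IH Suc.prems by simp
  qed
qed

lemma Ck_on_add:
  assumes U: "open U"
  shows "Ck_on k f U \<Longrightarrow> Ck_on k g U \<Longrightarrow> Ck_on k (\<lambda>u. f u + g u) U"
proof (induction k arbitrary: f g)
  case 0
  then show ?case by (simp add: continuous_on_add)
next
  case (Suc k)
  show ?case
  proof (rule Ck_on_SucI[OF U])
    show "((\<lambda>u. f u + g u) has_derivative (\<lambda>w. Der f u w + Der g u w)) (at u)" if "u \<in> U" for u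
      by (intro has_derivative_add Ck_on_Suc_derivative[OF Suc.prems(1) that]
          Ck_on_Suc_derivative[OF Suc.prems(2) that])
    show "Ck_on k (\<lambda>u. Der f u w + Der g u w) U" for w
      using Suc by simp
  qed
qed

lemma Ck_on_bounded_bilinear:
  assumes B: "bounded_bilinear B" and U: "open U"
  shows "Ck_on k f U \<Longrightarrow> Ck_on k g U \<Longrightarrow> Ck_on k (\<lambda>u. B (f u) (g u)) U"
proof (induction k arbitrary: f g)
  case 0
  then show ?case by (simp add: bounded_bilinear.continuous_on[OF B])
next
  case (Suc k)
  show ?case
  proof (rule Ck_on_SucI[OF U])
    show "((\<lambda>u. B (f u) (g u)) has_derivative (\<lambda>w. B (f u) (Der g u w) + B (Der f u w) (g u))) (at u)"
      if "u \<in> U" for u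
      by (intro bounded_bilinear.FDERIV[OF B] Ck_on_Suc_derivative[OF Suc.prems(1) that]
          Ck_on_Suc_derivative[OF Suc.prems(2) that])
    show "Ck_on k (\<lambda>u. B (f u) (Der g u w) + B (Der f u w) (g u)) U" for w
      by (rule Ck_on_add[OF U Suc.IH[OF Ck_on_SucD[OF Suc.prems(1)] Ck_on_Suc_Der[OF Suc.prems(2)]]
          Suc.IH[OF Ck_on_Suc_Der[OF Suc.prems(1)] Ck_on_SucD[OF Suc.prems(2)]]])
  qed
qed

lemma Ck_on_sum:
  assumes U: "open U" and "\<And>i. i \<in> A \<Longrightarrow> Ck_on k (f i) U"
  shows "Ck_on k (\<lambda>u. \<Sum>i\<in>A. f i u) U"
  using assms(2)
proof (induction A rule: infinite_finite_induct)
  case (insert i A)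
  then show ?case using Ck_on_add[OF U, of k "f i" "\<lambda>u. \<Sum>i\<in>A. f i u"] by simp
qed (simp_all add: Ck_on_const)

lemma Ck_on_inverse:
  fixes f :: "'a::real_normed_vector \<Rightarrow> real"
  assumes U: "open U" and nz: "\<And>u. u \<in> U \<Longrightarrow> f u \<noteq> 0"
  shows "Ck_on k f U \<Longrightarrow> Ck_on k (\<lambda>u. inverse (f u)) U"
proof (induction k)
  case 0
  then show ?case using nz by (simp add: continuous_on_inverse)
next
  case (Suc k)
  note M = Ck_on_bounded_bilinear[OF bounded_bilinear_mult U]
  show ?case
  proof (rule Ck_on_SucI[OF U])
    show "((\<lambda>u. inverse (f u)) has_derivative (\<lambda>w. - (inverse (f u) * Der f u w * inverse (f u)))) (at u)"
      if "u \<in> U" for u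
      by (rule Deriv.has_derivative_inverse[OF nz[OF that] Ck_on_Suc_derivative[OF Suc.prems that]])
    show "Ck_on k (\<lambda>u. - (inverse (f u) * Der f u w * inverse (f u))) U" for w
      by (rule Ck_on_bounded_linear_comp[OF bounded_linear_minus[OF bounded_linear_ident] U
            M[OF M[OF Suc.IH[OF Ck_on_SucD[OF Suc.prems]] Ck_on_Suc_Der[OF Suc.prems]]
              Suc.IH[OF Ck_on_SucD[OF Suc.prems]]]])
  qed
qed

text \<open>The chain rule is applied to the partial derivatives of the outer function, which
  are again functions of the intermediate point to which the induction hypothesis applies.\<close>

lemma Ck_on_compose:
  fixes g :: "'a::real_normed_vector \<Rightarrow> 'b::euclidean_space"
    and f :: "'b \<Rightarrow> 'c::real_normed_vector"
  assumes U: "open U" and sub: "\<And>u. u \<in> U \<Longrightarrow> g u \<in> V"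
  shows "Ck_on k g U \<Longrightarrow> Ck_on k f V \<Longrightarrow> Ck_on k (\<lambda>u. f (g u)) U"
proof (induction k arbitrary: f)
  case 0
  then show ?case using sub by (auto intro: continuous_on_compose2)
next
  case (Suc k)
  note f = Suc.prems(2) and g = Suc.prems(1)
  show ?case
  proof (rule Ck_on_SucI[OF U])
    fix u assume u: "u \<in> U"
    have "((\<lambda>u. f (g u)) has_derivative (\<lambda>w. Der f (g u) (Der g u w))) (at u)"
      using has_derivative_compose[OF Ck_on_Suc_derivative[OF g u] Ck_on_Suc_derivative[OF f sub[OF u]]] .
    moreover have D: "Der f (g u) v = (\<Sum>i\<in>Basis. (v \<bullet> i) *\<^sub>R Der f (g u) i)" for v
    proof -
      have l: "linear (Der f (g u))"
        using f sub[OF u] by (intro linear_frechet_derivative) simp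
      have "Der f (g u) v = Der f (g u) (\<Sum>i\<in>Basis. (v \<bullet> i) *\<^sub>R i)"
        by (simp only: euclidean_representation)
      also have "\<dots> = (\<Sum>i\<in>Basis. (v \<bullet> i) *\<^sub>R Der f (g u) i)"
        using l by (simp add: linear_sum linear_scale)
      finally show ?thesis .
    qed
    ultimately show "((\<lambda>u. f (g u)) has_derivative
        (\<lambda>w. \<Sum>i\<in>Basis. (Der g u w \<bullet> i) *\<^sub>R Der f (g u) i)) (at u)"
      by (subst (asm) D)
  next
    fix w
    show "Ck_on k (\<lambda>u. \<Sum>i\<in>Basis. (Der g u w \<bullet> i) *\<^sub>R Der f (g u) i) U"
    proof (intro Ck_on_sum[OF U] Ck_on_bounded_bilinear[OF bounded_bilinear_scaleR U])
      show "Ck_on k (\<lambda>u. Der g u w \<bullet> i) U" for i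
        using Ck_on_bounded_linear_comp[OF bounded_linear_inner_left U Ck_on_Suc_Der[OF g]] .
      show "Ck_on k (\<lambda>u. Der f (g u) i) U" for i
        by (rule Suc.IH[OF Ck_on_SucD[OF g] Ck_on_Suc_Der[OF f]])
    qed
  qed
qed

lemma smooth_onD: "smooth_on f U \<Longrightarrow> Ck_on k f U"
  unfolding smooth_on_def by (rule spec)

lemma smooth_onI: "(\<And>k. Ck_on k f U) \<Longrightarrow> smooth_on f U"
  unfolding smooth_on_def by (rule allI)

lemma smooth_on_subset: "smooth_on f U \<Longrightarrow> V \<subseteq> U \<Longrightarrow> smooth_on f V"
  by (rule smooth_onI) (rule Ck_on_subset[OF smooth_onD])

lemma smooth_on_cong:
  assumes "open U" "\<And>u. u \<in> U \<Longrightarrow> f u = g u"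
  shows "smooth_on f U \<longleftrightarrow> smooth_on g U"
  by (simp only: smooth_on_def Ck_on_cong[OF assms])

lemma smooth_on_derivative: "smooth_on f U \<Longrightarrow> u \<in> U \<Longrightarrow> (f has_derivative Der f u) (at u)"
  by (rule Ck_on_Suc_derivative[OF smooth_onD])

lemma smooth_on_differentiable: "smooth_on f U \<Longrightarrow> u \<in> U \<Longrightarrow> f differentiable (at u)"
  by (rule differentiableI[OF smooth_on_derivative])

lemma smooth_on_Der: "smooth_on f U \<Longrightarrow> smooth_on (\<lambda>u. Der f u w) U"
  by (rule smooth_onI) (rule Ck_on_Suc_Der[OF smooth_onD])

lemma smooth_on_imp_continuous_on: "smooth_on f U \<Longrightarrow> continuous_on U f"
  by (rule Ck_on_imp_continuous_on[OF smooth_onD])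

lemma smooth_on_const: "smooth_on (\<lambda>u. c) U"
  by (rule smooth_onI) (rule Ck_on_const)

lemma smooth_on_bounded_linear:
  assumes "bounded_linear L"
  shows "smooth_on L UNIV"
proof (rule smooth_onI)
  fix k
  have d: "(L has_derivative L) (at u)" for u
    by (rule bounded_linear_imp_has_derivative[OF assms])
  have "Ck_on (Suc k) L UNIV"
    by (rule Ck_on_SucI[OF open_UNIV d Ck_on_const])
  then show "Ck_on k L UNIV"
    by (rule Ck_on_SucD)
qed

lemma smooth_on_bounded_linear_comp:
  "bounded_linear L \<Longrightarrow> open U \<Longrightarrow> smooth_on f U \<Longrightarrow> smooth_on (\<lambda>u. L (f u)) U"
  by (rule smooth_onI) (rule Ck_on_bounded_linear_comp[OF _ _ smooth_onD])

lemma smooth_on_add: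
  "open U \<Longrightarrow> smooth_on f U \<Longrightarrow> smooth_on g U \<Longrightarrow> smooth_on (\<lambda>u. f u + g u) U"
  by (rule smooth_onI) (rule Ck_on_add[OF _ smooth_onD smooth_onD])

lemma smooth_on_minus: "open U \<Longrightarrow> smooth_on f U \<Longrightarrow> smooth_on (\<lambda>u. - f u) U"
  using smooth_on_bounded_linear_comp[OF bounded_linear_minus[OF bounded_linear_ident]] .

lemma smooth_on_diff:
  "open U \<Longrightarrow> smooth_on f U \<Longrightarrow> smooth_on g U \<Longrightarrow> smooth_on (\<lambda>u. f u - g u) U"
  using smooth_on_add[of U f "\<lambda>u. - g u"] smooth_on_minus[of U g] by simp

lemma smooth_on_bounded_bilinear:
  "bounded_bilinear B \<Longrightarrow> open U \<Longrightarrow> smooth_on f U \<Longrightarrow> smooth_on g U \<Longrightarrow> smooth_on (\<lambda>u. B (f u) (g u)) U"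
  by (rule smooth_onI) (rule Ck_on_bounded_bilinear[OF _ _ smooth_onD smooth_onD])

lemmas smooth_on_scaleR = smooth_on_bounded_bilinear[OF bounded_bilinear_scaleR]
lemmas smooth_on_inner = smooth_on_bounded_bilinear[OF bounded_bilinear_inner]

lemma smooth_on_mult:
  fixes f g :: "'a::real_normed_vector \<Rightarrow> real"
  shows "open U \<Longrightarrow> smooth_on f U \<Longrightarrow> smooth_on g U \<Longrightarrow> smooth_on (\<lambda>u. f u * g u) U"
  by (rule smooth_on_bounded_bilinear[OF bounded_bilinear_mult])

lemma smooth_on_sum:
  "open U \<Longrightarrow> (\<And>i. i \<in> A \<Longrightarrow> smooth_on (f i) U) \<Longrightarrow> smooth_on (\<lambda>u. \<Sum>i\<in>A. f i u) U"
  by (rule smooth_onI) (rule Ck_on_sum[OF _ smooth_onD])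

lemma smooth_on_prod:
  fixes f :: "'i \<Rightarrow> 'a::real_normed_vector \<Rightarrow> real"
  assumes "open U" "\<And>i. i \<in> A \<Longrightarrow> smooth_on (f i) U"
  shows "smooth_on (\<lambda>u. \<Prod>i\<in>A. f i u) U"
  using assms(2)
proof (induction A rule: infinite_finite_induct)
  case (insert i A)
  then show ?case using smooth_on_mult[OF assms(1), of "f i" "\<lambda>u. \<Prod>i\<in>A. f i u"] by simp
qed (simp_all add: smooth_on_const)

lemma smooth_on_inverse:
  fixes f :: "'a::real_normed_vector \<Rightarrow> real"
  shows "open U \<Longrightarrow> smooth_on f U \<Longrightarrow> (\<And>u. u \<in> U \<Longrightarrow> f u \<noteq> 0) \<Longrightarrow> smooth_on (\<lambda>u. inverse (f u)) U"
  by (rule smooth_onI) (rule Ck_on_inverse[OF _ _ smooth_onD])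

lemma smooth_on_divide:
  fixes f g :: "'a::real_normed_vector \<Rightarrow> real"
  assumes "open U" "smooth_on f U" "smooth_on g U" "\<And>u. u \<in> U \<Longrightarrow> g u \<noteq> 0"
  shows "smooth_on (\<lambda>u. f u / g u) U"
  using smooth_on_mult[OF assms(1,2) smooth_on_inverse[OF assms(1,3,4)]] by (simp add: divide_inverse)

lemma smooth_on_power:
  fixes f :: "'a::real_normed_vector \<Rightarrow> real"
  shows "open U \<Longrightarrow> smooth_on f U \<Longrightarrow> smooth_on (\<lambda>u. f u ^ n) U"
  by (induction n) (simp_all add: smooth_on_const smooth_on_mult[of U f])

lemma smooth_on_compose:
  fixes g :: "'a::real_normed_vector \<Rightarrow> 'b::euclidean_space"
  shows "open U \<Longrightarrow> smooth_on f V \<Longrightarrow> smooth_on g U \<Longrightarrow> (\<And>u. u \<in> U \<Longrightarrow> g u \<in> V)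
    \<Longrightarrow> smooth_on (\<lambda>u. f (g u)) U"
  by (rule smooth_onI) (rule Ck_on_compose[OF _ _ smooth_onD smooth_onD])

lemma smooth_on_vec_nth: "open U \<Longrightarrow> smooth_on f U \<Longrightarrow> smooth_on (\<lambda>u. f u $ i) U"
  using smooth_on_bounded_linear_comp[OF bounded_linear_vec_nth] .

text \<open>A vector valued map is the sum of its components times the constant basis vectors.\<close>

lemma smooth_on_vec_lambda:
  fixes f :: "'a::real_normed_vector \<Rightarrow> real^'n"
  assumes "open U" "\<And>i. smooth_on (\<lambda>u. f u $ i) U"
  shows "smooth_on f U"
proof -
  have "(\<lambda>u. f u) = (\<lambda>u. \<Sum>i\<in>UNIV. (f u $ i) *\<^sub>R axis i 1)"
    by (simp add: fun_eq_iff basis_expansion flip: scalar_mult_eq_scaleR)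
  moreover have "smooth_on (\<lambda>u. \<Sum>i\<in>UNIV. (f u $ i) *\<^sub>R axis i (1::real)) U"
    by (rule smooth_on_sum[OF assms(1) smooth_on_scaleR[OF assms smooth_on_const]])
  ultimately show ?thesis by (rule ssubst[where P = "\<lambda>f. smooth_on f U"])
qed

declare Ck_on.simps(2) [simp del]

section \<open>Second derivatives and smooth inverses\<close>

lemma Der_linear: "f differentiable (at u) \<Longrightarrow> linear (Der f u)"
  by (rule linear_frechet_derivative)

lemma Der_bounded_linear_comp:
  assumes "bounded_linear L" "f differentiable (at u)"
  shows "Der (\<lambda>u. L (f u)) u w = L (Der f u w)"
  using Der_eqI[OF bounded_linear.has_derivative[OF assms(1) Der_works[OF assms(2)]]] by simp

lemma has_derivative_along_line:
  assumes "f differentiable (at (p + t *\<^sub>R w))"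
  shows "((\<lambda>t. f (p + t *\<^sub>R w)) has_derivative (\<lambda>h. h *\<^sub>R Der f (p + t *\<^sub>R w) w)) (at t)"
proof -
  have "((\<lambda>t. p + t *\<^sub>R w) has_derivative (\<lambda>h. h *\<^sub>R w)) (at t)"
    by (auto intro!: derivative_eq_intros)
  from has_derivative_compose[OF this Der_works[OF assms]] show ?thesis
    by (simp add: linear_scale[OF Der_linear[OF assms]])
qed

lemma mean_value_along_line:
  fixes f :: "'a::real_normed_vector \<Rightarrow> real"
  assumes "0 < t" "\<And>\<tau>. 0 \<le> \<tau> \<Longrightarrow> \<tau> \<le> t \<Longrightarrow> f differentiable (at (p + \<tau> *\<^sub>R w))"
  obtains \<tau> where "0 < \<tau>" "\<tau> < t" "f (p + t *\<^sub>R w) - f p = t * Der f (p + \<tau> *\<^sub>R w) w"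
proof -
  have "DERIV (\<lambda>t. f (p + t *\<^sub>R w)) \<tau> :> Der f (p + \<tau> *\<^sub>R w) w" if "0 \<le> \<tau>" "\<tau> \<le> t" for \<tau>
    using has_derivative_along_line[OF assms(2)[OF that]]
    by (simp add: has_field_derivative_def mult.commute[of _ "Der f _ _"])
  from MVT2[OF assms(1) this] show ?thesis
    using that by auto
qed

text \<open>The second difference of \<open>f\<close> over a small parallelogram is, by two applications of the mean
  value theorem, a value of the mixed second derivative near the base point; exchanging the two
  sides of the parallelogram exchanges the order of differentiation.\<close>

lemma second_difference_eq_mixed_derivative:
  fixes f :: "'a::real_normed_vector \<Rightarrow> real"
  assumes f: "smooth_on f U" and B: "ball u r \<subseteq> U" and t: "0 < t" "t * (norm v + norm w) < r"
  obtains \<xi> where "dist u \<xi> \<le> t * (norm v + norm w)"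
    "f (u + t *\<^sub>R v + t *\<^sub>R w) - f (u + t *\<^sub>R v) - f (u + t *\<^sub>R w) + f u = t * (t * Der (\<lambda>x. Der f x v) \<xi> w)"
proof -
  have near: "dist u (u + a *\<^sub>R v + b *\<^sub>R w) \<le> t * (norm v + norm w)"
    if "0 \<le> a" "a \<le> t" "0 \<le> b" "b \<le> t" for a b
  proof -
    have "dist u (u + a *\<^sub>R v + b *\<^sub>R w) = norm (a *\<^sub>R v + b *\<^sub>R w)"
      unfolding dist_norm add.assoc by (metis add_diff_cancel_left' norm_minus_commute)
    also have "\<dots> \<le> norm (a *\<^sub>R v) + norm (b *\<^sub>R w)"
      by (rule norm_triangle_ineq)
    also have "\<dots> \<le> t * norm v + t * norm w"
      using that by (intro add_mono) (simp_all add: mult_right_mono)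
    finally show ?thesis by (simp add: distrib_left)
  qed
  then have inU: "u + a *\<^sub>R v + b *\<^sub>R w \<in> U" if "0 \<le> a" "a \<le> t" "0 \<le> b" "b \<le> t" for a b
    using near[OF that] t B by (intro subsetD[OF B]) simp
  define g where "g x = f (x + t *\<^sub>R w) - f x" for x
  have g: "(g has_derivative (\<lambda>h. Der f (u + a *\<^sub>R v + t *\<^sub>R w) h - Der f (u + a *\<^sub>R v) h)) (at (u + a *\<^sub>R v))"
    if "0 \<le> a" "a \<le> t" for a
  proof -
    have 1: "f differentiable (at (u + a *\<^sub>R v + t *\<^sub>R w))" "f differentiable (at (u + a *\<^sub>R v))"
      using inU[of a t] inU[of a 0] that t by (auto intro: smooth_on_differentiable[OF f])
    have "((\<lambda>x. x + t *\<^sub>R w) has_derivative (\<lambda>h. h)) (at (u + a *\<^sub>R v))"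
      by (auto intro!: derivative_eq_intros)
    from has_derivative_compose[OF this Der_works[OF 1(1)]] Der_works[OF 1(2)] show ?thesis
      unfolding g_def by (rule has_derivative_diff)
  qed
  obtain a where a: "0 < a" "a < t" "g (u + t *\<^sub>R v) - g u = t * Der g (u + a *\<^sub>R v) v"
    using mean_value_along_line[of t g u v] t g by (metis differentiableI)
  have "Der g (u + a *\<^sub>R v) v = Der f (u + a *\<^sub>R v + t *\<^sub>R w) v - Der f (u + a *\<^sub>R v) v"
    using a Der_eqI[OF g[of a]] by simp
  moreover obtain b where b: "0 < b" "b < t"
    "Der f (u + a *\<^sub>R v + t *\<^sub>R w) v - Der f (u + a *\<^sub>R v) v = t * Der (\<lambda>x. Der f x v) (u + a *\<^sub>R v + b *\<^sub>R w) w"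
  proof (rule mean_value_along_line[of t "\<lambda>x. Der f x v" "u + a *\<^sub>R v" w, OF t(1)])
    show "(\<lambda>x. Der f x v) differentiable at (u + a *\<^sub>R v + \<tau> *\<^sub>R w)" if "0 \<le> \<tau>" "\<tau> \<le> t" for \<tau>
      using smooth_on_differentiable[OF smooth_on_Der[OF f] inU] a that by simp
  qed (rule that)
  ultimately show ?thesis
    using a(3) near[of a b] a b by (intro that[of "u + a *\<^sub>R v + b *\<^sub>R w"]) (auto simp: g_def)
qed

lemma Der_Der_commute_real:
  fixes f :: "'a::real_normed_vector \<Rightarrow> real"
  assumes f: "smooth_on f U" and U: "open U" "u \<in> U"
  shows "Der (\<lambda>x. Der f x v) u w = Der (\<lambda>x. Der f x w) u v"
proof (rule ccontr)
  define A where "A v w x = Der (\<lambda>x. Der f x v) x w" for v w x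
  assume "Der (\<lambda>x. Der f x v) u w \<noteq> Der (\<lambda>x. Der f x w) u v"
  then have e: "\<bar>A v w u - A w v u\<bar> / 2 > 0" (is "?e > 0")
    by (simp add: A_def)
  have cont: "isCont (A v w) u" for v w
    using smooth_on_imp_continuous_on[OF smooth_on_Der[OF smooth_on_Der[OF f, of v], of w]] U
    by (simp add: A_def[abs_def] continuous_on_eq_continuous_at)
  obtain d1 where d1: "d1 > 0" "\<And>x. dist x u < d1 \<Longrightarrow> dist (A v w x) (A v w u) < ?e"
    using cont[of v w] e unfolding continuous_at_eps_delta by blast
  obtain d2 where d2: "d2 > 0" "\<And>x. dist x u < d2 \<Longrightarrow> dist (A w v x) (A w v u) < ?e"
    using cont[of w v] e unfolding continuous_at_eps_delta by blast
  obtain r where r: "r > 0" "ball u r \<subseteq> U"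
    using U open_contains_ball by blast
  define \<rho> where "\<rho> = min r (min d1 d2)"
  have \<rho>: "\<rho> > 0" using d1 d2 r by (simp add: \<rho>_def)
  define t where "t = \<rho> / (2 * (norm v + norm w + 1))"
  have t: "t > 0" using \<rho> by (simp add: t_def add_nonneg_pos)
  have "t * (norm v + norm w) < t * (2 * (norm v + norm w + 1))"
    using t by (intro mult_strict_left_mono) (simp_all add: add_nonneg_pos)
  also have "\<dots> = \<rho>" 
    using add_nonneg_pos[of "norm v + norm w" 1] by (simp add: t_def)
  finally have small: "t * (norm v + norm w) < \<rho>" .
  have sr: "t * (norm v + norm w) < r" "t * (norm w + norm v) < r"
    using small by (simp_all add: \<rho>_def add.commute)
  obtain \<xi> where \<xi>: "dist u \<xi> \<le> t * (norm v + norm w)"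
    "f (u + t *\<^sub>R v + t *\<^sub>R w) - f (u + t *\<^sub>R v) - f (u + t *\<^sub>R w) + f u = t * (t * A v w \<xi>)"
    by (rule second_difference_eq_mixed_derivative[OF f r(2) t sr(1)]) (erule that, simp only: A_def)
  obtain \<eta> where \<eta>: "dist u \<eta> \<le> t * (norm w + norm v)"
    "f (u + t *\<^sub>R w + t *\<^sub>R v) - f (u + t *\<^sub>R w) - f (u + t *\<^sub>R v) + f u = t * (t * A w v \<eta>)"
    by (rule second_difference_eq_mixed_derivative[OF f r(2) t sr(2)]) (erule that, simp only: A_def)
  have "t * (t * A v w \<xi>) = t * (t * A w v \<eta>)"
    using \<xi>(2) \<eta>(2) by (simp add: algebra_simps)
  then have "A v w \<xi> = A w v \<eta>" using t by simp
  moreover have "dist (A v w \<xi>) (A v w u) < ?e"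
    using \<xi>(1) small by (intro d1(2)) (simp add: \<rho>_def dist_commute)
  moreover have "dist (A w v \<eta>) (A w v u) < ?e"
    using \<eta>(1) small by (intro d2(2)) (simp add: \<rho>_def dist_commute add.commute)
  ultimately show False unfolding dist_real_def by (simp only:) argo
qed

lemma Der_Der_commute:
  fixes f :: "'a::real_normed_vector \<Rightarrow> 'b::euclidean_space"
  assumes f: "smooth_on f U" and U: "open U" "u \<in> U"
  shows "Der (\<lambda>x. Der f x v) u w = Der (\<lambda>x. Der f x w) u v"
proof (rule euclidean_eqI)
  fix b :: 'b assume "b \<in> Basis"
  note L = bounded_linear_inner_left[of b]
  have fb: "smooth_on (\<lambda>x. f x \<bullet> b) U"
    by (rule smooth_on_bounded_linear_comp[OF L U(1) f])
  have "Der (\<lambda>x. Der f x v) u w \<bullet> b = Der (\<lambda>x. Der (\<lambda>x. f x \<bullet> b) x v) u w" for v w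
  proof -
    have "Der (\<lambda>x. Der f x v) u w \<bullet> b = Der (\<lambda>x. Der f x v \<bullet> b) u w"
      by (rule Der_bounded_linear_comp[OF L smooth_on_differentiable[OF smooth_on_Der[OF f] U(2)], symmetric])
    also have "\<dots> = Der (\<lambda>x. Der (\<lambda>x. f x \<bullet> b) x v) u w"
      by (intro fun_cong[OF frechet_derivative_transform_within_open[OF _ U]])
        (simp_all add: Der_bounded_linear_comp[OF L] smooth_on_differentiable[OF f]
          differentiableI[OF bounded_linear.has_derivative[OF L smooth_on_derivative[OF smooth_on_Der[OF f] U(2)]]])
    finally show ?thesis .
  qed
  then show "Der (\<lambda>x. Der f x v) u w \<bullet> b = Der (\<lambda>x. Der f x w) u v \<bullet> b"
    using Der_Der_commute_real[OF fb U] by simp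
qed

text \<open>The derivative is continuous in the operator norm because it is continuous in each of the finitely
  many basis directions, and then a map that is nearly linear and injective is injective nearby.\<close>

lemma locally_injective_of_injective_derivative:
  fixes f :: "'a::euclidean_space \<Rightarrow> 'b::euclidean_space"
  assumes U: "open U" "a \<in> U" and f: "smooth_on f U" and inj: "inj (Der f a)"
  obtains r where "r > 0" "ball a r \<subseteq> U" "inj_on f (ball a r)"
proof -
  note da = smooth_on_differentiable[OF f]
  obtain g' where g': "linear g'" "g' \<circ> Der f a = id"
    using linear_injective_left_inverse[OF Der_linear[OF da[OF U(2)]] inj] by blast
  have on: "\<exists>d>0. \<forall>x. dist a x < d \<longrightarrow> onorm (\<lambda>v. Der f x v - Der f a v) < e" if "e > 0" for e
  proof -
    define e' where "e' = e / (2 * DIM('a))"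
    have e': "e' > 0" using that by (simp add: e'_def)
    have "\<forall>\<^sub>F x in nhds a. norm (Der f x i - Der f a i) < e'" for i
    proof -
      have "isCont (\<lambda>x. Der f x i) a"
        using smooth_on_imp_continuous_on[OF smooth_on_Der[OF f]] U
        by (simp add: continuous_on_eq_continuous_at)
      then show ?thesis
        using e' by (simp add: continuous_at_eps_delta dist_norm eventually_nhds_metric) 
    qed
    then have "\<forall>\<^sub>F x in nhds a. \<forall>i\<in>Basis. norm (Der f x i - Der f a i) < e'"
      by (simp add: eventually_ball_finite)
    moreover have "\<forall>\<^sub>F x in nhds a. x \<in> U"
      using U eventually_nhds_in_open by blast
    ultimately have "\<forall>\<^sub>F x in nhds a. onorm (\<lambda>v. Der f x v - Der f a v) < e"
    proof eventually_elim
      case (elim x)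
      have bl: "bounded_linear (\<lambda>v. Der f x v - Der f a v)"
        using Der_linear[OF da] elim U(2)
        by (simp add: bounded_linear_sub linear_conv_bounded_linear)
      have "onorm (\<lambda>v. Der f x v - Der f a v) \<le> (\<Sum>i\<in>Basis. norm (Der f x i - Der f a i))"
        by (rule onorm_componentwise[OF bl])
      also have "\<dots> \<le> (\<Sum>i\<in>(Basis :: 'a set). e')"
        using elim by (intro sum_mono) (simp add: less_imp_le)
      also have "\<dots> = e / 2" by (simp add: e'_def)
      finally show ?case using that by simp
    qed
    then show ?thesis by (auto simp: eventually_nhds_metric dist_commute)
  qed
  have bl: "bounded_linear g'"
    using g'(1) linear_conv_bounded_linear by blast
  show ?thesis
    by (rule has_derivative_locally_injective[OF U(2,1) bl g'(2) smooth_on_derivative[OF f] on])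
      (assumption, assumption, rule that)
qed

text \<open>The derivative of the inverse is the reciprocal of \<open>\<sigma>'\<close> composed with the inverse, so each order
  of differentiability of \<open>g\<close> yields the next one.\<close>

lemma smooth_on_real_inverse:
  fixes \<sigma> g :: "real \<Rightarrow> real"
  assumes J: "open J" and S: "open S" and \<sigma>: "smooth_on \<sigma> J" and nz: "\<And>t. t \<in> J \<Longrightarrow> Der \<sigma> t 1 \<noteq> 0"
    and g: "continuous_on S g" "\<And>y. y \<in> S \<Longrightarrow> g y \<in> J" "\<And>y. y \<in> S \<Longrightarrow> \<sigma> (g y) = y"
  shows "smooth_on g S"
proof (rule smooth_onI)
  have der: "(g has_derivative (\<lambda>w. w * inverse (Der \<sigma> (g y) 1))) (at y)" if y: "y \<in> S" for y
  proof -
    have "DERIV \<sigma> (g y) :> Der \<sigma> (g y) 1"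
    proof -
      have d: "\<sigma> differentiable (at (g y))"
        using smooth_on_differentiable[OF \<sigma> g(2)[OF y]] .
      have "Der \<sigma> (g y) = (*) (Der \<sigma> (g y) 1)"
      proof
        fix w
        show "Der \<sigma> (g y) w = Der \<sigma> (g y) 1 * w"
          using linear_scale[OF Der_linear[OF d], of w 1]
          by (simp only: real_scaleR_def mult_1_right mult.commute[of w])
      qed
      then show ?thesis using Der_works[OF d] by (simp add: has_field_derivative_def)
    qed
    moreover obtain r where r: "r > 0" "ball y r \<subseteq> S"
      using S y open_contains_ball by blast
    have "\<sigma> (g z) = z" if "y - r < z" "z < y + r" for z
      using r that by (intro g(3) subsetD[OF r(2)]) (auto simp: dist_real_def)
    moreover have "isCont g y" using g(1) S y by (simp add: continuous_on_eq_continuous_at)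
    ultimately have "DERIV g y :> inverse (Der \<sigma> (g y) 1)"
      using r nz[OF g(2)[OF y]] by (intro DERIV_inverse_function[where a="y - r" and b="y + r"]) auto
    then show ?thesis by (simp add: has_field_derivative_def mult.commute[of _ "inverse _"])
  qed
  show "Ck_on k g S" for k
  proof (induction k)
    case 0
    then show ?case using g by simp
  next
    case (Suc k)
    have "Ck_on k (\<lambda>y. Der \<sigma> (g y) 1) S"
      by (rule Ck_on_compose[OF S g(2) Suc smooth_onD[OF smooth_on_Der[OF \<sigma>]]])
    then have "Ck_on k (\<lambda>y. w * inverse (Der \<sigma> (g y) 1)) S" for w
      by (intro Ck_on_bounded_bilinear[OF bounded_bilinear_mult S Ck_on_const] Ck_on_inverse S nz g(2))
    then show ?case using Ck_on_SucI[OF S der] by blast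
  qed
qed

section \<open>Factoring through a submersion\<close>

lemma invariant_along_line:
  fixes F :: "'a::real_normed_vector \<Rightarrow> real"
  assumes "convex S" "p \<in> S" "q \<in> S" "\<And>z. z \<in> S \<Longrightarrow> F differentiable (at z)"
    "\<And>z. z \<in> S \<Longrightarrow> Der F z (q - p) = 0"
  shows "F q = F p"
proof -
  have "p + \<tau> *\<^sub>R (q - p) \<in> S" if "0 \<le> \<tau>" "\<tau> \<le> 1" for \<tau>
    using convexD_alt[OF assms(1-3) that] by (simp add: algebra_simps)
  then obtain \<tau> where "F (p + 1 *\<^sub>R (q - p)) - F p = 1 * Der F (p + \<tau> *\<^sub>R (q - p)) (q - p)"
      "0 < \<tau>" "\<tau> < 1"
    using mean_value_along_line[of 1 F p "q - p"] assms(4) by (metis zero_less_one)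
  moreover have "Der F (p + \<tau> *\<^sub>R (q - p)) (q - p) = 0"
    using calculation \<open>\<And>\<tau>. \<lbrakk>0 \<le> \<tau>; \<tau> \<le> 1\<rbrakk> \<Longrightarrow> p + \<tau> *\<^sub>R (q - p) \<in> S\<close> assms(5) by simp
  ultimately show ?thesis by simp
qed

text \<open>A line transverse to the level sets of \<open>s\<close> locally meets each of them once. Straightening the level
  sets by \<open>\<Phi>\<close>, which replaces the coordinate along \<open>w\<close> by \<open>s\<close>, shows that \<open>F\<close> takes at every point
  the value that it has where the line meets the level set of that point; along the line \<open>s\<close> has a
  smooth inverse.\<close>

lemma factor_through_submersion:
  fixes s F :: "'a::euclidean_space \<Rightarrow> real"
  assumes U: "open U" "u0 \<in> U" and s: "smooth_on s U" and F: "smooth_on F U"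
    and nz: "Der s u0 v \<noteq> 0"
    and ker: "\<And>u w. u \<in> U \<Longrightarrow> Der s u w = 0 \<Longrightarrow> Der F u w = 0"
  obtains r I f where "r > 0" "ball u0 r \<subseteq> U" "open I" "is_interval I" "smooth_on f I"
    "\<And>u. u \<in> ball u0 r \<Longrightarrow> s u \<in> I \<and> F u = f (s u)"
proof -
  have ds: "s differentiable (at u)" if "u \<in> U" for u
    using smooth_on_differentiable[OF s that] .
  have "v \<noteq> 0" using nz linear_0[OF Der_linear[OF ds[OF U(2)]]] by auto
  define w where "w = v /\<^sub>R norm v"
  have w: "w \<bullet> w = 1" using \<open>v \<noteq> 0\<close> by (simp add: w_def dot_square_norm)
  have nzw: "Der s u0 w \<noteq> 0"
    using nz \<open>v \<noteq> 0\<close> by (simp add: w_def linear_scale[OF Der_linear[OF ds[OF U(2)]]])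
  define U1 where "U1 = {u \<in> U. Der s u w \<noteq> 0}"
  have cDs: "continuous_on U (\<lambda>u. Der s u w)"
    by (rule smooth_on_imp_continuous_on[OF smooth_on_Der[OF s]])
  have U1: "open U1" "u0 \<in> U1" "U1 \<subseteq> U"
    using continuous_open_preimage[OF cDs U(1), of "- {0}"] U nzw
    by (auto simp: U1_def vimage_def Int_def)
  \<comment> \<open>\<open>(\<Phi> u - u0) \<bullet> w = s u - s u0\<close>, and the components orthogonal to \<open>w\<close> are those of \<open>u\<close>.\<close>
  define \<Phi> where "\<Phi> u = u + (s u - s u0 - (u - u0) \<bullet> w) *\<^sub>R w" for u
  have smooth\<Phi>: "smooth_on \<Phi> U1"
    unfolding \<Phi>_def
    by (intro smooth_on_add[OF U1(1)] smooth_on_scaleR[OF U1(1)] smooth_on_diff[OF U1(1)]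
        smooth_on_inner[OF U1(1)] smooth_on_const smooth_on_subset[OF s U1(3)]
        smooth_on_subset[OF smooth_on_bounded_linear[OF bounded_linear_ident] subset_UNIV])
  have d\<Phi>: "(\<Phi> has_derivative (\<lambda>h. h + (Der s u h - h \<bullet> w) *\<^sub>R w)) (at u)" if "u \<in> U" for u
    unfolding \<Phi>_def by (rule derivative_eq_intros Der_works[OF ds[OF that]] refl | simp)+
  have inj\<Phi>: "inj (\<lambda>h. h + (Der s u h - h \<bullet> w) *\<^sub>R w)" if "u \<in> U1" for u
  proof -
    have l: "linear (\<lambda>h. h + (Der s u h - h \<bullet> w) *\<^sub>R w)"
      using has_derivative_linear[OF d\<Phi>] that U1 by blast
    have "h = 0" if "h + (Der s u h - h \<bullet> w) *\<^sub>R w = 0" for h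
    proof -
      define c where "c = - (Der s u h - h \<bullet> w)"
      have "h + - c *\<^sub>R w = 0" using that by (simp only: c_def minus_minus)
      then have h: "h = c *\<^sub>R w" by simp
      have "h \<bullet> w = c" using h w by simp
      moreover have "Der s u h = c * Der s u w"
        using h linear_scale[OF Der_linear[OF ds]] \<open>u \<in> U1\<close> U1(3) by auto
      ultimately have "c * Der s u w = 0" using c_def by linarith
      then show "h = 0" using h \<open>u \<in> U1\<close> by (simp add: U1_def)
    qed
    then show ?thesis using linear_injective_0[OF l] by blast
  qed
  have "inj (Der \<Phi> u0)" using Der_eqI[OF d\<Phi>[OF U(2)]] inj\<Phi>[OF U1(2)] by simp
  then obtain r where r: "r > 0" "ball u0 r \<subseteq> U1" "inj_on \<Phi> (ball u0 r)"
    by (rule locally_injective_of_injective_derivative[OF U1(1,2) smooth\<Phi>])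
  define B where "B = ball u0 r"
  have B: "open B" "u0 \<in> B" "B \<subseteq> U" "B \<subseteq> U1" "inj_on \<Phi> B"
    using r U1 by (auto simp: B_def)
  define G where "G = inv_into B \<Phi>"
  have G\<Phi>: "G (\<Phi> u) = u" if "u \<in> B" for u
    using that B by (simp add: G_def)
  have \<Phi>G: "\<Phi> (G z) = z" "G z \<in> B" if "z \<in> \<Phi> ` B" for z
    using that by (auto simp: G_def f_inv_into_f inv_into_into)
  have cont\<Phi>: "continuous_on B \<Phi>"
    using smooth_on_imp_continuous_on[OF smooth\<Phi>] B continuous_on_subset by blast
  have "open (\<Phi> ` B)"
    using invariance_of_domain[OF cont\<Phi> B(1,5)] .
  moreover have \<Phi>0: "\<Phi> u0 = u0" by (simp add: \<Phi>_def)
  then have "u0 \<in> \<Phi> ` B" using B(2) by (metis imageI)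
  ultimately obtain \<rho> where \<rho>: "\<rho> > 0" "ball u0 \<rho> \<subseteq> \<Phi> ` B"
    using open_contains_ball by blast
  have contG: "continuous_on (\<Phi> ` B) G"
    using continuous_on_inverse_open[OF B(1) cont\<Phi> _ G\<Phi>] by simp
  have dG: "\<exists>G'. (G has_derivative G') (at z) \<and> (\<forall>h. Der s (G z) (G' h) = h \<bullet> w)" if "z \<in> \<Phi> ` B" for z
  proof -
    define \<Phi>' where "\<Phi>' h = h + (Der s (G z) h - h \<bullet> w) *\<^sub>R w" for h
    have d: "(\<Phi> has_derivative \<Phi>') (at (G z))"
      unfolding \<Phi>'_def using d\<Phi> \<Phi>G(2)[OF that] B by blast
    have l: "linear \<Phi>'" by (rule has_derivative_linear[OF d])
    moreover have "inj \<Phi>'" unfolding \<Phi>'_def using inj\<Phi> \<Phi>G(2)[OF that] B by blast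
    ultimately obtain G' where G': "linear G'" "\<Phi>' \<circ> G' = id"
      using linear_injective_isomorphism[of \<Phi>'] by (auto simp: fun_eq_iff)
    have "(G has_derivative G') (at z)"
      using has_derivative_inverse_strong[OF B(1) \<Phi>G(2)[OF that] cont\<Phi> G\<Phi> d G'(2)] \<Phi>G(1)[OF that]
      by simp
    moreover have "Der s (G z) (G' h) = h \<bullet> w" for h
    proof -
      have "h \<bullet> w = \<Phi>' (G' h) \<bullet> w" using G'(2) by (metis comp_apply id_apply)
      also have "\<dots> = Der s (G z) (G' h)" by (simp add: \<Phi>'_def inner_add_left w)
      finally show ?thesis by simp
    qed
    ultimately show ?thesis by blast
  qed
  define z' where "z' y = u0 + (y - s u0) *\<^sub>R w" for y
  define I where "I = {s u0 - \<rho> <..< s u0 + \<rho>}"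
  have z'ball: "z' y \<in> ball u0 \<rho>" if "y \<in> I" for y
  proof -
    have "dist u0 (z' y) = norm ((y - s u0) *\<^sub>R w)"
      unfolding z'_def dist_norm by (metis add_diff_cancel_left' norm_minus_commute)
    also have "\<dots> = \<bar>y - s u0\<bar>" using w by (simp add: norm_eq_sqrt_inner)
    finally show ?thesis using that by (auto simp: I_def)
  qed
  define g where "g y = (G (z' y) - u0) \<bullet> w" for y
  have Gz': "G (z' y) = u0 + g y *\<^sub>R w" "s (G (z' y)) = y" if "y \<in> I" for y
  proof -
    define u where "u = G (z' y)"
    have "\<Phi> u = z' y" using \<Phi>G(1) z'ball[OF that] \<rho> by (auto simp: u_def)
    then have e: "u - u0 = (y - s u + (u - u0) \<bullet> w) *\<^sub>R w"
      by (simp add: \<Phi>_def z'_def algebra_simps)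
    have "(u - u0) \<bullet> w = y - s u + (u - u0) \<bullet> w"
      by (subst e) (simp add: w)
    then have s: "s u = y" by simp
    then show "s (G (z' y)) = y" by (simp add: u_def)
    show "G (z' y) = u0 + g y *\<^sub>R w"
      using e by (simp add: s g_def flip: u_def)
  qed
  have F_line: "F (G z) = F (G (z' ((z - u0) \<bullet> w + s u0)))" if z: "z \<in> ball u0 \<rho>" for z
  proof (rule invariant_along_line[of "ball u0 \<rho>" _ _ "\<lambda>z. F (G z)"])
    have "\<bar>(z - u0) \<bullet> w\<bar> \<le> norm (z - u0) * norm w" by (rule Cauchy_Schwarz_ineq2)
    also have "norm w = 1" using w by (simp add: norm_eq_sqrt_inner)
    finally show "z' ((z - u0) \<bullet> w + s u0) \<in> ball u0 \<rho>"
      using z by (intro z'ball) (auto simp: I_def dist_norm norm_minus_commute)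
    fix x assume x: "x \<in> ball u0 \<rho>"
    then obtain G' where G': "(G has_derivative G') (at x)" "\<And>h. Der s (G x) (G' h) = h \<bullet> w"
      using dG \<rho> by blast
    have Gx: "G x \<in> U" using \<Phi>G(2) x \<rho> B by blast
    have d: "((\<lambda>z. F (G z)) has_derivative (\<lambda>h. Der F (G x) (G' h))) (at x)"
      using has_derivative_compose[OF G'(1) smooth_on_derivative[OF F Gx]] .
    then show "(\<lambda>z. F (G z)) differentiable (at x)" by (rule differentiableI)
    have "(z - z' ((z - u0) \<bullet> w + s u0)) \<bullet> w = 0"
      by (simp add: z'_def w inner_diff_left inner_add_left)
    then show "Der (\<lambda>z. F (G z)) x (z - z' ((z - u0) \<bullet> w + s u0)) = 0"
      using Der_eqI[OF d] ker[OF Gx] G'(2) by simp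
  qed (use z in auto)
  define J where "J = (\<lambda>t. u0 + t *\<^sub>R w) -` B"
  have "open J" unfolding J_def
    by (intro open_vimage B(1) continuous_intros)
  have line: "smooth_on (\<lambda>t. u0 + t *\<^sub>R w) S" if "open S" for S :: "real set"
    by (intro smooth_on_add[OF that] smooth_on_scaleR[OF that] smooth_on_const
        smooth_on_subset[OF smooth_on_bounded_linear[OF bounded_linear_ident] subset_UNIV])
  have "open I" by (simp add: I_def)
  have "smooth_on g I"
  proof (rule smooth_on_real_inverse[OF \<open>open J\<close> \<open>open I\<close>, of "\<lambda>t. s (u0 + t *\<^sub>R w)"])
    show "smooth_on (\<lambda>t. s (u0 + t *\<^sub>R w)) J"
      using B by (intro smooth_on_compose[OF \<open>open J\<close> s line[OF \<open>open J\<close>]]) (auto simp: J_def)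
    show "Der (\<lambda>t. s (u0 + t *\<^sub>R w)) t 1 \<noteq> 0" if "t \<in> J" for t
    proof -
      have t: "u0 + t *\<^sub>R w \<in> U1" using that B by (auto simp: J_def)
      show ?thesis
        using Der_eqI[OF has_derivative_along_line[OF ds]] t by (auto simp: U1_def)
    qed
    show "continuous_on I g"
      unfolding g_def using z'ball \<rho>
      by (intro continuous_intros continuous_on_compose2[OF contG]) (auto simp: z'_def intro!: continuous_intros)
    show "g y \<in> J" "s (u0 + g y *\<^sub>R w) = y" if "y \<in> I" for y
      using Gz'[OF that] \<Phi>G(2)[of "z' y"] z'ball[OF that] \<rho> by (auto simp: J_def)
  qed
  define f where "f y = F (u0 + g y *\<^sub>R w)" for y
  have "smooth_on f I"
    unfolding f_def
  proof (rule smooth_on_compose[OF \<open>open I\<close> F])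
    show "smooth_on (\<lambda>y. u0 + g y *\<^sub>R w) I"
      using smooth_on_compose[OF \<open>open I\<close> line[OF open_UNIV] \<open>smooth_on g I\<close>] by simp
    show "u0 + g y *\<^sub>R w \<in> U" if "y \<in> I" for y
      using \<Phi>G(2)[OF subsetD[OF \<rho>(2) z'ball[OF that]]] B(3) unfolding Gz'(1)[OF that] by blast
  qed
  have key: "s u \<in> I \<and> F u = f (s u)" if u: "u \<in> B" "\<Phi> u \<in> ball u0 \<rho>" for u
  proof -
    have e: "(\<Phi> u - u0) \<bullet> w + s u0 = s u"
      by (simp add: \<Phi>_def w inner_diff_left inner_add_left)
    have "\<bar>(\<Phi> u - u0) \<bullet> w\<bar> \<le> norm (\<Phi> u - u0) * norm w" by (rule Cauchy_Schwarz_ineq2)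
    also have "norm w = 1" using w by (simp add: norm_eq_sqrt_inner)
    finally have sI: "s u \<in> I"
      using u(2) e by (auto simp: I_def dist_norm norm_minus_commute)
    have "F u = F (G (\<Phi> u))" by (simp add: G\<Phi>[OF u(1)])
    also have "\<dots> = f (s u)"
      using F_line[OF u(2)] Gz'(1)[OF sI] by (simp add: e f_def)
    finally show ?thesis using sI by blast
  qed
  have "open (B \<inter> \<Phi> -` ball u0 \<rho>)"
    using continuous_open_preimage[OF cont\<Phi> B(1) open_ball] .
  moreover have "u0 \<in> B \<inter> \<Phi> -` ball u0 \<rho>" using B \<Phi>0 \<rho> by simp
  ultimately obtain r' where r': "r' > 0" "ball u0 r' \<subseteq> B \<inter> \<Phi> -` ball u0 \<rho>"
    using open_contains_ball by blast
  show ?thesis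
  proof (rule that[OF r'(1) _ \<open>open I\<close> _ \<open>smooth_on f I\<close>])
    show "ball u0 r' \<subseteq> U" using r' B by blast
    show "is_interval I" by (simp add: I_def is_interval_oo)
    show "s u \<in> I \<and> F u = f (s u)" if "u \<in> ball u0 r'" for u
      using key r' that by blast
  qed
qed

section \<open>Elementary smooth functions\<close>

lemma has_real_derivative_imp_has_derivative:
  "(f has_real_derivative D) (at x) \<Longrightarrow> (f has_derivative (\<lambda>w. w * D)) (at x)"
  by (rule has_derivative_eq_rhs[OF has_field_derivative_imp_has_derivative]) (auto simp: mult.commute)

text \<open>The functions that occur in the models satisfy differential equations of first order, which raise
  their order of differentiability one step at a time.\<close>

lemma smooth_on_sin_cos: "smooth_on (sin :: real \<Rightarrow> real) UNIV" "smooth_on (cos :: real \<Rightarrow> real) UNIV"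
proof -
  have "Ck_on k (sin :: real \<Rightarrow> real) UNIV \<and> Ck_on k (cos :: real \<Rightarrow> real) UNIV" for k
  proof (induction k)
    case (Suc k)
    note M = Ck_on_bounded_bilinear[OF bounded_bilinear_mult open_UNIV Ck_on_const]
    have "Ck_on k (\<lambda>x::real. w * - sin x) UNIV" for w
      using M[OF Ck_on_bounded_linear_comp[OF bounded_linear_minus[OF bounded_linear_ident] open_UNIV]] Suc
      by blast
    then have "Ck_on (Suc k) (cos :: real \<Rightarrow> real) UNIV"
      by (intro Ck_on_SucI[OF open_UNIV has_real_derivative_imp_has_derivative[OF DERIV_cos]])
    moreover have "Ck_on (Suc k) (sin :: real \<Rightarrow> real) UNIV"
      by (intro Ck_on_SucI[OF open_UNIV has_real_derivative_imp_has_derivative[OF DERIV_sin]] M)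
        (use Suc in blast)
    ultimately show ?case by blast
  qed (simp add: continuous_on_sin continuous_on_cos)
  then show "smooth_on (sin :: real \<Rightarrow> real) UNIV" "smooth_on (cos :: real \<Rightarrow> real) UNIV"
    by (auto intro!: smooth_onI)
qed

lemma smooth_on_sinh_cosh: "smooth_on (sinh :: real \<Rightarrow> real) UNIV" "smooth_on (cosh :: real \<Rightarrow> real) UNIV"
proof -
  have "Ck_on k (sinh :: real \<Rightarrow> real) UNIV \<and> Ck_on k (cosh :: real \<Rightarrow> real) UNIV" for k
  proof (induction k)
    case (Suc k)
    note M = Ck_on_bounded_bilinear[OF bounded_bilinear_mult open_UNIV Ck_on_const]
    have ds: "(sinh has_real_derivative cosh x) (at x)" "(cosh has_real_derivative sinh x) (at x)" for x :: real
      by (auto intro!: derivative_eq_intros)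
    have "Ck_on (Suc k) (cosh :: real \<Rightarrow> real) UNIV"
      by (intro Ck_on_SucI[OF open_UNIV has_real_derivative_imp_has_derivative[OF ds(2)]] M)
        (use Suc in blast)
    moreover have "Ck_on (Suc k) (sinh :: real \<Rightarrow> real) UNIV"
      by (intro Ck_on_SucI[OF open_UNIV has_real_derivative_imp_has_derivative[OF ds(1)]] M)
        (use Suc in blast)
    ultimately show ?case by blast
  qed (simp add: continuous_on_sinh continuous_on_cosh)
  then show "smooth_on (sinh :: real \<Rightarrow> real) UNIV" "smooth_on (cosh :: real \<Rightarrow> real) UNIV"
    by (auto intro!: smooth_onI)
qed

lemma smooth_on_sqrt: "smooth_on sqrt {0<..}"
proof (rule smooth_onI)
  show "Ck_on k sqrt {0<..}" for k
  proof (induction k)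
    case 0
    then show ?case by (simp add: continuous_on_real_sqrt)
  next
    case (Suc k)
    note M = Ck_on_bounded_bilinear[OF bounded_bilinear_mult open_greaterThan Ck_on_const]
    show ?case
    proof (rule Ck_on_SucI[OF open_greaterThan])
      show "(sqrt has_derivative (\<lambda>w. w * (inverse (sqrt x) / 2))) (at x)" if "x \<in> {0<..}" for x
        using DERIV_real_sqrt[of x] that by (intro has_real_derivative_imp_has_derivative) simp
      have "Ck_on k (\<lambda>x. inverse (sqrt x)) {0<..}"
        by (rule Ck_on_inverse[OF open_greaterThan _ Suc]) simp
      then show "Ck_on k (\<lambda>x. w * (inverse (sqrt x) / 2)) {0<..}" for w
        by (intro M Ck_on_bounded_linear_comp[OF bounded_linear_divide open_greaterThan])
    qed
  qed
qed

section \<open>Change of chart\<close>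

text \<open>Composing with a left inverse \<open>L\<close> of \<open>Y'\<close> gives a map \<open>P\<close> that is the identity to first order, so
  \<open>\<tau>\<close> differs from the differentiable map \<open>P \<circ> \<tau>\<close> by an error that is small compared with \<open>\<tau> z - \<tau> u\<close>.
  As \<open>\<tau>\<close> is continuous, this bounds \<open>\<tau> z - \<tau> u\<close> by a multiple of \<open>z - u\<close> and makes the error \<open>o(z - u)\<close>.\<close>

lemma lift_through_immersion_has_derivative:
  fixes Y :: "'a::euclidean_space \<Rightarrow> 'b::euclidean_space" and \<tau> :: "'c::euclidean_space \<Rightarrow> 'a"
  assumes Y: "(Y has_derivative Y') (at (\<tau> u))" and L: "bounded_linear L" "\<And>w. L (Y' w) = w"
    and Z: "((\<lambda>z. Y (\<tau> z)) has_derivative Z') (at u)" and cont: "isCont \<tau> u"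
  shows "(\<tau> has_derivative (\<lambda>w. L (Z' w))) (at u)"
proof -
  define P where "P z = L (Y z)" for z
  have P: "(P has_derivative (\<lambda>w. w)) (at (\<tau> u))"
    using bounded_linear.has_derivative[OF L(1) Y] L(2) by (simp add: P_def[abs_def])
  have Q: "((\<lambda>z. P (\<tau> z)) has_derivative (\<lambda>w. L (Z' w))) (at u)"
    using bounded_linear.has_derivative[OF L(1) Z] by (simp add: P_def[abs_def])
  let ?Q' = "\<lambda>w. L (Z' w)"
  have bl: "bounded_linear ?Q'" using Q by (rule has_derivative_bounded_linear)
  obtain K where K: "K > 0" "\<And>w. norm (?Q' w) \<le> norm w * K"
    using bounded_linear.pos_bounded[OF bl] by blast
  show ?thesis
    unfolding has_derivative_at_alt
  proof (intro conjI allI impI bl)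
    fix e :: real assume e: "e > 0"
    \<comment> \<open>The bound 1/2 allows the error to be absorbed, which leaves \<open>norm (\<tau> z - \<tau> u) \<le> (1 + 2 * K) * norm (z - u)\<close>.\<close>
    define c where "c = min (1/2) (e / (2 * K + 3))"
    have c: "c > 0" "c \<le> 1/2" "c * (2 * K + 3) \<le> e"
    proof -
      show "c > 0" using e K by (simp add: c_def)
      show "c \<le> 1/2" unfolding c_def by (rule min.cobounded1)
      have "c \<le> e / (2 * K + 3)" by (simp add: c_def)
      then show "c * (2 * K + 3) \<le> e" using K by (simp add: pos_le_divide_eq)
    qed
    obtain d1 where d1: "d1 > 0" "\<And>z. norm (z - \<tau> u) < d1 \<Longrightarrow> norm (P z - P (\<tau> u) - (z - \<tau> u)) \<le> c * norm (z - \<tau> u)"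
      using P c(1) unfolding has_derivative_at_alt by blast
    obtain d2 where d2: "d2 > 0" "\<And>z. norm (z - u) < d2 \<Longrightarrow> norm (P (\<tau> z) - P (\<tau> u) - ?Q' (z - u)) \<le> c * norm (z - u)"
      using Q c(1) unfolding has_derivative_at_alt by blast
    obtain d3 where d3: "d3 > 0" "\<And>z. dist z u < d3 \<Longrightarrow> dist (\<tau> z) (\<tau> u) < d1"
      using cont d1(1) unfolding continuous_at_eps_delta by blast
    show "\<exists>d>0. \<forall>z. norm (z - u) < d \<longrightarrow> norm (\<tau> z - \<tau> u - ?Q' (z - u)) \<le> e * norm (z - u)"
    proof (intro exI[of _ "min d2 d3"] conjI allI impI)
      show "min d2 d3 > 0" using d2 d3 by simp
      fix z assume z: "norm (z - u) < min d2 d3"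
      define a where "a = norm (\<tau> z - \<tau> u)"
      define b where "b = norm (z - u)"
      have "norm (\<tau> z - \<tau> u) < d1" using d3(2)[of z] z by (simp add: dist_norm)
      then have 1: "norm (P (\<tau> z) - P (\<tau> u) - (\<tau> z - \<tau> u)) \<le> c * a"
        using d1(2) by (simp add: a_def)
      have 2: "norm (P (\<tau> z) - P (\<tau> u) - ?Q' (z - u)) \<le> c * b"
        using d2(2) z by (simp add: b_def)
      have 3: "norm (\<tau> z - \<tau> u - ?Q' (z - u)) \<le> c * a + c * b"
      proof -
        have e: "\<tau> z - \<tau> u - ?Q' (z - u)
            = (P (\<tau> z) - P (\<tau> u) - ?Q' (z - u)) - (P (\<tau> z) - P (\<tau> u) - (\<tau> z - \<tau> u))"
          by simp
        show ?thesis
          unfolding e by (rule order_trans[OF norm_triangle_ineq4]) (use 1 2 in linarith)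
      qed
      have "a \<le> norm (\<tau> z - \<tau> u - ?Q' (z - u)) + norm (?Q' (z - u))"
        using norm_triangle_ineq[of "\<tau> z - \<tau> u - ?Q' (z - u)" "?Q' (z - u)"] by (simp add: a_def)
      also have "\<dots> \<le> c * a + c * b + b * K"
        using 3 K(2)[of "z - u"] by (simp add: b_def)
      also have "\<dots> \<le> a / 2 + b / 2 + b * K"
        using mult_right_mono[OF c(2), of a] mult_right_mono[OF c(2), of b] by (simp add: a_def b_def)
      finally have "a \<le> b * (1 + 2 * K)" by (simp add: algebra_simps)
      then have "c * a \<le> c * (b * (1 + 2 * K))" using c by simp
      then have "c * a + c * b \<le> (c * (2 * K + 3)) * b - c * b" by (simp add: algebra_simps)
      also have "\<dots> \<le> e * b" using mult_right_mono[OF c(3), of b] mult_nonneg_nonneg[OF less_imp_le[OF c(1)], of b]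
        unfolding b_def by simp
      finally show "norm (\<tau> z - \<tau> u - ?Q' (z - u)) \<le> e * norm (z - u)"
        using 3 by (simp add: b_def)
    qed
  qed
qed

lemma local_paramD:
  assumes "local_param M x U \<phi>"
  shows "open U" "openin M (\<phi> ` U)" "homeomorphic_map (top_of_set U) (subtopology M (\<phi> ` U)) \<phi>"
    "smooth_on (x \<circ> \<phi>) U" "u \<in> U \<Longrightarrow> inj (Der (x \<circ> \<phi>) u)" "inj_on \<phi> U"
  using assms homeomorphic_imp_injective_map[of "top_of_set U" "subtopology M (\<phi> ` U)" \<phi>]
  by (auto simp: local_param_def)

lemma local_param_open_image:
  assumes \<phi>: "local_param M x U \<phi>" and V: "open V" "V \<subseteq> U"
  shows "openin M (\<phi> ` V)"
proof -
  have "openin (subtopology M (\<phi> ` U)) (\<phi> ` V)"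
    using homeomorphic_imp_open_map[OF local_paramD(3)[OF \<phi>]] V
    by (simp add: open_map_def openin_open_eq[OF local_paramD(1)[OF \<phi>]])
  then show ?thesis
    using openin_trans_full local_paramD(2)[OF \<phi>] by blast
qed

lemma local_param_open_preimage:
  assumes \<phi>: "local_param M x U \<phi>" and W: "openin M W"
  shows "open {u \<in> U. \<phi> u \<in> W}"
proof -
  have "continuous_map (top_of_set U) M \<phi>"
    using homeomorphic_imp_continuous_map[OF local_paramD(3)[OF \<phi>]]
    by (simp add: continuous_map_in_subtopology)
  from openin_continuous_map_preimage[OF this W] show ?thesis
    using openin_open_eq[OF local_paramD(1)[OF \<phi>]] by simp
qed

text \<open>Charts carry no compatibility condition of their own: the coordinate change is continuous,
  and it is differentiable because it lifts a differentiable map through an immersion.\<close>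

lemma chart_change:
  assumes \<phi>: "local_param M x U \<phi>" "u \<in> U" and \<psi>: "local_param M x V \<psi>" "v \<in> V"
    and eq: "\<phi> u = \<psi> v"
  obtains T where "\<And>w. Der (x \<circ> \<psi>) v w = Der (x \<circ> \<phi>) u (T w)"
    "\<And>g::_ \<Rightarrow> 'b::real_normed_vector. g \<circ> \<phi> differentiable (at u) \<Longrightarrow>
       g \<circ> \<psi> differentiable (at v) \<and> (\<forall>w. Der (g \<circ> \<psi>) v w = Der (g \<circ> \<phi>) u (T w))"
proof -
  note d\<phi> = local_paramD[OF \<phi>(1)] and d\<psi> = local_paramD[OF \<psi>(1)]
  define \<tau> where "\<tau> z = inv_into U \<phi> (\<psi> z)" for z
  have \<tau>v: "\<tau> v = u" using \<phi>(2) d\<phi>(6) by (simp add: \<tau>_def flip: eq)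
  define V0 where "V0 = {z \<in> V. \<psi> z \<in> \<phi> ` U}"
  have V0: "open V0" "v \<in> V0"
    using local_param_open_preimage[OF \<psi>(1) d\<phi>(2)] \<psi>(2) \<phi>(2) by (auto simp: V0_def simp flip: eq)
  have \<phi>\<tau>: "\<phi> (\<tau> z) = \<psi> z" if "z \<in> V0" for z
    using that by (simp add: \<tau>_def V0_def f_inv_into_f)
  have "isCont \<tau> v"
    unfolding continuous_at_eps_delta
  proof (intro allI impI)
    fix e :: real assume e: "e > 0"
    define W where "W = {z \<in> V. \<psi> z \<in> \<phi> ` (U \<inter> ball u e)}"
    have "open W"
      unfolding W_def using d\<phi>(1)
      by (intro local_param_open_preimage[OF \<psi>(1)] local_param_open_image[OF \<phi>(1)]) auto
    moreover have "v \<in> W" using \<psi>(2) \<phi>(2) e by (auto simp: W_def simp flip: eq)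
    ultimately obtain d where d: "d > 0" "ball v d \<subseteq> W" using open_contains_ball by blast
    have "dist (\<tau> z) (\<tau> v) < e" if "dist z v < d" for z
    proof -
      have "z \<in> W" using d that by (auto simp: dist_commute)
      then obtain a where "a \<in> U" "dist u a < e" "\<psi> z = \<phi> a" by (auto simp: W_def)
      then show ?thesis using d\<phi>(6) by (simp add: \<tau>_def \<tau>v[unfolded \<tau>_def] dist_commute)
    qed
    then show "\<exists>d>0. \<forall>z. dist z v < d \<longrightarrow> dist (\<tau> z) (\<tau> v) < e" using d by blast
  qed
  have dx\<phi>: "((x \<circ> \<phi>) has_derivative Der (x \<circ> \<phi>) u) (at (\<tau> v))"
    using smooth_on_derivative[OF d\<phi>(4) \<phi>(2)] by (simp add: \<tau>v)
  obtain L where L: "linear L" "L \<circ> Der (x \<circ> \<phi>) u = id"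
    using linear_injective_left_inverse[OF _ d\<phi>(5)[OF \<phi>(2)]] has_derivative_linear[OF dx\<phi>] by blast
  have "((\<lambda>z. (x \<circ> \<phi>) (\<tau> z)) has_derivative Der (x \<circ> \<psi>) v) (at v)"
    using smooth_on_derivative[OF d\<psi>(4) \<psi>(2)]
    by (rule has_derivative_transform_within_open[OF _ V0]) (simp add: \<phi>\<tau>)
  then have d\<tau>: "(\<tau> has_derivative (\<lambda>w. L (Der (x \<circ> \<psi>) v w))) (at v)"
    using L by (intro lift_through_immersion_has_derivative[OF dx\<phi> _ _ _ \<open>isCont \<tau> v\<close>])
      (auto simp: linear_conv_bounded_linear fun_eq_iff)
  have chain: "((g \<circ> \<psi>) has_derivative (\<lambda>w. Der (g \<circ> \<phi>) u (L (Der (x \<circ> \<psi>) v w)))) (at v)"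
    if "g \<circ> \<phi> differentiable (at u)" for g :: "_ \<Rightarrow> 'c::real_normed_vector"
  proof -
    have "((g \<circ> \<phi>) has_derivative Der (g \<circ> \<phi>) u) (at (\<tau> v))"
      using Der_works[OF that] by (simp add: \<tau>v)
    from has_derivative_compose[OF d\<tau> this] show ?thesis
      by (rule has_derivative_transform_within_open[OF _ V0]) (simp add: \<phi>\<tau>)
  qed
  show ?thesis
  proof (rule that[of "\<lambda>w. L (Der (x \<circ> \<psi>) v w)"])
    show "Der (x \<circ> \<psi>) v w = Der (x \<circ> \<phi>) u (L (Der (x \<circ> \<psi>) v w))" for w
      using Der_eqI[OF chain[OF smooth_on_differentiable[OF d\<phi>(4) \<phi>(2)]]] by (rule fun_cong)
    show "g \<circ> \<psi> differentiable (at v) \<and> (\<forall>w. Der (g \<circ> \<psi>) v w = Der (g \<circ> \<phi>) u (L (Der (x \<circ> \<psi>) v w)))"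
      if "g \<circ> \<phi> differentiable (at u)" for g :: "_ \<Rightarrow> 'b"
      using chain[OF that] Der_eqI[OF chain[OF that]] by (metis differentiableI)
  qed
qed

lemma tangent_space_chart:
  assumes \<phi>: "local_param M x U \<phi>" "u \<in> U"
  shows "tangent_space M x (\<phi> u) = range (Der (x \<circ> \<phi>) u)"
proof
  show "range (Der (x \<circ> \<phi>) u) \<subseteq> tangent_space M x (\<phi> u)"
    using \<phi> by (auto simp: tangent_space_def)
  show "tangent_space M x (\<phi> u) \<subseteq> range (Der (x \<circ> \<phi>) u)"
  proof
    fix a assume "a \<in> tangent_space M x (\<phi> u)"
    then obtain V \<psi> v w where \<psi>: "local_param M x V \<psi>" "v \<in> V" "\<phi> u = \<psi> v" "a = Der (x \<circ> \<psi>) v w"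
      unfolding tangent_space_def by auto
    obtain T where "Der (x \<circ> \<psi>) v w = Der (x \<circ> \<phi>) u (T w)" for w
      using chart_change[OF \<phi> \<psi>(1-3)] by metis
    then show "a \<in> range (Der (x \<circ> \<phi>) u)" using \<psi>(4) by auto
  qed
qed

text \<open>The description in \<open>tangent_deriv\<close> is unambiguous because all charts at a point are related by
  differentiable coordinate changes, so it can be evaluated in any one of them.\<close>

lemma tangent_deriv_chart:
  fixes g :: "'m \<Rightarrow> 'b::real_normed_vector"
  assumes \<phi>: "local_param M x U \<phi>" "u \<in> U" and g: "g \<circ> \<phi> differentiable (at u)"
  shows "tangent_deriv M x g (\<phi> u) (Der (x \<circ> \<phi>) u w) = Der (g \<circ> \<phi>) u w"
  unfolding tangent_deriv_def
proof (rule the_equality)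
  show "\<exists>U' \<phi>' u' w'. local_param M x U' \<phi>' \<and> u' \<in> U' \<and> \<phi>' u' = \<phi> u \<and>
      Der (x \<circ> \<phi>') u' w' = Der (x \<circ> \<phi>) u w \<and> Der (g \<circ> \<phi>') u' w' = Der (g \<circ> \<phi>) u w"
    using \<phi> by blast
next
  fix d
  assume "\<exists>U' \<phi>' u' w'. local_param M x U' \<phi>' \<and> u' \<in> U' \<and> \<phi>' u' = \<phi> u \<and>
      Der (x \<circ> \<phi>') u' w' = Der (x \<circ> \<phi>) u w \<and> Der (g \<circ> \<phi>') u' w' = d"
  then obtain V \<psi> v w' where \<psi>: "local_param M x V \<psi>" "v \<in> V" "\<phi> u = \<psi> v"
    "Der (x \<circ> \<psi>) v w' = Der (x \<circ> \<phi>) u w" "Der (g \<circ> \<psi>) v w' = d"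
    by metis
  obtain T where T: "\<And>w. Der (x \<circ> \<psi>) v w = Der (x \<circ> \<phi>) u (T w)"
    "\<And>g::'m \<Rightarrow> 'b. g \<circ> \<phi> differentiable (at u) \<Longrightarrow>
       g \<circ> \<psi> differentiable (at v) \<and> (\<forall>w. Der (g \<circ> \<psi>) v w = Der (g \<circ> \<phi>) u (T w))"
    using chart_change[OF \<phi> \<psi>(1-3)] by metis
  have "T w' = w"
    using T(1)[of w'] \<psi>(4) injD[OF local_paramD(5)[OF \<phi>]] by metis
  then show "d = Der (g \<circ> \<phi>) u w" using T(2)[OF g] \<psi>(5) by metis
qed

lemma local_param_reparametrize:
  assumes \<phi>: "local_param M x U \<phi>" and V: "open V" "V \<subseteq> U" and W: "open W"
    and \<theta>: "homeomorphism V W \<theta> g"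
    and smooth: "smooth_on (x \<circ> (\<phi> \<circ> g)) W" and inj: "\<And>w. w \<in> W \<Longrightarrow> inj (Der (x \<circ> (\<phi> \<circ> g)) w)"
  shows "local_param M x W (\<phi> \<circ> g)"
proof -
  have gW: "g ` W = V" using \<theta> by (simp add: homeomorphism_def)
  have img: "(\<phi> \<circ> g) ` W = \<phi> ` V" by (simp only: image_comp[symmetric] gW)
  have "homeomorphic_map (subtopology (top_of_set U) V) (subtopology (subtopology M (\<phi> ` U)) (\<phi> ` V)) \<phi>"
    using V openin_subset[OF local_paramD(2)[OF \<phi>]]
    by (intro homeomorphic_map_subtopologies[OF local_paramD(3)[OF \<phi>]]) (auto simp: Int_absorb1)
  then have "homeomorphic_map (top_of_set V) (subtopology M (\<phi> ` V)) \<phi>"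
    using V by (simp add: subtopology_subtopology Int_absorb1 image_mono Int_absorb2)
  moreover have "homeomorphic_map (top_of_set W) (top_of_set V) g"
    unfolding homeomorphic_map_maps homeomorphic_maps_def
    using \<theta> by (intro exI[of _ \<theta>]) (auto simp: homeomorphism_def)
  ultimately have "homeomorphic_map (top_of_set W) (subtopology M (\<phi> ` V)) (\<phi> \<circ> g)"
    using homeomorphic_map_compose by blast
  then show ?thesis
    using W smooth inj local_param_open_image[OF \<phi> V] unfolding local_param_def img by blast
qed

section \<open>Traces and linear systems\<close>

text \<open>Independence of the trace from the basis: expand \<open>A b\<close> for \<open>b \<in> B\<close> through the basis \<open>C\<close> and
  exchange the sums.\<close>

lemma trace_on_eq:
  fixes T :: "'a::euclidean_space set"
  assumes C: "independent C" "span C = T"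
    and A: "\<And>a. a \<in> T \<Longrightarrow> A a \<in> T" "\<And>a b. a \<in> T \<Longrightarrow> b \<in> T \<Longrightarrow> A (a + b) = A a + A b"
      "\<And>r a. a \<in> T \<Longrightarrow> A (r *\<^sub>R a) = r *\<^sub>R A a"
  shows "trace_on T A = (\<Sum>c\<in>C. representation C (A c) c)"
proof -
  define B where "B = (SOME B. independent B \<and> span B = T)"
  have B: "independent B" "span B = T"
    using someI[of "\<lambda>B. independent B \<and> span B = T" C] C by (auto simp: B_def)
  have finB: "finite B" and finC: "finite C" using B C independent_imp_finite by auto
  have A0: "A 0 = 0" using A(3)[of 0 0] B span_zero by force
  have A_sum: "A (\<Sum>c\<in>S. r c *\<^sub>R c) = (\<Sum>c\<in>S. r c *\<^sub>R A c)" if "finite S" "S \<subseteq> T" for S r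
    using that
  proof (induction S)
    case (insert s S)
    have T: "subspace T" using B(2) subspace_span by metis
    have "(\<Sum>c\<in>S. r c *\<^sub>R c) \<in> T" "r s *\<^sub>R s \<in> T"
      using insert.prems by (auto intro!: subspace_sum[OF T] subspace_scale[OF T])
    then show ?case using insert by (simp add: A(2,3))
  qed (simp add: A0)
  have CT: "C \<subseteq> T" and BT: "B \<subseteq> T" using B(2) C(2) span_superset by auto
  have rep: "representation B (A b) b = (\<Sum>c\<in>C. representation C b c * representation B (A c) b)"
    if "b \<in> B" for b
  proof -
    have b: "b \<in> span C" using BT that C(2) by blast
    have "A b = A (\<Sum>c\<in>C. representation C b c *\<^sub>R c)"
      using real_vector.sum_representation_eq[OF C(1) b finC subset_refl] by simp
    also have "\<dots> = (\<Sum>c\<in>C. representation C b c *\<^sub>R A c)"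
      by (rule A_sum[OF finC CT])
    finally have "A b = (\<Sum>c\<in>C. representation C b c *\<^sub>R A c)" .
    moreover have "A c \<in> span B" if "c \<in> C" for c using A(1) CT B(2) that by blast
    ultimately show ?thesis
      by (simp add: real_vector.representation_sum[OF B(1)] real_vector.representation_scale[OF B(1)]
          span_scale)
  qed
  have rep2: "(\<Sum>b\<in>B. representation C b c * representation B (A c) b) = representation C (A c) c"
    if "c \<in> C" for c
  proof -
    have Ac: "A c \<in> span B" using A(1) CT B(2) that by blast
    have "representation C (A c) c = representation C (\<Sum>b\<in>B. representation B (A c) b *\<^sub>R b) c"
      using real_vector.sum_representation_eq[OF B(1) Ac finB subset_refl] by simp
    also have "\<dots> = (\<Sum>b\<in>B. representation B (A c) b * representation C b c)"
    proof -
      have "b \<in> span C" if "b \<in> B" for b using BT C(2) that by blast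
      then show ?thesis
        by (simp add: real_vector.representation_sum[OF C(1)] real_vector.representation_scale[OF C(1)]
            span_scale)
    qed
    finally show ?thesis by (simp add: mult.commute)
  qed
  have "trace_on T A = (\<Sum>b\<in>B. representation B (A b) b)"
    by (simp add: trace_on_def B_def Let_def)
  also have "\<dots> = (\<Sum>b\<in>B. \<Sum>c\<in>C. representation C b c * representation B (A c) b)"
    by (intro sum.cong refl rep)
  also have "\<dots> = (\<Sum>c\<in>C. representation C (A c) c)"
    by (subst sum.swap) (intro sum.cong refl rep2)
  finally show ?thesis .
qed

lemma smooth_on_det:
  fixes A :: "'a::real_normed_vector \<Rightarrow> real^'n^'n"
  assumes U: "open U" and A: "\<And>i j. smooth_on (\<lambda>u. A u $ i $ j) U"
  shows "smooth_on (\<lambda>u. det (A u)) U"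
  unfolding det_def
  by (intro smooth_on_sum[OF U] smooth_on_mult[OF U] smooth_on_const smooth_on_prod[OF U] A)

text \<open>The solution of a linear system with smooth coefficients is smooth: Cramer's rule for the normal
  equations, whose Gram matrix is invertible because \<open>Der Y u\<close> is injective.\<close>

lemma smooth_on_solution:
  fixes Y :: "real^'n \<Rightarrow> real^'m" and r :: "real^'n \<Rightarrow> real^'m" and z :: "real^'n \<Rightarrow> real^'n"
  assumes U: "open U" and Y: "smooth_on Y U" and inj: "\<And>u. u \<in> U \<Longrightarrow> inj (Der Y u)"
    and r: "smooth_on r U" and z: "\<And>u. u \<in> U \<Longrightarrow> Der Y u (z u) = r u"
  shows "smooth_on (\<lambda>u. z u $ k) U"
proof -
  define G :: "real^'n \<Rightarrow> real^'n^'n"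
    where "G u = (\<chi> i j. Der Y u (axis i 1) \<bullet> Der Y u (axis j 1))" for u
  define b :: "real^'n \<Rightarrow> real^'n" where "b u = (\<chi> i. Der Y u (axis i 1) \<bullet> r u)" for u
  have sG: "smooth_on (\<lambda>u. G u $ i $ j) U" for i j
    unfolding G_def by (simp add: smooth_on_inner[OF U] smooth_on_Der[OF Y])
  have sb: "smooth_on (\<lambda>u. b u $ i) U" for i
    unfolding b_def by (simp add: smooth_on_inner[OF U] smooth_on_Der[OF Y] r)
  have Gv: "(G u *v a) $ i = Der Y u (axis i 1) \<bullet> Der Y u a" if "u \<in> U" for u a i
  proof -
    have l: "linear (Der Y u)" using Der_linear smooth_on_differentiable[OF Y that] by blast
    have "Der Y u a = Der Y u (\<Sum>j\<in>UNIV. (a $ j) *\<^sub>R axis j 1)"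
      by (simp add: basis_expansion flip: scalar_mult_eq_scaleR)
    also have "\<dots> = (\<Sum>j\<in>UNIV. (a $ j) *\<^sub>R Der Y u (axis j 1))"
      by (simp add: linear_sum[OF l] linear_scale[OF l])
    finally have e: "Der Y u a = (\<Sum>j\<in>UNIV. (a $ j) *\<^sub>R Der Y u (axis j 1))" .
    show ?thesis
      unfolding e by (simp add: G_def matrix_vector_mult_def inner_sum_right mult.commute)
  qed
  have det: "det (G u) \<noteq> 0" if u: "u \<in> U" for u
  proof -
    have l: "linear (Der Y u)" using Der_linear smooth_on_differentiable[OF Y u] by blast
    have "a = 0" if a: "G u *v a = 0" for a
    proof -
      have "Der Y u a \<bullet> Der Y u a = (\<Sum>i\<in>UNIV. (a $ i) * (Der Y u (axis i 1) \<bullet> Der Y u a))"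
      proof -
        have "Der Y u a = Der Y u (\<Sum>j\<in>UNIV. (a $ j) *\<^sub>R axis j 1)"
          by (simp add: basis_expansion flip: scalar_mult_eq_scaleR)
        also have "\<dots> = (\<Sum>j\<in>UNIV. (a $ j) *\<^sub>R Der Y u (axis j 1))"
          by (simp add: linear_sum[OF l] linear_scale[OF l])
        finally have "Der Y u a \<bullet> d = (\<Sum>j\<in>UNIV. (a $ j) *\<^sub>R Der Y u (axis j 1)) \<bullet> d" for d
          by (rule arg_cong)
        from this[of "Der Y u a"] show ?thesis by (simp add: inner_sum_left)
      qed
      also have "\<dots> = 0" using Gv[OF u, of a] a by simp
      finally have "Der Y u a = Der Y u 0" by (simp add: linear_0[OF l])
      then show "a = 0" using injD[OF inj[OF u]] by blast
    qed
    then show ?thesis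
      by (metis invertible_det_nz invertible_left_inverse matrix_left_invertible_ker)
  qed
  have cramer: "z u $ k = det (\<chi> i j. if j = k then b u $ i else G u $ i $ j) / det (G u)" if u: "u \<in> U" for u
  proof -
    have "G u *v z u = b u" by (simp add: vec_eq_iff Gv[OF u] z[OF u]) (simp add: b_def)
    then show ?thesis using cramer[OF det[OF u], of "z u" "b u"] by (metis (no_types, lifting) vec_lambda_beta)
  qed
  have "smooth_on (\<lambda>u. det (\<chi> i j. if j = k then b u $ i else G u $ i $ j) / det (G u)) U"
  proof (intro smooth_on_divide[OF U] smooth_on_det[OF U] sG det)
    show "smooth_on (\<lambda>u. (\<chi> i j. if j = k then b u $ i else G u $ i $ j) $ i $ j) U" for i j
      by (cases "j = k") (simp_all add: sG sb)
  qed
  then show ?thesis by (rule iffD2[OF smooth_on_cong[OF U cramer], rotated])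
qed

section \<open>The Minkowski form\<close>

abbreviation minkowski_product :: "real^4 \<Rightarrow> real^4 \<Rightarrow> real" (infixl "\<diamond>" 70) where
  "v \<diamond> w \<equiv> minkowski v w"

lemma bounded_bilinear_minkowski: "bounded_bilinear minkowski"
proof -
  define R :: "real^4 \<Rightarrow> real^4" where "R v = v - (2 * v $ 1) *\<^sub>R axis 1 1" for v
  have "linear R"
    by (rule linearI) (simp_all add: R_def algebra_simps)
  then have "bounded_bilinear (\<lambda>v w. R v \<bullet> w)"
    by (intro bounded_bilinear.comp1[OF bounded_bilinear_inner]) (simp add: linear_conv_bounded_linear)
  moreover have "minkowski = (\<lambda>v w. R v \<bullet> w)"
    by (intro ext) (simp add: minkowski_def R_def inner_vec_def sum_4 axis_def)
  ultimately show ?thesis by (simp only:)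
qed

interpretation minkowski: bounded_bilinear minkowski
  by (rule bounded_bilinear_minkowski)

lemmas minkowski_simps = minkowski.add_left minkowski.add_right minkowski.scaleR_left
  minkowski.scaleR_right minkowski.diff_left minkowski.diff_right minkowski.minus_left
  minkowski.minus_right minkowski.zero_left minkowski.zero_right

lemma minkowski_commute: "v \<diamond> w = w \<diamond> v"
  by (simp add: minkowski_def mult.commute)

lemma minkowski_nondegenerate:
  assumes "\<And>w. v \<diamond> w = 0"
  shows "v = 0"
proof -
  have "v $ i = 0" for i
    using assms[of "axis i 1"] exhaust_4[of i] by (auto simp: minkowski_def axis_def)
  then show ?thesis by (simp add: vec_eq_iff)
qed

text \<open>Pairing a vanishing linear combination with each \<open>vi\<close> shows that the four vectors are independent.\<close>

lemma minkowski_orthogonal_basis: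
  assumes "v1 \<diamond> v2 = 0" "v1 \<diamond> v3 = 0" "v1 \<diamond> v4 = 0" "v2 \<diamond> v3 = 0" "v2 \<diamond> v4 = 0" "v3 \<diamond> v4 = 0"
    and "v1 \<diamond> v1 \<noteq> 0" "v2 \<diamond> v2 \<noteq> 0" "v3 \<diamond> v3 \<noteq> 0" "v4 \<diamond> v4 \<noteq> 0"
  shows "\<exists>r1 r2 r3 r4. v = r1 *\<^sub>R v1 + r2 *\<^sub>R v2 + r3 *\<^sub>R v3 + r4 *\<^sub>R v4"
proof -
  define f :: "real^4 \<Rightarrow> real^4" where
    "f r = (r $ 1) *\<^sub>R v1 + (r $ 2) *\<^sub>R v2 + (r $ 3) *\<^sub>R v3 + (r $ 4) *\<^sub>R v4" for r
  have l: "linear f" by (rule linearI) (simp_all add: f_def algebra_simps)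
  have "r = 0" if "f r = 0" for r
  proof -
    have "f r \<diamond> v1 = 0" "f r \<diamond> v2 = 0" "f r \<diamond> v3 = 0" "f r \<diamond> v4 = 0"
      using that by (simp_all add: minkowski_simps)
    then have "r $ 1 = 0" "r $ 2 = 0" "r $ 3 = 0" "r $ 4 = 0"
      using assms minkowski_commute[of v2 v1] minkowski_commute[of v3 v1] minkowski_commute[of v4 v1]
        minkowski_commute[of v3 v2] minkowski_commute[of v4 v2] minkowski_commute[of v4 v3]
      by (simp_all add: f_def minkowski_simps)
    then show "r = 0" by (simp add: vec_eq_iff forall_4)
  qed
  then have "surj f" using linear_injective_0[OF l] linear_injective_imp_surjective[OF l] by blast
  then obtain r where "v = f r" by blast
  then show ?thesis unfolding f_def by blast
qed

lemma Der_minkowski: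
  assumes "f differentiable (at u)" "g differentiable (at u)"
  shows "Der (\<lambda>u. f u \<diamond> g u) u w = f u \<diamond> Der g u w + Der f u w \<diamond> g u"
  using Der_eqI[OF minkowski.FDERIV[OF Der_works[OF assms(1)] Der_works[OF assms(2)]]] by simp

lemma Der_scaleR:
  assumes "f differentiable (at u)" "g differentiable (at u)"
  shows "Der (\<lambda>u. f u *\<^sub>R g u) u w = f u *\<^sub>R Der g u w + Der f u w *\<^sub>R g u"
  using Der_eqI[OF bounded_bilinear.FDERIV[OF bounded_bilinear_scaleR Der_works[OF assms(1)] Der_works[OF assms(2)]]]
  by simp

lemma Der_add:
  assumes "f differentiable (at u)" "g differentiable (at u)"
  shows "Der (\<lambda>u. f u + g u) u w = Der f u w + Der g u w"
  using Der_eqI[OF has_derivative_add[OF Der_works[OF assms(1)] Der_works[OF assms(2)]]] by simp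

lemma Der_diff:
  assumes "f differentiable (at u)" "g differentiable (at u)"
  shows "Der (\<lambda>u. f u - g u) u w = Der f u w - Der g u w"
  using Der_eqI[OF has_derivative_diff[OF Der_works[OF assms(1)] Der_works[OF assms(2)]]] by simp

lemma Der_real_compose:
  fixes f :: "'a::real_normed_vector \<Rightarrow> real"
  assumes "(\<phi> has_real_derivative D) (at (f u))" "f differentiable (at u)"
  shows "Der (\<lambda>u. \<phi> (f u)) u w = D * Der f u w"
  using Der_eqI[OF has_derivative_compose[OF Der_works[OF assms(2)]
      has_field_derivative_imp_has_derivative[OF assms(1)]]] by simp

lemma Der_cong:
  assumes "open U" "u \<in> U" "\<And>u. u \<in> U \<Longrightarrow> f u = g u"
  shows "Der f u = Der g u"
proof -
  have "(f has_derivative D) (at u) \<longleftrightarrow> (g has_derivative D) (at u)" for D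
    using has_derivative_transform_within_open[OF _ assms(1,2), of f D UNIV g]
      has_derivative_transform_within_open[OF _ assms(1,2), of g D UNIV f] assms(3) by auto
  then show ?thesis by (simp add: frechet_derivative_def)
qed

section \<open>Frames of principal directions\<close>

text \<open>Directions \<open>w1\<close>, \<open>w2\<close>, \<open>w3\<close> in the parameter space whose images form an orthonormal basis of
  principal directions; \<open>\<mu>\<close> is the curvature of the first and \<open>\<kappa>\<close> that of the other two. The Weingarten
  equation \<open>S X = - dN X\<close> is written with the normal field \<open>n\<close> in coordinates.\<close>

definition principal_frame ::
  "(real^3 \<Rightarrow> real^4) \<Rightarrow> (real^3 \<Rightarrow> real^4) \<Rightarrow> real^3 \<Rightarrow> real \<Rightarrow> real \<Rightarrow> real^3 \<Rightarrow> real^3 \<Rightarrow> real^3 \<Rightarrow> bool"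
  where
  "principal_frame y n u \<mu> \<kappa> w1 w2 w3 \<longleftrightarrow>
     (\<forall>w. \<exists>a b c. w = a *\<^sub>R w1 + b *\<^sub>R w2 + c *\<^sub>R w3) \<and>
     \<bar>Der y u w1 \<diamond> Der y u w1\<bar> = 1 \<and> \<bar>Der y u w2 \<diamond> Der y u w2\<bar> = 1 \<and> \<bar>Der y u w3 \<diamond> Der y u w3\<bar> = 1 \<and>
     Der y u w1 \<diamond> Der y u w2 = 0 \<and> Der y u w1 \<diamond> Der y u w3 = 0 \<and> Der y u w2 \<diamond> Der y u w3 = 0 \<and>
     Der n u w1 = - (\<mu> *\<^sub>R Der y u w1) \<and> Der n u w2 = - (\<kappa> *\<^sub>R Der y u w2) \<and>
     Der n u w3 = - (\<kappa> *\<^sub>R Der y u w3)"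

locale hypersurface_chart =
  fixes U :: "(real^3) set" and y n :: "real^3 \<Rightarrow> real^4" and h :: "real^3 \<Rightarrow> real" and \<epsilon> :: real
  assumes U: "open U" and y: "smooth_on y U" and n: "smooth_on n U" and h: "smooth_on h U"
    and eps: "\<epsilon> = - 1 \<or> \<epsilon> = 1"
    and nn: "u \<in> U \<Longrightarrow> n u \<diamond> n u = \<epsilon>"
    and ny: "u \<in> U \<Longrightarrow> n u \<diamond> Der y u w = 0"
begin

lemma dy: "u \<in> U \<Longrightarrow> y differentiable (at u)"
  and dn: "u \<in> U \<Longrightarrow> n differentiable (at u)"
  and dh: "u \<in> U \<Longrightarrow> h differentiable (at u)"
  using smooth_on_differentiable y n h by blast+

lemma ddy: "u \<in> U \<Longrightarrow> (\<lambda>u. Der y u w) differentiable (at u)"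
  and ddn: "u \<in> U \<Longrightarrow> (\<lambda>u. Der n u w) differentiable (at u)"
  and ddh: "u \<in> U \<Longrightarrow> (\<lambda>u. Der h u w) differentiable (at u)"
  using smooth_on_differentiable[OF smooth_on_Der] y n h by blast+

lemmas Der_y_simps = linear_add[OF Der_linear[OF dy]] linear_scale[OF Der_linear[OF dy]]
lemmas Der_n_simps = linear_add[OF Der_linear[OF dn]] linear_scale[OF Der_linear[OF dn]]
lemmas Der_h_simps = linear_add[OF Der_linear[OF dh]] linear_scale[OF Der_linear[OF dh]]

lemma normal_second_derivative:
  assumes u: "u \<in> U"
  shows "n u \<diamond> Der (\<lambda>u. Der y u v) u w = - (Der n u w \<diamond> Der y u v)"
proof -
  have "Der (\<lambda>u. n u \<diamond> Der y u v) u w = Der (\<lambda>u. 0) u w"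
    using Der_cong[OF U u, of "\<lambda>u. n u \<diamond> Der y u v" "\<lambda>u. 0"] ny by simp
  then show ?thesis
    using Der_minkowski[OF dn[OF u] ddy[OF u]] by simp
qed

text \<open>The frame and the normal form an orthogonal basis of the ambient space.\<close>

lemma orthogonal_to_tangent_space:
  assumes u: "u \<in> U" and F: "principal_frame y n u \<mu> \<kappa> w1 w2 w3"
    and Z: "\<And>w. Z \<diamond> Der y u w = 0"
  shows "Z = (\<epsilon> * (Z \<diamond> n u)) *\<^sub>R n u"
proof -
  let ?e1 = "Der y u w1" and ?e2 = "Der y u w2" and ?e3 = "Der y u w3"
  have ortho: "?e1 \<diamond> ?e2 = 0" "?e1 \<diamond> ?e3 = 0" "?e2 \<diamond> ?e3 = 0" "?e2 \<diamond> ?e1 = 0" "?e3 \<diamond> ?e1 = 0" "?e3 \<diamond> ?e2 = 0"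
    "?e1 \<diamond> ?e1 \<noteq> 0" "?e2 \<diamond> ?e2 \<noteq> 0" "?e3 \<diamond> ?e3 \<noteq> 0"
    using F minkowski_commute by (auto simp: principal_frame_def)
  have nz: "n u \<diamond> n u \<noteq> 0" using nn[OF u] eps by auto
  have sp: "\<exists>r1 r2 r3 r4. v = r1 *\<^sub>R ?e1 + r2 *\<^sub>R ?e2 + r3 *\<^sub>R ?e3 + r4 *\<^sub>R n u" for v
    by (rule minkowski_orthogonal_basis)
      (use ortho nz ny[OF u] minkowski_commute[of "n u" "Der y u _"] in simp_all)
  have "Z - (\<epsilon> * (Z \<diamond> n u)) *\<^sub>R n u = 0"
  proof (rule minkowski_nondegenerate)
    fix v
    obtain r1 r2 r3 r4 where v: "v = r1 *\<^sub>R ?e1 + r2 *\<^sub>R ?e2 + r3 *\<^sub>R ?e3 + r4 *\<^sub>R n u"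
      using sp by blast
    show "(Z - (\<epsilon> * (Z \<diamond> n u)) *\<^sub>R n u) \<diamond> v = 0"
      using Z ny[OF u] nn[OF u] eps by (auto simp: v minkowski_simps)
  qed
  then show ?thesis by simp
qed

end

section \<open>Excluding a gradient in the plane of the double curvature\<close>

text \<open>The gradient is a principal direction with curvature \<open>- (3 * \<epsilon> / 2) * h\<close>; the two alternatives are that
  this is the simple curvature or the double one. In each of them the relation \<open>3 * h = \<mu> + 2 * \<kappa>\<close>
  determines the other curvature as a constant multiple of \<open>h\<close>.\<close>

locale biconservative_chart = hypersurface_chart +
  assumes frames: "u \<in> U \<Longrightarrow> \<exists>\<mu> \<kappa> w1 w2 w3. principal_frame y n u \<mu> \<kappa> w1 w2 w3 \<and>
    \<mu> \<noteq> \<kappa> \<and> 3 * h u = \<mu> + 2 * \<kappa> \<and>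
    (\<mu> = - (3 * \<epsilon> / 2) * h u \<and> Der h u w1 \<noteq> 0 \<and> Der h u w2 = 0 \<and> Der h u w3 = 0 \<or>
     \<kappa> = - (3 * \<epsilon> / 2) * h u \<and> Der h u w1 = 0 \<and> (Der h u w2 \<noteq> 0 \<or> Der h u w3 \<noteq> 0))"
begin

text \<open>Codazzi's equation makes a double curvature \<open>\<kappa>\<close> constant along its own plane. If the gradient of
  \<open>h\<close> lies in that plane, \<open>\<kappa>\<close> is a constant multiple of \<open>h\<close>, so that the gradient vanishes, which
  is excluded.

  The equation is used in the following form. The one-form \<open>\<alpha> = dn + \<kappa> dy\<close> has rank one, hence
  vanishing minors, and differentiating these shows that the derivative of \<open>\<alpha>\<close> applied to a vector
  of the plane is a multiple of \<open>dy w1\<close>. Antisymmetrizing over two vectors of the plane removes the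
  second derivatives and leaves \<open>d\<kappa>(w3) dy w2 - d\<kappa>(w2) dy w3\<close>. Being
  orthogonal to \<open>dy w1\<close> and a multiple of it, this vector is zero.

  The rank of \<open>\<alpha>\<close> must be known in a neighbourhood. The form \<open>\<beta>\<close> is the analogue of \<open>\<alpha>\<close> for the
  other alternative: it has rank one where that alternative holds and full rank where it does not,
  so the alternative to be excluded is an open condition.\<close>

lemma gradient_in_simple_direction:
  assumes u0: "u0 \<in> U"
  shows "\<exists>w1 w2 w3. principal_frame y n u0 (- (3 * \<epsilon> / 2) * h u0) ((3/2 + 3 * \<epsilon> / 4) * h u0) w1 w2 w3 \<and>
    h u0 \<noteq> 0 \<and> Der h u0 w1 \<noteq> 0 \<and> Der h u0 w2 = 0 \<and> Der h u0 w3 = 0"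
proof -
  define \<alpha> where "\<alpha> u w = Der n u w + (- (3 * \<epsilon> / 2) * h u) *\<^sub>R Der y u w" for u w
  define \<beta> where "\<beta> u w = Der n u w + ((3/2 + 3 * \<epsilon> / 4) * h u) *\<^sub>R Der y u w" for u w
  define good where "good u \<longleftrightarrow> (\<exists>w1 w2 w3. principal_frame y n u (- (3 * \<epsilon> / 2) * h u) ((3/2 + 3 * \<epsilon> / 4) * h u) w1 w2 w3 \<and>
    h u \<noteq> 0 \<and> Der h u w1 \<noteq> 0 \<and> Der h u w2 = 0 \<and> Der h u w3 = 0)" for u
  define bad where "bad u \<longleftrightarrow> (\<exists>w1 w2 w3. principal_frame y n u ((3 + 3 * \<epsilon>) * h u) (- (3 * \<epsilon> / 2) * h u) w1 w2 w3 \<and>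
    h u \<noteq> 0 \<and> (Der h u w2 \<noteq> 0 \<or> Der h u w3 \<noteq> 0))" for u
  have dich: "good u \<or> bad u" if u: "u \<in> U" for u
  proof -
    obtain \<mu> \<kappa> w1 w2 w3 where F: "principal_frame y n u \<mu> \<kappa> w1 w2 w3" "\<mu> \<noteq> \<kappa>" "3 * h u = \<mu> + 2 * \<kappa>"
      and c: "\<mu> = - (3 * \<epsilon> / 2) * h u \<and> Der h u w1 \<noteq> 0 \<and> Der h u w2 = 0 \<and> Der h u w3 = 0 \<or>
        \<kappa> = - (3 * \<epsilon> / 2) * h u \<and> Der h u w1 = 0 \<and> (Der h u w2 \<noteq> 0 \<or> Der h u w3 \<noteq> 0)"
      using frames[OF u] by blast
    show ?thesis
      using c
    proof
      assume a: "\<mu> = - (3 * \<epsilon> / 2) * h u \<and> Der h u w1 \<noteq> 0 \<and> Der h u w2 = 0 \<and> Der h u w3 = 0"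
      then have "\<kappa> = (3/2 + 3 * \<epsilon> / 4) * h u" using F(3) by (simp add: algebra_simps)
      then show ?thesis using a F unfolding good_def by (intro disjI1 exI[of _ w1] exI[of _ w2] exI[of _ w3]) auto
    next
      assume b: "\<kappa> = - (3 * \<epsilon> / 2) * h u \<and> Der h u w1 = 0 \<and> (Der h u w2 \<noteq> 0 \<or> Der h u w3 \<noteq> 0)"
      then have "\<mu> = (3 + 3 * \<epsilon>) * h u" using F(3) by (simp add: algebra_simps)
      then show ?thesis using b F unfolding bad_def by (intro disjI2 exI[of _ w1] exI[of _ w2] exI[of _ w3]) auto
    qed
  qed
  have "\<not> bad u0"
  proof
    assume "bad u0"
    then obtain w1 w2 w3 where F: "principal_frame y n u0 ((3 + 3 * \<epsilon>) * h u0) (- (3 * \<epsilon> / 2) * h u0) w1 w2 w3"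
      and h0: "h u0 \<noteq> 0" and nz: "Der h u0 w2 \<noteq> 0 \<or> Der h u0 w3 \<noteq> 0"
      unfolding bad_def by blast
    let ?e1 = "Der y u0 w1" and ?e2 = "Der y u0 w2" and ?e3 = "Der y u0 w3"
    have ortho: "?e1 \<diamond> ?e2 = 0" "?e1 \<diamond> ?e3 = 0" "?e2 \<diamond> ?e3 = 0" "?e3 \<diamond> ?e2 = 0"
      "?e1 \<diamond> ?e1 \<noteq> 0" "?e2 \<diamond> ?e2 \<noteq> 0" "?e3 \<diamond> ?e3 \<noteq> 0"
      using F minkowski_commute by (auto simp: principal_frame_def)
    have e1: "?e1 \<noteq> 0" using ortho(5) by (auto simp: minkowski_simps)
    have nw: "Der n u0 w1 = - (((3 + 3 * \<epsilon>) * h u0) *\<^sub>R ?e1)" "Der n u0 w2 = (3 * \<epsilon> / 2 * h u0) *\<^sub>R ?e2"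
      "Der n u0 w3 = (3 * \<epsilon> / 2 * h u0) *\<^sub>R ?e3"
      using F by (auto simp: principal_frame_def)
    \<comment> \<open>\<open>\<beta>\<close> multiplies the simple direction by \<open>c1\<close> and the plane of the double curvature by \<open>- c1\<close>.\<close>
    define c1 where "c1 = (- 3/2 - 9 * \<epsilon> / 4) * h u0"
    have c1: "c1 \<noteq> 0" using h0 eps by (auto simp: c1_def)
    have \<beta>1: "\<beta> u0 w1 = c1 *\<^sub>R ?e1" unfolding \<beta>_def nw
      by (simp add: c1_def algebra_simps flip: scaleR_add_left scaleR_minus_left scaleR_diff_left)
    have \<beta>2: "\<beta> u0 w2 = (- c1) *\<^sub>R ?e2" unfolding \<beta>_def nw
      by (simp add: c1_def algebra_simps flip: scaleR_add_left scaleR_minus_left scaleR_diff_left)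
    \<comment> \<open>Some minor of \<open>\<beta>\<close> is nonzero at \<open>u0\<close> and hence nearby, where \<open>\<beta>\<close> cannot have rank one.\<close>
    obtain i j where ij: "\<beta> u0 w1 $ i * \<beta> u0 w2 $ j - \<beta> u0 w2 $ i * \<beta> u0 w1 $ j \<noteq> 0"
    proof (rule ccontr)
      assume "\<not> thesis"
      then have *: "\<beta> u0 w1 $ i * \<beta> u0 w2 $ j = \<beta> u0 w2 $ i * \<beta> u0 w1 $ j" for i j
        using that by force
      have "?e1 $ i * ?e2 $ j = ?e2 $ i * ?e1 $ j" for i j
        using *[of i j] c1 by (simp add: \<beta>1 \<beta>2)
      moreover obtain i where i: "?e1 $ i \<noteq> 0" using e1 by (auto simp: vec_eq_iff)
      ultimately have "?e2 = (?e2 $ i / ?e1 $ i) *\<^sub>R ?e1"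
        by (simp add: vec_eq_iff field_simps)
      then have "?e2 \<diamond> ?e2 = (?e2 $ i / ?e1 $ i) * (?e1 \<diamond> ?e2)"
        by (metis minkowski.scaleR_left real_scaleR_def)
      then show False using ortho by simp
    qed
    define m where "m u = \<beta> u w1 $ i * \<beta> u w2 $ j - \<beta> u w2 $ i * \<beta> u w1 $ j" for u
    have s\<beta>: "smooth_on (\<lambda>u. \<beta> u w $ i) U" for w i
      unfolding \<beta>_def
      by (intro smooth_on_vec_nth[OF U] smooth_on_add[OF U] smooth_on_scaleR[OF U] smooth_on_mult[OF U]
          smooth_on_const smooth_on_Der n y h)
    have "continuous_on U m"
      unfolding m_def
      by (intro smooth_on_imp_continuous_on smooth_on_diff[OF U] smooth_on_mult[OF U] s\<beta>)
    define U' where "U' = {u \<in> U. m u \<noteq> 0}"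
    have U': "open U'" "u0 \<in> U'" "U' \<subseteq> U"
      using continuous_open_preimage[OF \<open>continuous_on U m\<close> U, of "- {0}"] u0 ij
      by (auto simp: U'_def m_def vimage_def Int_def)
    have badU': "bad u" if "u \<in> U'" for u
    proof (rule ccontr)
      assume "\<not> bad u"
      then have "good u" using dich that U' by blast
      then obtain v1 v2 v3 where G: "principal_frame y n u (- (3 * \<epsilon> / 2) * h u) ((3/2 + 3 * \<epsilon> / 4) * h u) v1 v2 v3"
        unfolding good_def by blast
      have u: "u \<in> U" using that U' by blast
      have par: "\<exists>r. \<beta> u w = r *\<^sub>R \<beta> u v1" for w
      proof -
        obtain a b c where w: "w = a *\<^sub>R v1 + b *\<^sub>R v2 + c *\<^sub>R v3"
          using G unfolding principal_frame_def by blast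
        have "\<beta> u v2 = 0" "\<beta> u v3 = 0"
          using G unfolding \<beta>_def principal_frame_def by auto
        moreover have "\<beta> u w = a *\<^sub>R \<beta> u v1 + b *\<^sub>R \<beta> u v2 + c *\<^sub>R \<beta> u v3"
          unfolding \<beta>_def w by (simp add: Der_n_simps[OF u] Der_y_simps[OF u] algebra_simps)
        ultimately show ?thesis by auto
      qed
      obtain r1 r2 where "\<beta> u w1 = r1 *\<^sub>R \<beta> u v1" "\<beta> u w2 = r2 *\<^sub>R \<beta> u v1"
        using par by metis
      then have "m u = 0" by (simp add: m_def)
      then show False using that by (simp add: U'_def)
    qed
    \<comment> \<open>The difference of the two curvatures.\<close>
    define k where "k = (- 3 - 9 * \<epsilon> / 2) * h u0"
    have k: "k \<noteq> 0" using h0 eps by (auto simp: k_def)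
    have \<alpha>1: "\<alpha> u0 w1 = k *\<^sub>R ?e1" unfolding \<alpha>_def nw
      by (simp add: k_def algebra_simps flip: scaleR_add_left scaleR_minus_left scaleR_diff_left)
    have \<alpha>2: "\<alpha> u0 w2 = 0" "\<alpha> u0 w3 = 0" unfolding \<alpha>_def nw by simp_all
    have \<alpha>par: "\<alpha> u v $ i * \<alpha> u w $ j = \<alpha> u w $ i * \<alpha> u v $ j" if u': "u \<in> U'" for u v w i j
    proof -
      obtain v1 v2 v3 where G: "principal_frame y n u ((3 + 3 * \<epsilon>) * h u) (- (3 * \<epsilon> / 2) * h u) v1 v2 v3"
        using badU'[OF u'] unfolding bad_def by blast
      have u: "u \<in> U" using u' U' by blast
      have par: "\<exists>r. \<alpha> u w = r *\<^sub>R \<alpha> u v1" for w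
      proof -
        obtain a b c where w: "w = a *\<^sub>R v1 + b *\<^sub>R v2 + c *\<^sub>R v3"
          using G unfolding principal_frame_def by blast
        have "\<alpha> u v2 = 0" "\<alpha> u v3 = 0"
          using G unfolding \<alpha>_def principal_frame_def by auto
        moreover have "\<alpha> u w = a *\<^sub>R \<alpha> u v1 + b *\<^sub>R \<alpha> u v2 + c *\<^sub>R \<alpha> u v3"
          unfolding \<alpha>_def w by (simp add: Der_n_simps[OF u] Der_y_simps[OF u] algebra_simps)
        ultimately show ?thesis by auto
      qed
      obtain r1 r2 where "\<alpha> u v = r1 *\<^sub>R \<alpha> u v1" "\<alpha> u w = r2 *\<^sub>R \<alpha> u v1"
        using par by metis
      then show ?thesis by simp
    qed
    have s\<alpha>: "smooth_on (\<lambda>u. \<alpha> u w) U" for w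
      unfolding \<alpha>_def
      by (intro smooth_on_add[OF U] smooth_on_scaleR[OF U] smooth_on_mult[OF U]
          smooth_on_const smooth_on_Der n y h)
    define E where "E z w = Der (\<lambda>u. \<alpha> u w) u0 z" for z w
    have Epar: "E z X $ i * ?e1 $ j = ?e1 $ i * E z X $ j" if X: "\<alpha> u0 X = 0" for X z i j
    proof -
      have d: "(\<lambda>u. \<alpha> u w $ i) differentiable (at u0)" for w i
        by (rule smooth_on_differentiable[OF smooth_on_vec_nth[OF U s\<alpha>] u0])
      have Di: "Der (\<lambda>u. \<alpha> u w $ i) u0 z = E z w $ i" for w i
        unfolding E_def
        by (rule Der_bounded_linear_comp[OF bounded_linear_vec_nth smooth_on_differentiable[OF s\<alpha> u0]])
      have P: "Der (\<lambda>u. \<alpha> u v $ i * \<alpha> u w $ j) u0 z = \<alpha> u0 v $ i * E z w $ j + E z v $ i * \<alpha> u0 w $ j" for v w i j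
        using Der_scaleR[OF d d, of v i w j z] Di by simp
      have "Der (\<lambda>u. \<alpha> u X $ i * \<alpha> u w1 $ j) u0 z = Der (\<lambda>u. \<alpha> u w1 $ i * \<alpha> u X $ j) u0 z"
        by (rule fun_cong[OF Der_cong[OF U'(1,2) \<alpha>par]])
      then have "E z X $ i * \<alpha> u0 w1 $ j = \<alpha> u0 w1 $ i * E z X $ j"
        unfolding P X by simp
      then show ?thesis using k by (simp add: \<alpha>1)
    qed
    have Eorth: "E z X \<diamond> e = 0" if X: "\<alpha> u0 X = 0" and e: "?e1 \<diamond> e = 0" for X z e
    proof -
      obtain i where i: "?e1 $ i \<noteq> 0" using e1 by (auto simp: vec_eq_iff)
      have "E z X = (E z X $ i / ?e1 $ i) *\<^sub>R ?e1"
        using Epar[OF X, of z i] i by (simp add: vec_eq_iff field_simps)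
      then have "E z X \<diamond> e = (E z X $ i / ?e1 $ i) * (?e1 \<diamond> e)"
        by (metis minkowski.scaleR_left real_scaleR_def)
      then show ?thesis using e by simp
    qed
    have Eval: "E z w = Der (\<lambda>u. Der n u w) u0 z + (- (3 * \<epsilon> / 2) * h u0) *\<^sub>R Der (\<lambda>u. Der y u w) u0 z
        + (- (3 * \<epsilon> / 2) * Der h u0 z) *\<^sub>R Der y u0 w" for z w
    proof -
      have d: "(\<lambda>u. - (3 * \<epsilon> / 2) * h u) differentiable (at u0)"
        by (intro derivative_intros dh u0)
      have D: "Der (\<lambda>u. - (3 * \<epsilon> / 2) * h u) u0 z = - (3 * \<epsilon> / 2) * Der h u0 z"
        by (rule Der_bounded_linear_comp[OF bounded_linear_mult_right dh[OF u0]])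
      have d': "(\<lambda>u. (- (3 * \<epsilon> / 2) * h u) *\<^sub>R Der y u w) differentiable (at u0)"
        by (rule smooth_on_differentiable[OF smooth_on_scaleR[OF U smooth_on_mult[OF U smooth_on_const h]
             smooth_on_Der[OF y]] u0])
      show ?thesis
        unfolding E_def \<alpha>_def Der_add[OF ddn[OF u0] d'] Der_scaleR[OF d ddy[OF u0]] D
        by (simp only: add.assoc)
    qed
    have "E w3 w2 - E w2 w3 = (- (3 * \<epsilon> / 2)) *\<^sub>R (Der h u0 w3 *\<^sub>R ?e2 - Der h u0 w2 *\<^sub>R ?e3)"
      unfolding Eval using Der_Der_commute[OF n U u0, of w2 w3] Der_Der_commute[OF y U u0, of w2 w3]
      by (simp add: algebra_simps)
    then have E: "(E w3 w2 - E w2 w3) \<diamond> e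
        = - (3 * \<epsilon> / 2) * (Der h u0 w3 * (?e2 \<diamond> e) - Der h u0 w2 * (?e3 \<diamond> e))" for e
      by (simp add: minkowski_simps)
    have "Der h u0 w3 = 0"
      using E[of ?e2] Eorth[OF \<alpha>2(1) ortho(1), of w3] Eorth[OF \<alpha>2(2) ortho(1), of w2] ortho eps
      by (auto simp: minkowski.diff_left)
    moreover have "Der h u0 w2 = 0"
      using E[of ?e3] Eorth[OF \<alpha>2(1) ortho(2), of w3] Eorth[OF \<alpha>2(2) ortho(2), of w2] ortho eps
      by (auto simp: minkowski.diff_left)
    ultimately have "Der h u0 w3 = 0 \<and> Der h u0 w2 = 0" by blast
    then show False using nz by blast
  qed
  then show ?thesis using dich[OF u0] unfolding good_def by blast
qed

end

section \<open>The axis of rotation\<close>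

lemma Der_mult_real:
  fixes f g :: "'a::real_normed_vector \<Rightarrow> real"
  assumes "f differentiable (at u)" "g differentiable (at u)"
  shows "Der (\<lambda>u. f u * g u) u w = f u * Der g u w + Der f u w * g u"
  using Der_scaleR[OF assms] by simp

text \<open>The quotients of the coordinates of \<open>V\<close> have derivative zero.\<close>

lemma constant_direction:
  fixes V :: "real^'k \<Rightarrow> real^'n"
  assumes V: "smooth_on V U" and U: "open U" "u0 \<in> U" and nz: "\<And>u. u \<in> U \<Longrightarrow> V u \<noteq> 0"
    and par: "\<And>u w. u \<in> U \<Longrightarrow> \<exists>\<theta>. Der V u w = \<theta> *\<^sub>R V u"
  obtains r where "r > 0" "ball u0 r \<subseteq> U" "\<And>u. u \<in> ball u0 r \<Longrightarrow> \<exists>\<rho>. \<rho> \<noteq> 0 \<and> V u = \<rho> *\<^sub>R V u0"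
proof -
  obtain j where j: "V u0 $ j \<noteq> 0" using nz[OF U(2)] by (auto simp: vec_eq_iff)
  have sV: "smooth_on (\<lambda>u. V u $ i) U" for i by (rule smooth_on_vec_nth[OF U(1) V])
  have "open {u \<in> U. V u $ j \<noteq> 0}"
    using continuous_open_preimage[OF smooth_on_imp_continuous_on[OF sV[of j]] U(1), of "- {0}"]
    by (simp add: vimage_def Int_def open_Compl)
  then obtain r where r: "r > 0" "ball u0 r \<subseteq> {u \<in> U. V u $ j \<noteq> 0}"
    using open_contains_ball U(2) j by blast
  have const: "V u $ i / V u $ j = V u0 $ i / V u0 $ j" if u: "u \<in> ball u0 r" for u i
  proof (rule has_derivative_zero_unique[OF convex_ball[of u0 r]])
    fix p assume p: "p \<in> ball u0 r"
    then have pU: "p \<in> U" "V p $ j \<noteq> 0" using r by auto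
    have d: "((\<lambda>u. V u $ i) has_derivative (\<lambda>w. Der V p w $ i)) (at p within ball u0 r)" for i
      using bounded_linear.has_derivative[OF bounded_linear_vec_nth smooth_on_derivative[OF V pU(1)]]
      by (rule has_derivative_at_withinI)
    have "((\<lambda>u. V u $ i / V u $ j) has_derivative
        (\<lambda>w. (Der V p w $ i * V p $ j - V p $ i * Der V p w $ j) / (V p $ j * V p $ j))) (at p within ball u0 r)"
      by (rule has_derivative_divide'[OF d d pU(2)])
    moreover have "(Der V p w $ i * V p $ j - V p $ i * Der V p w $ j) / (V p $ j * V p $ j) = 0" for w
      using par[OF pU(1), of w] by auto
    ultimately show "((\<lambda>u. V u $ i / V u $ j) has_derivative (\<lambda>h. 0)) (at p within ball u0 r)"
      by simp
  qed (use u r in auto)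
  have "\<exists>\<rho>. \<rho> \<noteq> 0 \<and> V u = \<rho> *\<^sub>R V u0" if u: "u \<in> ball u0 r" for u
  proof (intro exI conjI)
    have nzj: "V u $ j \<noteq> 0" using u r by auto
    show "V u $ j / V u0 $ j \<noteq> 0" using nzj j by simp
    show "V u = (V u $ j / V u0 $ j) *\<^sub>R V u0"
      using const[OF u] nzj j by (simp add: vec_eq_iff field_simps)
  qed
  then show ?thesis using that[of r] r by auto
qed

text \<open>The two-by-two minors of \<open>(c - c u0, A)\<close> have derivative zero.\<close>

lemma stays_on_line:
  fixes c :: "real^'k \<Rightarrow> real^'n"
  assumes B: "convex B" "u0 \<in> B" "u \<in> B" and A: "A \<noteq> 0"
    and c: "\<And>p. p \<in> B \<Longrightarrow> c differentiable (at p)"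
    and par: "\<And>p w. p \<in> B \<Longrightarrow> \<exists>\<theta>. Der c p w = \<theta> *\<^sub>R A"
  shows "\<exists>\<zeta>. c u - c u0 = \<zeta> *\<^sub>R A"
proof -
  obtain j where j: "A $ j \<noteq> 0" using A by (auto simp: vec_eq_iff)
  have "c u $ i * A $ j - c u $ j * A $ i = c u0 $ i * A $ j - c u0 $ j * A $ i" for i
  proof (rule has_derivative_zero_unique[OF B(1) _ B(3,2)])
    fix p assume p: "p \<in> B"
    have d: "((\<lambda>u. c u $ i) has_derivative (\<lambda>w. Der c p w $ i)) (at p within B)" for i
      using bounded_linear.has_derivative[OF bounded_linear_vec_nth Der_works[OF c[OF p]]]
      by (rule has_derivative_at_withinI)
    have "((\<lambda>u. c u $ i * A $ j - c u $ j * A $ i) has_derivative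
        (\<lambda>w. Der c p w $ i * A $ j - Der c p w $ j * A $ i)) (at p within B)"
      by (intro has_derivative_diff has_derivative_mult_left d)
    moreover have "Der c p w $ i * A $ j - Der c p w $ j * A $ i = 0" for w
      using par[OF p, of w] by auto
    ultimately show "((\<lambda>u. c u $ i * A $ j - c u $ j * A $ i) has_derivative (\<lambda>h. 0)) (at p within B)"
      by simp
  qed
  then have "c u - c u0 = ((c u $ j - c u0 $ j) / A $ j) *\<^sub>R A"
    using j by (simp add: vec_eq_iff field_simps)
  then show ?thesis by blast
qed

text \<open>The principal curvatures are \<open>a * h\<close> and, doubly, \<open>b * h\<close>, and \<open>h\<close> is constant along the leaves, the
  surfaces tangent to the plane of the double curvature. The constant direction \<open>w0\<close> is transverse
  to the leaves; dividing by \<open>Der h u w0\<close> turns a form that is a multiple of \<open>dh\<close> into its smooth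
  coefficient.\<close>

locale rotational_chart = hypersurface_chart +
  fixes a b :: real and w0 :: "real^3"
  assumes ab: "a \<noteq> b" "b \<noteq> 0"
    and hw0: "u \<in> U \<Longrightarrow> Der h u w0 \<noteq> 0"
    and frames: "u \<in> U \<Longrightarrow> \<exists>w1 w2 w3. principal_frame y n u (a * h u) (b * h u) w1 w2 w3 \<and>
      h u \<noteq> 0 \<and> Der h u w1 \<noteq> 0 \<and> Der h u w2 = 0 \<and> Der h u w3 = 0"
begin

definition adapted :: "real^3 \<Rightarrow> real^3 \<Rightarrow> real^3 \<Rightarrow> real^3 \<Rightarrow> bool" where
  "adapted u w1 w2 w3 \<longleftrightarrow> principal_frame y n u (a * h u) (b * h u) w1 w2 w3 \<and>
      h u \<noteq> 0 \<and> Der h u w1 \<noteq> 0 \<and> Der h u w2 = 0 \<and> Der h u w3 = 0"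

text \<open>The centre of curvature of the leaf through \<open>y u\<close>. It does not move along the leaf.\<close>

definition focal :: "real^3 \<Rightarrow> real^4" where
  "focal u = y u + inverse (b * h u) *\<^sub>R n u"

text \<open>The velocity of the focal point with respect to \<open>h\<close>: it satisfies \<open>d focal = dh V\<close>, and it is the
  axis that the argument has to show to be constant in direction.\<close>

definition V :: "real^3 \<Rightarrow> real^4" where
  "V u = inverse (Der h u w0) *\<^sub>R Der focal u w0"

text \<open>The derivative of \<open>V\<close> with respect to \<open>h\<close>.\<close>

definition V' :: "real^3 \<Rightarrow> real^4" where
  "V' u = inverse (Der h u w0) *\<^sub>R Der V u w0"

text \<open>The coefficient in \<open>V \<diamond> dy = m dh\<close>, expressed through \<open>V \<diamond> V\<close> and \<open>h\<close> because these two are known to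
  be constant along the leaves.\<close>

definition m :: "real^3 \<Rightarrow> real" where
  "m u = inverse (1 - a / b) * (V u \<diamond> V u - \<epsilon> * (inverse (b * (h u)\<^sup>2))\<^sup>2)"

lemma adapted_frame: "u \<in> U \<Longrightarrow> \<exists>w1 w2 w3. adapted u w1 w2 w3"
  unfolding adapted_def by (rule frames)

lemma h_nonzero: "u \<in> U \<Longrightarrow> h u \<noteq> 0"
  using frames by blast

lemma smooth_focal: "smooth_on focal U"
  unfolding focal_def using ab h_nonzero
  by (intro smooth_on_add[OF U] y smooth_on_scaleR[OF U] smooth_on_inverse[OF U] smooth_on_mult[OF U]
      smooth_on_const h n) simp

lemma smooth_V: "smooth_on V U"
  unfolding V_def using hw0
  by (intro smooth_on_scaleR[OF U] smooth_on_inverse[OF U] smooth_on_Der smooth_focal h) simp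

lemma smooth_V': "smooth_on V' U"
  unfolding V'_def using hw0
  by (intro smooth_on_scaleR[OF U] smooth_on_inverse[OF U] smooth_on_Der smooth_V h) simp

lemma dV: "u \<in> U \<Longrightarrow> V differentiable (at u)" and dV': "u \<in> U \<Longrightarrow> V' differentiable (at u)"
  using smooth_on_differentiable smooth_V smooth_V' by blast+

lemma Der_focal:
  assumes u: "u \<in> U"
  shows "Der focal u v = Der y u v + inverse (b * h u) *\<^sub>R Der n u v - (Der h u v / (b * (h u)\<^sup>2)) *\<^sub>R n u"
proof -
  have h0: "h u \<noteq> 0" by (rule h_nonzero[OF u])
  have di: "((\<lambda>x. inverse (b * x)) has_real_derivative (- inverse (b * (h u)\<^sup>2))) (at (h u))"
    using h0 ab by (auto intro!: derivative_eq_intros simp: field_simps power2_eq_square)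
  have 1: "(\<lambda>u. inverse (b * h u)) differentiable (at u)"
    using differentiable_compose[of "\<lambda>x. inverse (b * x)" h u UNIV] di dh[OF u]
    by (metis differentiableI has_field_derivative_imp_has_derivative)
  have 2: "(\<lambda>u. inverse (b * h u) *\<^sub>R n u) differentiable (at u)"
    using 1 dn[OF u] by (intro differentiable_scaleR)
  show ?thesis
    unfolding focal_def Der_add[OF dy[OF u] 2] Der_scaleR[OF 1 dn[OF u]] Der_real_compose[OF di dh[OF u]]
    by (simp add: divide_inverse mult.commute)
qed

lemma adapted_expand:
  assumes u: "u \<in> U" and F: "adapted u w1 w2 w3"
  obtains x1 x2 x3 where "v = x1 *\<^sub>R w1 + x2 *\<^sub>R w2 + x3 *\<^sub>R w3"
    "Der h u v = x1 * Der h u w1"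
    "Der y u v = x1 *\<^sub>R Der y u w1 + x2 *\<^sub>R Der y u w2 + x3 *\<^sub>R Der y u w3"
    "Der n u v = - ((x1 * a * h u) *\<^sub>R Der y u w1 + (x2 * b * h u) *\<^sub>R Der y u w2 + (x3 * b * h u) *\<^sub>R Der y u w3)"
proof -
  obtain x1 x2 x3 where v: "v = x1 *\<^sub>R w1 + x2 *\<^sub>R w2 + x3 *\<^sub>R w3"
    using F unfolding adapted_def principal_frame_def by blast
  show ?thesis
    using F that[OF v] unfolding adapted_def principal_frame_def v
    by (simp add: Der_n_simps[OF u] Der_y_simps[OF u] Der_h_simps[OF u] mult.assoc)
qed

text \<open>Along the leaf \<open>dn = - b h dy\<close>, and the two terms of \<open>d focal\<close> cancel; what is left is the component
  of the vector in the simple direction.\<close>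

lemma V_adapted:
  assumes u: "u \<in> U" and F: "adapted u w1 w2 w3"
  shows "V u = ((1 - a / b) / Der h u w1) *\<^sub>R Der y u w1 - inverse (b * (h u)\<^sup>2) *\<^sub>R n u"
    and "Der focal u v = Der h u v *\<^sub>R V u"
proof -
  have h0: "h u \<noteq> 0" "Der h u w1 \<noteq> 0" "b \<noteq> 0" using F ab by (auto simp: adapted_def)
  have fc: "Der focal u v = Der h u v *\<^sub>R
      (((1 - a / b) / Der h u w1) *\<^sub>R Der y u w1 - inverse (b * (h u)\<^sup>2) *\<^sub>R n u)" for v
  proof -
    obtain x1 x2 x3 where x: "Der h u v = x1 * Der h u w1"
      "Der y u v = x1 *\<^sub>R Der y u w1 + x2 *\<^sub>R Der y u w2 + x3 *\<^sub>R Der y u w3"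
      "Der n u v = - ((x1 * a * h u) *\<^sub>R Der y u w1 + (x2 * b * h u) *\<^sub>R Der y u w2 + (x3 * b * h u) *\<^sub>R Der y u w3)"
      using adapted_expand[OF u F] by metis
    have s: "inverse (b * h u) * (x1 * a * h u) = x1 * (a / b)" "inverse (b * h u) * (x2 * b * h u) = x2"
      "inverse (b * h u) * (x3 * b * h u) = x3"
      using h0 by (simp_all add: field_simps)
    have t: "x1 * Der h u w1 * ((1 - a / b) / Der h u w1) = x1 - x1 * (a / b)"
      using h0 by (simp add: field_simps)
    have r: "inverse (b * h u) *\<^sub>R Der n u v = - ((x1 * (a / b)) *\<^sub>R Der y u w1 + x2 *\<^sub>R Der y u w2 + x3 *\<^sub>R Der y u w3)"
      unfolding x(3) scaleR_minus_right scaleR_add_right scaleR_scaleR s ..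
    show ?thesis
      unfolding Der_focal[OF u] r unfolding x(1,2) scaleR_diff_right scaleR_scaleR t
      by (simp add: algebra_simps divide_inverse)
  qed
  show Veq: "V u = ((1 - a / b) / Der h u w1) *\<^sub>R Der y u w1 - inverse (b * (h u)\<^sup>2) *\<^sub>R n u"
    unfolding V_def fc[of w0] using hw0[OF u] by simp
  show "Der focal u v = Der h u v *\<^sub>R V u"
    unfolding Veq by (rule fc)
qed

lemma Der_focal_eq: "u \<in> U \<Longrightarrow> Der focal u v = Der h u v *\<^sub>R V u"
  using V_adapted(2) adapted_frame by blast

lemma V_normal:
  assumes u: "u \<in> U"
  shows "V u \<diamond> n u = - \<epsilon> * inverse (b * (h u)\<^sup>2)"
proof -
  obtain w1 w2 w3 where F: "adapted u w1 w2 w3" using adapted_frame[OF u] by blast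
  have yn: "Der y u w1 \<diamond> n u = 0"
    using ny[OF u, of w1] minkowski_commute[of "n u"] by simp
  show ?thesis
    unfolding V_adapted(1)[OF u F] minkowski.diff_left minkowski.scaleR_left yn nn[OF u] by simp
qed

lemma V_m:
  assumes u: "u \<in> U"
  shows "V u \<diamond> Der y u v = m u * Der h u v" "V u \<diamond> Der n u v = - (a * h u * m u * Der h u v)" "m u \<noteq> 0"
proof -
  obtain w1 w2 w3 where F: "adapted u w1 w2 w3" using adapted_frame[OF u] by blast
  have h0: "Der h u w1 \<noteq> 0" using F by (simp add: adapted_def)
  have ab1: "1 - a / b \<noteq> 0" using ab by (simp add: field_simps)
  have ortho: "Der y u w1 \<diamond> Der y u w2 = 0" "Der y u w1 \<diamond> Der y u w3 = 0" "\<bar>Der y u w1 \<diamond> Der y u w1\<bar> = 1"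
    using F by (auto simp: adapted_def principal_frame_def)
  note V = V_adapted(1)[OF u F]
  define p where "p = (1 - a / b) / Der h u w1"
  have yn: "Der y u v \<diamond> n u = 0" for v using ny[OF u] minkowski_commute by metis
  have "V u \<diamond> V u = p\<^sup>2 * (Der y u w1 \<diamond> Der y u w1) + \<epsilon> * (inverse (b * (h u)\<^sup>2))\<^sup>2"
    unfolding V p_def[symmetric]
    by (simp add: minkowski_simps ny[OF u] yn nn[OF u] power2_eq_square algebra_simps)
  then have m: "m u = (p / Der h u w1) * (Der y u w1 \<diamond> Der y u w1)"
    using ab1 h0 by (simp add: m_def p_def power2_eq_square field_simps)
  then show "m u \<noteq> 0" using ab1 h0 ortho(3) by (auto simp: p_def)
  obtain x1 x2 x3 where x: "Der h u v = x1 * Der h u w1"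
      "Der y u v = x1 *\<^sub>R Der y u w1 + x2 *\<^sub>R Der y u w2 + x3 *\<^sub>R Der y u w3"
      "Der n u v = - ((x1 * a * h u) *\<^sub>R Der y u w1 + (x2 * b * h u) *\<^sub>R Der y u w2 + (x3 * b * h u) *\<^sub>R Der y u w3)"
      using adapted_expand[OF u F] by metis
  show "V u \<diamond> Der y u v = m u * Der h u v" "V u \<diamond> Der n u v = - (a * h u * m u * Der h u v)"
    unfolding V p_def[symmetric] x m using h0
    by (simp_all add: minkowski_simps ny[OF u] ortho)
qed

lemma kernel_principal:
  assumes u: "u \<in> U" and X: "Der h u X = 0"
  shows "Der n u X = - ((b * h u) *\<^sub>R Der y u X)"
proof -
  obtain w1 w2 w3 where F: "adapted u w1 w2 w3" using adapted_frame[OF u] by blast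
  obtain x1 x2 x3 where x: "Der h u X = x1 * Der h u w1"
      "Der y u X = x1 *\<^sub>R Der y u w1 + x2 *\<^sub>R Der y u w2 + x3 *\<^sub>R Der y u w3"
      "Der n u X = - ((x1 * a * h u) *\<^sub>R Der y u w1 + (x2 * b * h u) *\<^sub>R Der y u w2 + (x3 * b * h u) *\<^sub>R Der y u w3)"
    using adapted_expand[OF u F] by metis
  have "x1 = 0" using x(1) X F by (simp add: adapted_def)
  then show ?thesis unfolding x by (simp add: algebra_simps)
qed

text \<open>Differentiating \<open>dF = dh W\<close> once more and using the symmetry of both second derivatives gives
  that \<open>dh \<and> dW = 0\<close>.\<close>

lemma Der_multiple_of_Der_h:
  fixes F W :: "real^3 \<Rightarrow> real^4"
  assumes F: "smooth_on F U" and W: "smooth_on W U"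
    and eq: "\<And>u v. u \<in> U \<Longrightarrow> Der F u v = Der h u v *\<^sub>R W u" and u: "u \<in> U"
  shows "Der W u v = Der h u v *\<^sub>R (inverse (Der h u w0) *\<^sub>R Der W u w0)"
proof -
  have D: "Der (\<lambda>u. Der F u v) u w = Der h u v *\<^sub>R Der W u w + Der (\<lambda>u. Der h u v) u w *\<^sub>R W u" for v w
    using Der_cong[OF U u, of "\<lambda>u. Der F u v" "\<lambda>u. Der h u v *\<^sub>R W u"] eq
      Der_scaleR[OF ddh[OF u] smooth_on_differentiable[OF W u]] by simp
  have "Der h u v *\<^sub>R Der W u w0 = Der h u w0 *\<^sub>R Der W u v"
    using Der_Der_commute[OF F U u, of v w0] Der_Der_commute[OF h U u, of v w0] unfolding D by simp
  then have "inverse (Der h u w0) *\<^sub>R (Der h u v *\<^sub>R Der W u w0) = Der W u v"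
    using hw0[OF u] by simp
  then show ?thesis by (simp add: mult.commute)
qed

lemma Der_V: "u \<in> U \<Longrightarrow> Der V u v = Der h u v *\<^sub>R V' u"
  unfolding V'_def by (rule Der_multiple_of_Der_h[OF smooth_focal smooth_V Der_focal_eq])

lemma Der_V'_kernel: "u \<in> U \<Longrightarrow> Der h u X = 0 \<Longrightarrow> Der V' u X = 0"
  by (subst Der_multiple_of_Der_h[OF smooth_V smooth_V' Der_V]) simp_all

lemma Der_m_kernel:
  assumes u: "u \<in> U" and X: "Der h u X = 0"
  shows "m differentiable (at u)" "Der m u X = 0"
proof -
  have h0: "h u \<noteq> 0" by (rule h_nonzero[OF u])
  obtain D where di: "((\<lambda>x. \<epsilon> * (inverse (b * x\<^sup>2))\<^sup>2) has_real_derivative D) (at (h u))"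
  proof -
    have "((\<lambda>x. inverse (b * x\<^sup>2)) has_real_derivative
        - (inverse (b * (h u)\<^sup>2) * (b * (2 * h u)) * inverse (b * (h u)\<^sup>2))) (at (h u))"
      using h0 ab by (auto intro!: derivative_eq_intros simp: algebra_simps)
    from DERIV_cmult[OF DERIV_power[OF this, of 2], of \<epsilon>]
    show ?thesis by (rule that)
  qed
  have 1: "(\<lambda>u. \<epsilon> * (inverse (b * (h u)\<^sup>2))\<^sup>2) differentiable (at u)"
    using has_derivative_compose[OF Der_works[OF dh[OF u]] has_field_derivative_imp_has_derivative[OF di]]
    by (rule differentiableI)
  have 2: "(\<lambda>u. V u \<diamond> V u) differentiable (at u)"
    using minkowski.FDERIV[OF Der_works[OF dV[OF u]] Der_works[OF dV[OF u]]] by (rule differentiableI)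
  have 3: "(\<lambda>u. V u \<diamond> V u - \<epsilon> * (inverse (b * (h u)\<^sup>2))\<^sup>2) differentiable (at u)"
    using 2 1 by (rule differentiable_diff)
  have m: "m = (\<lambda>u. inverse (1 - a / b) * (V u \<diamond> V u - \<epsilon> * (inverse (b * (h u)\<^sup>2))\<^sup>2))"
    by (rule ext) (rule m_def)
  show "m differentiable (at u)"
    unfolding m using differentiable_const 3 by (rule differentiable_mult)
  show "Der m u X = 0"
    unfolding m Der_bounded_linear_comp[OF bounded_linear_mult_right 3] Der_diff[OF 2 1]
      Der_minkowski[OF dV[OF u] dV[OF u]] Der_real_compose[OF di dh[OF u]] X Der_V[OF u]
    by (simp add: minkowski_simps)
qed

text \<open>The derivative of \<open>V_normal\<close> in the transverse direction.\<close>

lemma V'_normal: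
  assumes u: "u \<in> U"
  shows "V' u \<diamond> n u = 2 * \<epsilon> / b * inverse (h u ^ 3) + a * h u * m u"
proof -
  have h0: "h u \<noteq> 0" by (rule h_nonzero[OF u])
  have di: "((\<lambda>x. - \<epsilon> * inverse (b * x\<^sup>2)) has_real_derivative (2 * \<epsilon> / b * inverse (h u ^ 3))) (at (h u))"
  proof -
    have "((\<lambda>x. - \<epsilon> * inverse (b * x\<^sup>2)) has_real_derivative
        (- \<epsilon> * - (inverse (b * (h u)\<^sup>2) * (b * (2 * h u)) * inverse (b * (h u)\<^sup>2)))) (at (h u))"
      using h0 ab by (auto intro!: derivative_eq_intros simp: algebra_simps)
    moreover have "- \<epsilon> * - (inverse (b * (h u)\<^sup>2) * (b * (2 * h u)) * inverse (b * (h u)\<^sup>2))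
        = 2 * \<epsilon> / b * inverse (h u ^ 3)"
      using h0 ab(2) by (simp add: divide_simps power2_eq_square power3_eq_cube)
    ultimately show ?thesis by (simp only:)
  qed
  have "Der (\<lambda>u. V u \<diamond> n u) u w0 = Der (\<lambda>u. - \<epsilon> * inverse (b * (h u)\<^sup>2)) u w0"
    by (rule fun_cong[OF Der_cong[OF U u V_normal]])
  then have "V u \<diamond> Der n u w0 + Der V u w0 \<diamond> n u = 2 * \<epsilon> / b * inverse (h u ^ 3) * Der h u w0"
    unfolding Der_minkowski[OF dV[OF u] dn[OF u]] Der_real_compose[OF di dh[OF u]] .
  then have "Der h u w0 * (V' u \<diamond> n u) = Der h u w0 * (2 * \<epsilon> / b * inverse (h u ^ 3) + a * h u * m u)"
    unfolding V_m(2)[OF u] Der_V[OF u] minkowski.scaleR_left by (simp add: algebra_simps)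
  then show ?thesis using hw0[OF u] by simp
qed

text \<open>Both sides of the preceding formula are differentiated along the leaf \<open>h = const\<close>,
  where the right hand side is constant.\<close>

lemma V'_orthogonal_kernel:
  assumes u: "u \<in> U" and X: "Der h u X = 0"
  shows "V' u \<diamond> Der y u X = 0"
proof -
  have h0: "h u \<noteq> 0" by (rule h_nonzero[OF u])
  have di: "((\<lambda>x. 2 * \<epsilon> / b * inverse (x ^ 3)) has_real_derivative
      (2 * \<epsilon> / b * (- (inverse (h u ^ 3) * (3 * h u ^ 2) * inverse (h u ^ 3))))) (at (h u))"
    using h0 ab by (auto intro!: derivative_eq_intros simp: algebra_simps)
  have 1: "(\<lambda>u. 2 * \<epsilon> / b * inverse (h u ^ 3)) differentiable (at u)"
    using has_derivative_compose[OF Der_works[OF dh[OF u]] has_field_derivative_imp_has_derivative[OF di]]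
    by (rule differentiableI)
  have ah: "(\<lambda>u. a * h u) differentiable (at u)"
    using differentiable_const dh[OF u] by (rule differentiable_mult)
  have dm: "m differentiable (at u)" by (rule Der_m_kernel(1)[OF u X])
  have 2: "(\<lambda>u. a * h u * m u) differentiable (at u)"
    using ah dm by (rule differentiable_mult)
  have "Der (\<lambda>u. V' u \<diamond> n u) u X = Der (\<lambda>u. 2 * \<epsilon> / b * inverse (h u ^ 3) + a * h u * m u) u X"
    by (rule fun_cong[OF Der_cong[OF U u V'_normal]])
  then have "V' u \<diamond> Der n u X = 0"
    unfolding Der_minkowski[OF dV'[OF u] dn[OF u]] Der_add[OF 1 2] Der_real_compose[OF di dh[OF u]]
      Der_mult_real[OF ah dm] Der_bounded_linear_comp[OF bounded_linear_mult_right dh[OF u]]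
      X Der_m_kernel(2)[OF u X] Der_V'_kernel[OF u X] by (simp add: minkowski_simps)
  then show ?thesis
    unfolding kernel_principal[OF u X] using h0 ab by (simp add: minkowski_simps)
qed

text \<open>Both \<open>V\<close> and \<open>V'\<close> are orthogonal to the leaf. A suitable combination \<open>Z = V' - \<theta> V\<close> is orthogonal to
  the whole tangent space at the given point, so that it is a multiple of the normal there. But \<open>Z\<close>
  is constant along the leaf and orthogonal to it, so it is also orthogonal to the second derivative
  of \<open>y\<close> along the leaf, whose normal component is the curvature \<open>b h\<close> and does not vanish. Hence \<open>Z = 0\<close>.\<close>

lemma V'_parallel_V:
  assumes u1: "u1 \<in> U"
  shows "\<exists>\<theta>. V' u1 = \<theta> *\<^sub>R V u1"
proof -
  \<comment> \<open>The choice that makes the tangential part of \<open>Z\<close> vanish at \<open>u1\<close>.\<close>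
  define \<theta> where "\<theta> = (V' u1 \<diamond> Der y u1 w0) / (V u1 \<diamond> Der y u1 w0)"
  define Z where "Z u = V' u - \<theta> *\<^sub>R V u" for u
  have sZ: "smooth_on Z U"
    unfolding Z_def
    by (intro smooth_on_diff[OF U] smooth_V' smooth_on_scaleR[OF U] smooth_on_const smooth_V)
  have dZ: "Z differentiable (at u1)" by (rule smooth_on_differentiable[OF sZ u1])
  have Zker: "Z u \<diamond> Der y u X = 0" if "u \<in> U" "Der h u X = 0" for u X
    using V'_orthogonal_kernel[OF that] V_m(1)[OF that(1), of X] that(2)
    by (simp add: Z_def minkowski_simps)
  have Z0: "Z u1 \<diamond> Der y u1 w0 = 0"
    using V_m(1,3)[OF u1] hw0[OF u1] by (simp add: Z_def \<theta>_def minkowski_simps)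
  have split: "Der h u w0 * (Z u \<diamond> Der y u v) = Der h u v * (Z u \<diamond> Der y u w0)" if u: "u \<in> U" for u v
  proof -
    define X where "X = Der h u w0 *\<^sub>R v - Der h u v *\<^sub>R w0"
    have "Der h u X = 0"
      by (simp add: X_def linear_diff[OF Der_linear[OF dh[OF u]]] Der_h_simps[OF u])
    from Zker[OF u this] show ?thesis
      by (simp add: X_def linear_diff[OF Der_linear[OF dy[OF u]]] Der_y_simps[OF u] minkowski_simps)
  qed
  have Zt: "Z u1 \<diamond> Der y u1 v = 0" for v
    using split[OF u1, of v] Z0 hw0[OF u1] by simp
  obtain w1 w2 w3 where F: "adapted u1 w1 w2 w3" using adapted_frame[OF u1] by blast
  have X: "Der h u1 w2 = 0" and h0: "h u1 \<noteq> 0" and e2: "\<bar>Der y u1 w2 \<diamond> Der y u1 w2\<bar> = 1"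
    and PF: "principal_frame y n u1 (a * h u1) (b * h u1) w1 w2 w3"
    using F by (auto simp: adapted_def principal_frame_def)
  have DZ: "Der Z u1 w2 = 0"
  proof -
    have sV: "(\<lambda>u. \<theta> *\<^sub>R V u) differentiable (at u1)"
      by (rule differentiable_scaleR[OF differentiable_const dV[OF u1]])
    show ?thesis
      unfolding Z_def Der_diff[OF dV'[OF u1] sV]
        Der_bounded_linear_comp[OF bounded_linear_scaleR_right dV[OF u1]]
      using Der_V'_kernel[OF u1 X] Der_V[OF u1, of w2] X by simp
  qed
  have dP: "(\<lambda>u. Z u \<diamond> Der y u v) differentiable (at u1)" for v
    using minkowski.FDERIV[OF Der_works[OF dZ] Der_works[OF ddy[OF u1]]] by (rule differentiableI)
  have "Der (\<lambda>u. Der h u w0 * (Z u \<diamond> Der y u w2)) u1 w2 = Der (\<lambda>u. Der h u w2 * (Z u \<diamond> Der y u w0)) u1 w2"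
    by (rule fun_cong[OF Der_cong[OF U u1 split]])
  then have "Der h u1 w0 * (Z u1 \<diamond> Der (\<lambda>u. Der y u w2) u1 w2) = 0"
    unfolding Der_mult_real[OF ddh[OF u1] dP] Der_minkowski[OF dZ ddy[OF u1]] Zt DZ X
    by (simp add: minkowski_simps)
  then have ZD: "Z u1 \<diamond> Der (\<lambda>u. Der y u w2) u1 w2 = 0" using hw0[OF u1] by simp
  have Zn: "Z u1 = (\<epsilon> * (Z u1 \<diamond> n u1)) *\<^sub>R n u1"
    by (rule orthogonal_to_tangent_space[OF u1 PF Zt])
  have "n u1 \<diamond> Der (\<lambda>u. Der y u w2) u1 w2 \<noteq> 0"
    unfolding normal_second_derivative[OF u1] kernel_principal[OF u1 X]
    using h0 ab e2 by (auto simp: minkowski_simps)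
  moreover have "(\<epsilon> * (Z u1 \<diamond> n u1)) * (n u1 \<diamond> Der (\<lambda>u. Der y u w2) u1 w2) = 0"
    using ZD by (subst (asm) Zn) (simp add: minkowski_simps)
  ultimately have "\<epsilon> * (Z u1 \<diamond> n u1) = 0" by simp
  then have "Z u1 = 0" using Zn scaleR_zero_left by metis
  then show ?thesis by (auto simp: Z_def)
qed

text \<open>The focal points lie on the line through \<open>c0\<close> in the direction \<open>A\<close>, the axis, and the axis is
  orthogonal to the leaves. As \<open>V \<diamond> n\<close> is a nonzero multiple of \<open>1 / h\<^sup>2\<close>, the axis is never
  tangent to the hypersurface, which is what makes the distance from it a regular function.\<close>

lemma rotation_axis:
  assumes u0: "u0 \<in> U"
  obtains r c0 A where "r > 0" "ball u0 r \<subseteq> U" "A \<noteq> 0"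
    "\<And>u. u \<in> ball u0 r \<Longrightarrow> \<exists>\<zeta>. y u - c0 = \<zeta> *\<^sub>R A - inverse (b * h u) *\<^sub>R n u"
    "\<And>u. u \<in> ball u0 r \<Longrightarrow> A \<diamond> n u \<noteq> 0"
    "\<And>u v. u \<in> ball u0 r \<Longrightarrow> A \<diamond> Der y u v = 0 \<longleftrightarrow> Der h u v = 0"
proof -
  have Vn: "V u \<diamond> n u \<noteq> 0" if "u \<in> U" for u
    using V_normal[OF that] h_nonzero[OF that] ab eps by auto
  have Vnz: "V u \<noteq> 0" if "u \<in> U" for u
    using Vn[OF that] by (auto simp: minkowski_simps)
  have "\<exists>\<theta>. Der V u w = \<theta> *\<^sub>R V u" if "u \<in> U" for u w
    using Der_V[OF that, of w] V'_parallel_V[OF that] by auto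
  then obtain r where r: "r > 0" "ball u0 r \<subseteq> U"
    and \<rho>: "\<And>u. u \<in> ball u0 r \<Longrightarrow> \<exists>\<rho>. \<rho> \<noteq> 0 \<and> V u = \<rho> *\<^sub>R V u0"
    using constant_direction[OF smooth_V U u0 Vnz] by metis
  show ?thesis
  proof (rule that[OF r Vnz[OF u0]])
    fix u assume u: "u \<in> ball u0 r"
    then have uU: "u \<in> U" using r by blast
    obtain k where k: "k \<noteq> 0" "V u = k *\<^sub>R V u0" using \<rho>[OF u] by blast
    have "\<exists>\<zeta>. focal u - focal u0 = \<zeta> *\<^sub>R V u0"
    proof (rule stays_on_line[OF convex_ball[of u0 r] _ u Vnz[OF u0]])
      show "u0 \<in> ball u0 r" using r by simp
      fix p w assume p: "p \<in> ball u0 r"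
      then have pU: "p \<in> U" using r by blast
      show "focal differentiable (at p)" by (rule smooth_on_differentiable[OF smooth_focal pU])
      show "\<exists>\<theta>. Der focal p w = \<theta> *\<^sub>R V u0"
        using Der_focal_eq[OF pU, of w] \<rho>[OF p] by auto
    qed
    then obtain \<zeta> where \<zeta>: "focal u - focal u0 = \<zeta> *\<^sub>R V u0" ..
    have "y u - focal u0 = \<zeta> *\<^sub>R V u0 - inverse (b * h u) *\<^sub>R n u"
      unfolding \<zeta>[symmetric] by (simp add: focal_def)
    then show "\<exists>\<zeta>. y u - focal u0 = \<zeta> *\<^sub>R V u0 - inverse (b * h u) *\<^sub>R n u" ..
    show "V u0 \<diamond> n u \<noteq> 0" using Vn[OF uU] k by (auto simp: minkowski_simps)
    show "V u0 \<diamond> Der y u v = 0 \<longleftrightarrow> Der h u v = 0" for v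
      using V_m(1)[OF uU, of v] V_m(3)[OF uU] k by (auto simp: minkowski_simps)
  qed
qed

end

section \<open>From functions on a chart to a model hypersurface\<close>

text \<open>The last two of the model coordinates only have to be differentiable: they make the coordinate
  change a homeomorphism by invariance of domain, and the new parametrization is smooth because the
  model is.\<close>

lemma congruent_near_of_coordinates:
  fixes Y :: "real \<Rightarrow> real \<Rightarrow> real \<Rightarrow> real \<Rightarrow> real^4"
  assumes \<phi>: "local_param M x U \<phi>" and B: "open B" "u0 \<in> B" "B \<subseteq> U" and F: "minkowski_isometry F"
    and Y: "smooth_on (\<lambda>p::real^4. Y (p$1) (p$2) (p$3) (p$4)) UNIV"
    and s: "smooth_on s B" and g: "smooth_on g B"
    and \<tau>: "\<And>u. u \<in> B \<Longrightarrow> \<tau> differentiable (at u)" and \<upsilon>: "\<And>u. u \<in> B \<Longrightarrow> \<upsilon> differentiable (at u)"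
    and nz: "Der s u0 v \<noteq> 0" and ker: "\<And>u w. u \<in> B \<Longrightarrow> Der s u w = 0 \<Longrightarrow> Der g u w = 0"
    and eq: "\<And>u. u \<in> B \<Longrightarrow> F (x (\<phi> u)) = Y (g u) (s u) (\<tau> u) (\<upsilon> u)"
  shows "\<exists>f I. open I \<and> is_interval I \<and> smooth_on f I \<and> congruent_near M x (\<phi> u0) I (\<lambda>s. Y (f s) s)"
proof -
  note d\<phi> = local_paramD[OF \<phi>]
  obtain r1 I f where r1: "r1 > 0" "ball u0 r1 \<subseteq> B" and I: "open I" "is_interval I" and f: "smooth_on f I"
    and sf: "\<And>u. u \<in> ball u0 r1 \<Longrightarrow> s u \<in> I \<and> g u = f (s u)"
    using factor_through_submersion[OF B(1,2) s g nz ker] by metis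
  have "u0 \<in> U" using B by blast
  then obtain r2 where r2: "r2 > 0" "ball u0 r2 \<subseteq> U" "inj_on (x \<circ> \<phi>) (ball u0 r2)"
    using locally_injective_of_injective_derivative[OF d\<phi>(1) _ d\<phi>(4) d\<phi>(5)] by metis
  define C where "C = ball u0 (min r1 r2)"
  have C: "open C" "u0 \<in> C" "C \<subseteq> ball u0 r1" "C \<subseteq> B" "C \<subseteq> U" and injC: "inj_on (x \<circ> \<phi>) C"
    using r1 r2 B by (auto simp: C_def intro: inj_on_subset)
  define \<theta> :: "real^3 \<Rightarrow> real^3" where "\<theta> u = vector [s u, \<tau> u, \<upsilon> u]" for u
  define P where "P p = Y (f (p$1)) (p$1) (p$2) (p$3)" for p :: "real^3"
  have bijF: "bij F" and sF: "smooth_on (inv F) UNIV" using F by (auto simp: minkowski_isometry_def)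
  have FP: "F (x (\<phi> u)) = P (\<theta> u)" if "u \<in> C" for u
    using eq[OF subsetD[OF C(4) that]] sf[OF subsetD[OF C(3) that]] by (simp add: P_def \<theta>_def)
  then have xP: "x (\<phi> u) = inv F (P (\<theta> u))" if "u \<in> C" for u
    using that bijF by (metis bij_inv_eq_iff)
  have inj\<theta>: "inj_on \<theta> C"
    using injC xP unfolding inj_on_def by (metis comp_apply)
  have d\<theta>: "\<theta> differentiable (at u)" if "u \<in> C" for u
  proof -
    have u: "u \<in> B" using that C by blast
    have e: "\<theta> = (\<lambda>u. s u *\<^sub>R axis 1 1 + \<tau> u *\<^sub>R axis 2 1 + \<upsilon> u *\<^sub>R axis 3 1)"
      by (simp add: fun_eq_iff vec_eq_iff \<theta>_def forall_3 axis_def)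
    show ?thesis
      unfolding e using smooth_on_differentiable[OF s u] \<tau>[OF u] \<upsilon>[OF u]
      by (intro differentiable_add differentiable_scaleR differentiable_const)
  qed
  then have cont\<theta>: "continuous_on C \<theta>"
    by (meson continuous_at_imp_continuous_on differentiable_imp_continuous_within)
  define W where "W = \<theta> ` C"
  have W: "open W" unfolding W_def by (rule invariance_of_domain[OF cont\<theta> C(1) inj\<theta>])
  define G where "G = inv_into C \<theta>"
  have G\<theta>: "G (\<theta> u) = u" if "u \<in> C" for u using inj\<theta> that by (simp add: G_def)
  have hom: "homeomorphism C W \<theta> G"
    unfolding homeomorphism_def W_def
    using cont\<theta> G\<theta> continuous_on_inverse_open[OF C(1) cont\<theta> _ G\<theta>] by force
  have WI: "p $ 1 \<in> I" if "p \<in> W" for p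
    using that sf C(3) by (auto simp: W_def \<theta>_def)
  have sc: "smooth_on (\<lambda>p::real^3. p $ i) W" for i
    by (rule smooth_on_subset[OF smooth_on_bounded_linear[OF bounded_linear_vec_nth] subset_UNIV])
  have sfp: "smooth_on (\<lambda>p::real^3. f (p $ 1)) W"
    by (rule smooth_on_compose[OF W f sc WI])
  have sP: "smooth_on P W"
  proof -
    define E :: "real^3 \<Rightarrow> real^4" where "E p = vector [f (p$1), p$1, p$2, p$3]" for p
    have "smooth_on (\<lambda>p. E p $ i) W" for i
      using exhaust_4[of i] sc sfp by (auto simp: E_def)
    then have "smooth_on E W" by (rule smooth_on_vec_lambda[OF W])
    from smooth_on_compose[OF W Y this] show ?thesis
      by (simp add: P_def[abs_def] E_def)
  qed
  have xG: "x (\<phi> (G p)) = inv F (P p)" if "p \<in> W" for p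
    using that xP G\<theta> by (auto simp: W_def)
  have smooth: "smooth_on (x \<circ> (\<phi> \<circ> G)) W"
  proof -
    have "smooth_on (\<lambda>p. inv F (P p)) W" by (rule smooth_on_compose[OF W sF sP]) simp
    then show ?thesis using smooth_on_cong[OF W, of "x \<circ> (\<phi> \<circ> G)" "\<lambda>p. inv F (P p)"] xG by simp
  qed
  have "local_param M x W (\<phi> \<circ> G)"
  proof (rule local_param_reparametrize[OF \<phi> C(1,5) W hom smooth])
    fix p assume "p \<in> W"
    then obtain u where u: "u \<in> C" "p = \<theta> u" by (auto simp: W_def)
    have "((\<lambda>u. (x \<circ> (\<phi> \<circ> G)) (\<theta> u)) has_derivative (\<lambda>w. Der (x \<circ> (\<phi> \<circ> G)) p (Der \<theta> u w))) (at u)"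
      using has_derivative_compose[OF Der_works[OF d\<theta>[OF u(1)]], of "x \<circ> (\<phi> \<circ> G)"]
        smooth_on_derivative[OF smooth \<open>p \<in> W\<close>] u(2) by simp
    then have "((x \<circ> \<phi>) has_derivative (\<lambda>w. Der (x \<circ> (\<phi> \<circ> G)) p (Der \<theta> u w))) (at u)"
      by (rule has_derivative_transform_within_open[OF _ C(1) u(1)]) (simp add: G\<theta>)
    then have chain: "Der (x \<circ> \<phi>) u = (\<lambda>w. Der (x \<circ> (\<phi> \<circ> G)) p (Der \<theta> u w))" by (rule Der_eqI)
    have inj: "inj (\<lambda>w. Der (x \<circ> (\<phi> \<circ> G)) p (Der \<theta> u w))"
      using d\<phi>(5)[OF subsetD[OF C(5) u(1)]] unfolding chain .
    then have "inj (Der \<theta> u)" by (metis (mono_tags, lifting) injD injI)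
    then have "surj (Der \<theta> u)"
      using linear_injective_imp_surjective[OF Der_linear[OF d\<theta>[OF u(1)]]] by blast
    then show "inj (Der (x \<circ> (\<phi> \<circ> G)) p)"
      using inj unfolding inj_def surj_def by metis
  qed
  moreover have "\<phi> u0 \<in> (\<phi> \<circ> G) ` W"
    using C(2) G\<theta> by (auto simp: W_def image_iff intro!: bexI[of _ u0])
  moreover have "F (x ((\<phi> \<circ> G) p)) = Y (f (p $ 1)) (p $ 1) (p $ 2) (p $ 3)" if "p \<in> W" for p
    using xG[OF that] bijF by (simp add: P_def bij_is_surj surj_f_inv_f)
  ultimately have "congruent_near M x (\<phi> u0) I (\<lambda>s. Y (f s) s)"
    unfolding congruent_near_def using F WI by blast
  then show ?thesis using I f by blast
qed

lemma smooth_on_coordinates: "smooth_on (\<lambda>p::real^4. p $ i) UNIV"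
  by (rule smooth_on_bounded_linear[OF bounded_linear_vec_nth])

lemma smooth_on_vector_4:
  fixes a b c d :: "'a::real_normed_vector \<Rightarrow> real"
  assumes "open U" "smooth_on a U" "smooth_on b U" "smooth_on c U" "smooth_on d U"
  shows "smooth_on (\<lambda>p. vector [a p, b p, c p, d p] :: real^4) U"
proof (rule smooth_on_vec_lambda[OF assms(1)])
  show "smooth_on (\<lambda>p. (vector [a p, b p, c p, d p] :: real^4) $ i) U" for i
    using exhaust_4[of i] assms(2-) by auto
qed

lemma smooth_on_real_compose:
  fixes f :: "real \<Rightarrow> real"
  shows "smooth_on f UNIV \<Longrightarrow> smooth_on (\<lambda>p::real^4. f (p $ i)) UNIV"
  by (rule smooth_on_compose[OF open_UNIV _ smooth_on_coordinates]) auto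

lemmas smooth_coordinate_intros = smooth_on_vector_4[OF open_UNIV] smooth_on_mult[OF open_UNIV]
  smooth_on_add[OF open_UNIV] smooth_on_power[OF open_UNIV] smooth_on_coordinates
  smooth_on_real_compose[OF smooth_on_sin_cos(1)] smooth_on_real_compose[OF smooth_on_sin_cos(2)]
  smooth_on_real_compose[OF smooth_on_sinh_cosh(1)] smooth_on_real_compose[OF smooth_on_sinh_cosh(2)]

lemma differentiable_real_compose:
  fixes f :: "real \<Rightarrow> real" and g :: "'a::real_normed_vector \<Rightarrow> real"
  assumes "(f has_real_derivative D) (at (g u))" "g differentiable (at u)"
  shows "(\<lambda>u. f (g u)) differentiable (at u)"
  using has_derivative_compose[OF Der_works[OF assms(2)] has_field_derivative_imp_has_derivative[OF assms(1)]]
  by (rule differentiableI)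

lemma differentiable_arctan_quotient:
  fixes f g :: "'a::real_normed_vector \<Rightarrow> real"
  assumes "f differentiable (at u)" "g differentiable (at u)" "g u \<noteq> 0"
  shows "(\<lambda>u. arctan (f u / g u)) differentiable (at u)"
  by (rule differentiable_real_compose[OF DERIV_arctan differentiable_divide[OF assms]])

lemma differentiable_arccos_quotient:
  fixes f g :: "'a::real_normed_vector \<Rightarrow> real"
  assumes "f differentiable (at u)" "g differentiable (at u)" "\<bar>f u\<bar> < g u"
  shows "(\<lambda>u. arccos (f u / g u)) differentiable (at u)"
  using assms
  by (intro differentiable_real_compose[OF DERIV_arccos differentiable_divide]) (auto simp: field_simps abs_less_iff)

lemma differentiable_arsinh_quotient:
  fixes f g :: "'a::real_normed_vector \<Rightarrow> real"
  assumes "f differentiable (at u)" "g differentiable (at u)" "g u \<noteq> 0"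
  shows "(\<lambda>u. arsinh (f u / g u)) differentiable (at u)"
  by (rule differentiable_real_compose[OF arsinh_real_has_field_derivative differentiable_divide[OF assms]])

lemma differentiable_sqrt:
  fixes f :: "'a::real_normed_vector \<Rightarrow> real"
  assumes "f differentiable (at u)" "f u > 0"
  shows "(\<lambda>u. sqrt (f u)) differentiable (at u)"
  by (rule differentiable_real_compose[OF DERIV_real_sqrt[OF assms(2)] assms(1)])

lemma sin_arccos_quotient:
  fixes s c :: real
  assumes "s > 0" "\<bar>c\<bar> < s"
  shows "s * sin (arccos (c / s)) = sqrt (s\<^sup>2 - c\<^sup>2)"
proof -
  have "\<bar>c / s\<bar> \<le> 1" using assms by simp
  then have "s * sin (arccos (c / s)) = sqrt (s\<^sup>2) * sqrt (1 - (c / s)\<^sup>2)"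
    using assms(1) by (simp add: sin_arccos_abs)
  also have "\<dots> = sqrt (s\<^sup>2 * (1 - (c / s)\<^sup>2))" by (rule real_sqrt_mult[symmetric])
  also have "s\<^sup>2 * (1 - (c / s)\<^sup>2) = s\<^sup>2 - c\<^sup>2"
    using assms(1) by (simp add: power_divide field_simps)
  finally show ?thesis .
qed

lemma smooth_on_sqrt_compose:
  fixes Q :: "'a::real_normed_vector \<Rightarrow> real"
  assumes "open B" "smooth_on Q B" "\<And>u. u \<in> B \<Longrightarrow> Q u > 0"
  shows "smooth_on (\<lambda>u. sqrt (Q u)) B"
  using smooth_on_compose[OF assms(1) smooth_on_sqrt assms(2)] assms(3) by simp

lemma Der_sqrt:
  fixes Q :: "'a::real_normed_vector \<Rightarrow> real"
  assumes "Q differentiable (at u)" "Q u > 0"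
  shows "Der (\<lambda>u. sqrt (Q u)) u v = 0 \<longleftrightarrow> Der Q u v = 0"
  unfolding Der_real_compose[OF DERIV_real_sqrt[OF assms(2)] assms(1)] using assms(2) by simp

lemma open_positive_part:
  fixes f :: "'a::real_normed_vector \<Rightarrow> real"
  assumes "open B" "smooth_on f B"
  shows "open {u \<in> B. f u > 0}"
  using continuous_open_preimage[OF smooth_on_imp_continuous_on[OF assms(2)] assms(1) open_greaterThan, of 0]
  by (simp add: vimage_def Int_def)

text \<open>The isometry \<open>F\<close> is going to move the axis into the position that it has in the model, where the
  rotations that preserve the axis act in an obvious way on the coordinates \<open>l\<close>. Each of the four
  lemmas below recovers the parameters of one model from these coordinates: \<open>s\<close> is the distance from
  the axis (for a null axis, the null coordinate that is constant on the leaves), the function of the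
  model comes from the position along the axis, and the other two parameters from the position on
  the leaf. All that is used
  about the hypersurface is that \<open>s\<close> is regular and that the position along the axis is constant on the
  level sets of \<open>s\<close>.\<close>

locale axial_chart =
  fixes M :: "'m topology" and x :: "'m \<Rightarrow> real^4" and U B :: "(real^3) set" and \<phi> :: "real^3 \<Rightarrow> 'm"
    and F :: "real^4 \<Rightarrow> real^4" and l :: "real^3 \<Rightarrow> real^4" and u0 :: "real^3"
  assumes \<phi>: "local_param M x U \<phi>" and B: "open B" "u0 \<in> B" "B \<subseteq> U" and F: "minkowski_isometry F"
    and l: "smooth_on l B" and Fl: "u \<in> B \<Longrightarrow> F (x (\<phi> u)) = l u"
begin

abbreviation near :: "(real \<Rightarrow> real) \<Rightarrow> real set \<Rightarrow> ((real \<Rightarrow> real) \<Rightarrow> real \<Rightarrow> real \<Rightarrow> real \<Rightarrow> real^4) \<Rightarrow> bool" where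
  "near f I Y \<equiv> open I \<and> is_interval I \<and> smooth_on f I \<and> congruent_near M x (\<phi> u0) I (Y f)"

lemma li: "smooth_on (\<lambda>u. l u $ i) B"
  by (rule smooth_on_vec_nth[OF B(1) l])

lemmas l_intros = smooth_on_add[OF B(1)] smooth_on_diff[OF B(1)] smooth_on_power[OF B(1)] li

lemma dl: "u \<in> B \<Longrightarrow> (\<lambda>u. l u $ i) differentiable (at u)"
  by (rule smooth_on_differentiable[OF li])

lemma near_model1:
  assumes l0: "l u0 $ 2 > 0"
    and nz: "Der (\<lambda>u. (l u $ 2)\<^sup>2 + (l u $ 3)\<^sup>2 + (l u $ 4)\<^sup>2) u0 v \<noteq> 0"
    and ker: "\<And>u w. u \<in> B \<Longrightarrow> Der (\<lambda>u. (l u $ 2)\<^sup>2 + (l u $ 3)\<^sup>2 + (l u $ 4)\<^sup>2) u w = 0 \<Longrightarrow> Der (\<lambda>u. l u $ 1) u w = 0"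
  shows "\<exists>f I. near f I model1"
proof -
  define Q where "Q u = (l u $ 2)\<^sup>2 + (l u $ 3)\<^sup>2 + (l u $ 4)\<^sup>2" for u
  define s where "s u = sqrt (Q u)" for u
  define C where "C = {u \<in> B. l u $ 2 > 0}"
  have C: "open C" "u0 \<in> C" "C \<subseteq> B" "C \<subseteq> U"
    using open_positive_part[OF B(1) li[of 2]] B l0 by (auto simp: C_def)
  have pos: "l u $ 2 > 0" "Q u > 0" "s u > 0" "\<bar>l u $ 4\<bar> < s u" if "u \<in> C" for u
  proof -
    show p: "l u $ 2 > 0" using that by (simp add: C_def)
    then have "(l u $ 4)\<^sup>2 < Q u" by (simp add: Q_def add_pos_nonneg)
    then show "\<bar>l u $ 4\<bar> < s u" unfolding s_def by (rule real_less_rsqrt[of "\<bar>l u $ 4\<bar>", simplified])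
    show "Q u > 0" using p by (simp add: Q_def add_pos_nonneg)
    then show "s u > 0" by (simp add: s_def)
  qed
  have sQ: "smooth_on Q C"
    unfolding Q_def by (rule smooth_on_subset[OF _ C(3)]) (intro l_intros)
  have dQ: "Q differentiable (at u)" if "u \<in> C" for u by (rule smooth_on_differentiable[OF sQ that])
  have ss: "smooth_on s C" unfolding s_def by (rule smooth_on_sqrt_compose[OF C(1) sQ pos(2)])
  show ?thesis
    unfolding model1_def
  proof (rule congruent_near_of_coordinates[OF \<phi> C(1,2,4) F,
        where Y = "\<lambda>c s t u. vector [c, s * cos t * sin u, s * sin t * sin u, s * cos u]"
        and s = s and g = "\<lambda>u. l u $ 1" and \<tau> = "\<lambda>u. arctan (l u $ 3 / l u $ 2)"
        and \<upsilon> = "\<lambda>u. arccos (l u $ 4 / s u)" and v = v])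
    show "smooth_on (\<lambda>p::real^4. vector [p $ 1, p $ 2 * cos (p $ 3) * sin (p $ 4), p $ 2 * sin (p $ 3) * sin (p $ 4),
        p $ 2 * cos (p $ 4)] :: real^4) UNIV"
      by (intro smooth_coordinate_intros)
    show "smooth_on s C" by (rule ss)
    show "smooth_on (\<lambda>u. l u $ 1) C" by (rule smooth_on_subset[OF li C(3)])
    show "(\<lambda>u. arctan (l u $ 3 / l u $ 2)) differentiable (at u)" if "u \<in> C" for u
      using dl[of u] pos(1)[OF that] C that by (intro differentiable_arctan_quotient) auto
    show "(\<lambda>u. arccos (l u $ 4 / s u)) differentiable (at u)" if "u \<in> C" for u
      using dl[of u] C that by (intro differentiable_arccos_quotient pos smooth_on_differentiable[OF ss]) auto
    show "Der s u0 v \<noteq> 0"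
      using nz unfolding s_def Der_sqrt[OF dQ pos(2), OF C(2) C(2)] by (simp add: Q_def[abs_def])
    show "Der (\<lambda>u. l u $ 1) u w = 0" if "u \<in> C" "Der s u w = 0" for u w
      using that(2) ker[of u w] C(3) that(1) unfolding s_def Der_sqrt[OF dQ pos(2), OF that(1) that(1)]
      by (auto simp: Q_def[abs_def])
    show "F (x (\<phi> u)) = vector [l u $ 1, s u * cos (arctan (l u $ 3 / l u $ 2)) * sin (arccos (l u $ 4 / s u)),
        s u * sin (arctan (l u $ 3 / l u $ 2)) * sin (arccos (l u $ 4 / s u)), s u * cos (arccos (l u $ 4 / s u))]"
      if u: "u \<in> C" for u
    proof -
      note p = pos[OF u]
      define \<rho> where "\<rho> = sqrt ((l u $ 2)\<^sup>2 + (l u $ 3)\<^sup>2)"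
      have \<rho>: "\<rho> > 0" using p(1) by (simp add: \<rho>_def add_pos_nonneg)
      have q: "\<bar>l u $ 4 / s u\<bar> < 1" using p by simp
      have sin4: "s u * sin (arccos (l u $ 4 / s u)) = \<rho>"
        using p(2) sin_arccos_quotient[OF p(3,4)] by (simp add: \<rho>_def s_def Q_def)
      have "1 + (l u $ 3 / l u $ 2)\<^sup>2 = (\<rho> / l u $ 2)\<^sup>2"
        using p(1) by (simp add: \<rho>_def power_divide field_simps)
      then have sq: "sqrt (1 + (l u $ 3 / l u $ 2)\<^sup>2) = \<rho> / l u $ 2" using p(1) \<rho> by simp
      have "\<rho> * cos (arctan (l u $ 3 / l u $ 2)) = l u $ 2" "\<rho> * sin (arctan (l u $ 3 / l u $ 2)) = l u $ 3"
        unfolding cos_arctan sin_arctan sq using p(1) \<rho> by simp_all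
      then have "s u * cos (arctan (l u $ 3 / l u $ 2)) * sin (arccos (l u $ 4 / s u)) = l u $ 2"
        "s u * sin (arctan (l u $ 3 / l u $ 2)) * sin (arccos (l u $ 4 / s u)) = l u $ 3"
        using sin4 by (metis mult.assoc mult.commute)+
      moreover have "s u * cos (arccos (l u $ 4 / s u)) = l u $ 4" using q p(3) by (simp add: cos_arccos_abs)
      ultimately show ?thesis using Fl[of u] u C(3) by (auto simp: vec_eq_iff forall_4)
    qed
  qed
qed

lemma near_model2:
  assumes l0: "l u0 $ 2 > 0" "(l u0 $ 2)\<^sup>2 > (l u0 $ 1)\<^sup>2"
    and nz: "Der (\<lambda>u. (l u $ 2)\<^sup>2 - (l u $ 1)\<^sup>2 + (l u $ 3)\<^sup>2) u0 v \<noteq> 0"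
    and ker: "\<And>u w. u \<in> B \<Longrightarrow> Der (\<lambda>u. (l u $ 2)\<^sup>2 - (l u $ 1)\<^sup>2 + (l u $ 3)\<^sup>2) u w = 0 \<Longrightarrow> Der (\<lambda>u. l u $ 4) u w = 0"
  shows "\<exists>f I. near f I model2"
proof -
  define R where "R u = (l u $ 2)\<^sup>2 - (l u $ 1)\<^sup>2" for u
  define Q where "Q u = (l u $ 2)\<^sup>2 - (l u $ 1)\<^sup>2 + (l u $ 3)\<^sup>2" for u
  define s where "s u = sqrt (Q u)" for u
  have sR: "smooth_on R B" unfolding R_def by (intro l_intros)
  define C where "C = {u \<in> B. l u $ 2 > 0} \<inter> {u \<in> B. R u > 0}"
  have C: "open C" "u0 \<in> C" "C \<subseteq> B" "C \<subseteq> U"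
    using open_positive_part[OF B(1) li[of 2]] open_positive_part[OF B(1) sR] B l0 by (auto simp: C_def R_def)
  have pos: "l u $ 2 > 0" "R u > 0" "Q u > 0" "s u > 0" "\<bar>l u $ 3\<bar> < s u" if "u \<in> C" for u
  proof -
    show "l u $ 2 > 0" and p: "R u > 0" using that by (auto simp: C_def)
    have "(l u $ 3)\<^sup>2 < Q u" using p by (simp add: Q_def R_def)
    then show "\<bar>l u $ 3\<bar> < s u" unfolding s_def by (rule real_less_rsqrt[of "\<bar>l u $ 3\<bar>", simplified])
    show "Q u > 0" using p by (simp add: Q_def R_def add_pos_nonneg)
    then show "s u > 0" by (simp add: s_def)
  qed
  have sQ: "smooth_on Q C"
    unfolding Q_def by (rule smooth_on_subset[OF _ C(3)]) (intro l_intros)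
  have dQ: "Q differentiable (at u)" if "u \<in> C" for u by (rule smooth_on_differentiable[OF sQ that])
  have dR: "R differentiable (at u)" if "u \<in> C" for u
    using smooth_on_differentiable[OF sR] C that by blast
  have ss: "smooth_on s C" unfolding s_def by (rule smooth_on_sqrt_compose[OF C(1) sQ pos(3)])
  show ?thesis
    unfolding model2_def
  proof (rule congruent_near_of_coordinates[OF \<phi> C(1,2,4) F,
        where Y = "\<lambda>c s t u. vector [s * sinh u * sin t, s * cosh u * sin t, s * cos t, c]"
        and s = s and g = "\<lambda>u. l u $ 4" and \<tau> = "\<lambda>u. arccos (l u $ 3 / s u)"
        and \<upsilon> = "\<lambda>u. arsinh (l u $ 1 / sqrt (R u))" and v = v])
    show "smooth_on (\<lambda>p::real^4. vector [p $ 2 * sinh (p $ 4) * sin (p $ 3), p $ 2 * cosh (p $ 4) * sin (p $ 3),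
        p $ 2 * cos (p $ 3), p $ 1] :: real^4) UNIV"
      by (intro smooth_coordinate_intros)
    show "smooth_on s C" by (rule ss)
    show "smooth_on (\<lambda>u. l u $ 4) C" by (rule smooth_on_subset[OF li C(3)])
    show "(\<lambda>u. arccos (l u $ 3 / s u)) differentiable (at u)" if "u \<in> C" for u
      using dl[of u] C that by (intro differentiable_arccos_quotient pos smooth_on_differentiable[OF ss]) auto
    show "(\<lambda>u. arsinh (l u $ 1 / sqrt (R u))) differentiable (at u)" if "u \<in> C" for u
      using dl[of u] C that pos(2)[OF that]
      by (intro differentiable_arsinh_quotient differentiable_sqrt dR) auto
    show "Der s u0 v \<noteq> 0"
      using nz unfolding s_def Der_sqrt[OF dQ pos(3), OF C(2) C(2)] by (simp add: Q_def[abs_def])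
    show "Der (\<lambda>u. l u $ 4) u w = 0" if "u \<in> C" "Der s u w = 0" for u w
      using that(2) ker[of u w] C(3) that(1) unfolding s_def Der_sqrt[OF dQ pos(3), OF that(1) that(1)]
      by (auto simp: Q_def[abs_def])
    show "F (x (\<phi> u)) = vector [s u * sinh (arsinh (l u $ 1 / sqrt (R u))) * sin (arccos (l u $ 3 / s u)),
        s u * cosh (arsinh (l u $ 1 / sqrt (R u))) * sin (arccos (l u $ 3 / s u)),
        s u * cos (arccos (l u $ 3 / s u)), l u $ 4]"
      if u: "u \<in> C" for u
    proof -
      note p = pos[OF u]
      have \<rho>: "sqrt (R u) > 0" using p by simp
      have q: "\<bar>l u $ 3 / s u\<bar> < 1" using p by simp
      have sin3: "s u * sin (arccos (l u $ 3 / s u)) = sqrt (R u)"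
        using p(3) sin_arccos_quotient[OF p(4,5)] by (simp add: R_def s_def Q_def)
      have "(l u $ 1 / sqrt (R u))\<^sup>2 + 1 = (l u $ 2 / sqrt (R u))\<^sup>2"
        using p(2) by (simp add: power_divide field_simps) (simp add: R_def)
      then have sq: "sqrt ((l u $ 1 / sqrt (R u))\<^sup>2 + 1) = l u $ 2 / sqrt (R u)" using p(1) \<rho> by simp
      have "sqrt (R u) * sinh (arsinh (l u $ 1 / sqrt (R u))) = l u $ 1"
        "sqrt (R u) * cosh (arsinh (l u $ 1 / sqrt (R u))) = l u $ 2"
        unfolding cosh_arsinh_real sinh_arsinh_real sq using \<rho> by simp_all
      then have "s u * sinh (arsinh (l u $ 1 / sqrt (R u))) * sin (arccos (l u $ 3 / s u)) = l u $ 1"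
        "s u * cosh (arsinh (l u $ 1 / sqrt (R u))) * sin (arccos (l u $ 3 / s u)) = l u $ 2"
        using sin3 by (metis mult.assoc mult.commute)+
      moreover have "s u * cos (arccos (l u $ 3 / s u)) = l u $ 3" using q p(4) by (simp add: cos_arccos_abs)
      ultimately show ?thesis using Fl[of u] u C(3) by (auto simp: vec_eq_iff forall_4)
    qed
  qed
qed

lemma near_model3:
  assumes l0: "l u0 $ 1 > 0" "l u0 $ 3 > 0" "(l u0 $ 1)\<^sup>2 > (l u0 $ 2)\<^sup>2 + (l u0 $ 3)\<^sup>2"
    and nz: "Der (\<lambda>u. (l u $ 1)\<^sup>2 - (l u $ 2)\<^sup>2 - (l u $ 3)\<^sup>2) u0 v \<noteq> 0"
    and ker: "\<And>u w. u \<in> B \<Longrightarrow> Der (\<lambda>u. (l u $ 1)\<^sup>2 - (l u $ 2)\<^sup>2 - (l u $ 3)\<^sup>2) u w = 0 \<Longrightarrow> Der (\<lambda>u. l u $ 4) u w = 0"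
  shows "\<exists>f I. near f I model3"
proof -
  define R where "R u = (l u $ 2)\<^sup>2 + (l u $ 3)\<^sup>2" for u
  define Q where "Q u = (l u $ 1)\<^sup>2 - (l u $ 2)\<^sup>2 - (l u $ 3)\<^sup>2" for u
  define s where "s u = sqrt (Q u)" for u
  have sR: "smooth_on R B" unfolding R_def by (intro l_intros)
  have sQB: "smooth_on Q B" unfolding Q_def by (intro l_intros)
  define C where "C = {u \<in> B. l u $ 1 > 0} \<inter> {u \<in> B. l u $ 3 > 0} \<inter> {u \<in> B. Q u > 0}"
  have C: "open C" "u0 \<in> C" "C \<subseteq> B" "C \<subseteq> U"
    using open_positive_part[OF B(1) li[of 1]] open_positive_part[OF B(1) li[of 3]]
      open_positive_part[OF B(1) sQB] B l0 by (auto simp: C_def Q_def)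
  have pos: "l u $ 1 > 0" "l u $ 3 > 0" "R u > 0" "Q u > 0" "s u > 0" if "u \<in> C" for u
  proof -
    show "l u $ 1 > 0" and p: "l u $ 3 > 0" and q: "Q u > 0" using that by (auto simp: C_def)
    show "R u > 0" using p by (simp add: R_def add_nonneg_pos)
    show "s u > 0" using q by (simp add: s_def)
  qed
  have sQ: "smooth_on Q C" by (rule smooth_on_subset[OF sQB C(3)])
  have dQ: "Q differentiable (at u)" if "u \<in> C" for u by (rule smooth_on_differentiable[OF sQ that])
  have dR: "R differentiable (at u)" if "u \<in> C" for u
    using smooth_on_differentiable[OF sR] C that by blast
  have ss: "smooth_on s C" unfolding s_def by (rule smooth_on_sqrt_compose[OF C(1) sQ pos(4)])
  show ?thesis
    unfolding model3_def
  proof (rule congruent_near_of_coordinates[OF \<phi> C(1,2,4) F,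
        where Y = "\<lambda>c s t u. vector [s * cosh t, s * sinh t * sin u, s * sinh t * cos u, c]"
        and s = s and g = "\<lambda>u. l u $ 4" and \<tau> = "\<lambda>u. arsinh (sqrt (R u) / s u)"
        and \<upsilon> = "\<lambda>u. arctan (l u $ 2 / l u $ 3)" and v = v])
    show "smooth_on (\<lambda>p::real^4. vector [p $ 2 * cosh (p $ 3), p $ 2 * sinh (p $ 3) * sin (p $ 4),
        p $ 2 * sinh (p $ 3) * cos (p $ 4), p $ 1] :: real^4) UNIV"
      by (intro smooth_coordinate_intros)
    show "smooth_on s C" by (rule ss)
    show "smooth_on (\<lambda>u. l u $ 4) C" by (rule smooth_on_subset[OF li C(3)])
    show "(\<lambda>u. arsinh (sqrt (R u) / s u)) differentiable (at u)" if "u \<in> C" for u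
      using pos[OF that]
      by (intro differentiable_arsinh_quotient differentiable_sqrt dR that smooth_on_differentiable[OF ss]) auto
    show "(\<lambda>u. arctan (l u $ 2 / l u $ 3)) differentiable (at u)" if "u \<in> C" for u
      using dl[of u] pos(2)[OF that] C that by (intro differentiable_arctan_quotient) auto
    show "Der s u0 v \<noteq> 0"
      using nz unfolding s_def Der_sqrt[OF dQ pos(4), OF C(2) C(2)] by (simp add: Q_def[abs_def])
    show "Der (\<lambda>u. l u $ 4) u w = 0" if "u \<in> C" "Der s u w = 0" for u w
      using that(2) ker[of u w] C(3) that(1) unfolding s_def Der_sqrt[OF dQ pos(4), OF that(1) that(1)]
      by (auto simp: Q_def[abs_def])
    show "F (x (\<phi> u)) = vector [s u * cosh (arsinh (sqrt (R u) / s u)),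
        s u * sinh (arsinh (sqrt (R u) / s u)) * sin (arctan (l u $ 2 / l u $ 3)),
        s u * sinh (arsinh (sqrt (R u) / s u)) * cos (arctan (l u $ 2 / l u $ 3)), l u $ 4]"
      if u: "u \<in> C" for u
    proof -
      note p = pos[OF u]
      have \<rho>: "sqrt (R u) > 0" using p by simp
      have sh: "s u * sinh (arsinh (sqrt (R u) / s u)) = sqrt (R u)" using p(5) by simp
      have "(sqrt (R u) / s u)\<^sup>2 + 1 = (l u $ 1 / s u)\<^sup>2"
        using p by (simp add: power_divide s_def field_simps) (simp add: R_def Q_def)
      then have ch: "s u * cosh (arsinh (sqrt (R u) / s u)) = l u $ 1"
        unfolding cosh_arsinh_real using p by simp
      have "1 + (l u $ 2 / l u $ 3)\<^sup>2 = (sqrt (R u) / l u $ 3)\<^sup>2"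
        using p by (simp add: power_divide field_simps) (simp add: R_def)
      then have sq: "sqrt (1 + (l u $ 2 / l u $ 3)\<^sup>2) = sqrt (R u) / l u $ 3" using p(2) \<rho> by simp
      have "sqrt (R u) * cos (arctan (l u $ 2 / l u $ 3)) = l u $ 3" "sqrt (R u) * sin (arctan (l u $ 2 / l u $ 3)) = l u $ 2"
        unfolding cos_arctan sin_arctan sq using p(2) \<rho> by simp_all
      then show ?thesis using Fl[of u] u C(3) sh ch by (auto simp: vec_eq_iff forall_4)
    qed
  qed
qed

text \<open>In the model \<open>- l \<diamond> l = s\<^sup>2 + 2 s f(s)\<close>, which determines the function of the model.\<close>

lemma near_model4:
  assumes l0: "l u0 $ 1 \<noteq> l u0 $ 4"
    and nz: "Der (\<lambda>u. l u $ 1 - l u $ 4) u0 v \<noteq> 0"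
    and ker: "\<And>u w. u \<in> B \<Longrightarrow> Der (\<lambda>u. l u $ 1 - l u $ 4) u w = 0 \<Longrightarrow> Der (\<lambda>u. l u \<diamond> l u) u w = 0"
  shows "\<exists>f I. near f I model4"
proof -
  define s where "s u = l u $ 1 - l u $ 4" for u
  define g where "g u = (- 1/2) * ((l u \<diamond> l u + s u * s u) * inverse (s u))" for u
  have sB: "smooth_on s B" unfolding s_def by (intro l_intros)
  define C where "C = {u \<in> B. (s u)\<^sup>2 > 0}"
  have C: "open C" "u0 \<in> C" "C \<subseteq> B" "C \<subseteq> U"
    using open_positive_part[OF B(1) smooth_on_power[OF B(1) sB, of 2]] B l0 by (auto simp: C_def s_def)
  have nzs: "s u \<noteq> 0" if "u \<in> C" for u using that by (simp add: C_def)
  have ss: "smooth_on s C" by (rule smooth_on_subset[OF sB C(3)])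
  have lC: "smooth_on l C" by (rule smooth_on_subset[OF l C(3)])
  have sq: "smooth_on (\<lambda>u. l u \<diamond> l u) C"
    by (rule smooth_on_bounded_bilinear[OF bounded_bilinear_minkowski C(1) lC lC])
  have sg: "smooth_on g C"
    unfolding g_def
    by (intro smooth_on_mult[OF C(1)] smooth_on_const smooth_on_add[OF C(1)] sq ss
        smooth_on_inverse[OF C(1) ss] nzs)
  have dq: "(\<lambda>u. l u \<diamond> l u) differentiable (at u)" and ds: "s differentiable (at u)" if "u \<in> C" for u
    using smooth_on_differentiable[OF sq that] smooth_on_differentiable[OF ss that] by blast+
  show ?thesis
    unfolding model4_def
  proof (rule congruent_near_of_coordinates[OF \<phi> C(1,2,4) F,
        where Y = "\<lambda>c s t u. vector [s * (t\<^sup>2 + u\<^sup>2) / 2 + s + c, s * t, s * u, s * (t\<^sup>2 + u\<^sup>2) / 2 + c]"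
        and s = s and g = g and \<tau> = "\<lambda>u. l u $ 2 / s u"
        and \<upsilon> = "\<lambda>u. l u $ 3 / s u" and v = v])
    show "smooth_on (\<lambda>p::real^4. vector [p $ 2 * ((p $ 3)\<^sup>2 + (p $ 4)\<^sup>2) / 2 + p $ 2 + p $ 1, p $ 2 * p $ 3,
        p $ 2 * p $ 4, p $ 2 * ((p $ 3)\<^sup>2 + (p $ 4)\<^sup>2) / 2 + p $ 1] :: real^4) UNIV"
      by (intro smooth_coordinate_intros smooth_on_divide[OF open_UNIV] smooth_on_const) simp_all
    show "smooth_on s C" "smooth_on g C" by (fact ss sg)+
    show "(\<lambda>u. l u $ 2 / s u) differentiable (at u)" "(\<lambda>u. l u $ 3 / s u) differentiable (at u)" if "u \<in> C" for u
      using dl[of u] C that by (auto intro!: differentiable_divide ds nzs)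
    show "Der s u0 v \<noteq> 0" using nz unfolding s_def .
    show "Der g u w = 0" if u: "u \<in> C" and sw: "Der s u w = 0" for u w
    proof -
      have "((\<lambda>u. inverse (s u)) has_derivative (\<lambda>w. - (inverse (s u) * Der s u w * inverse (s u)))) (at u)"
        by (rule Deriv.has_derivative_inverse[OF nzs[OF u] Der_works[OF ds[OF u]]])
      then have i: "(\<lambda>u. inverse (s u)) differentiable (at u)" "Der (\<lambda>u. inverse (s u)) u w = 0"
        using Der_eqI[of "\<lambda>u. inverse (s u)"] sw by (auto intro: differentiableI)
      have lw: "Der (\<lambda>u. l u \<diamond> l u) u w = 0"
        using ker[of u w] sw u C(3) by (auto simp: s_def[abs_def])
      have ss2: "(\<lambda>u. s u * s u) differentiable (at u)" "Der (\<lambda>u. s u * s u) u w = 0"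
        using Der_mult_real[OF ds[OF u] ds[OF u], of w] sw differentiable_mult[OF ds[OF u] ds[OF u]] by auto
      have sum: "(\<lambda>u. l u \<diamond> l u + s u * s u) differentiable (at u)"
        by (rule differentiable_add[OF dq[OF u] ss2(1)])
      show ?thesis
        unfolding g_def Der_bounded_linear_comp[OF bounded_linear_mult_right differentiable_mult[OF sum i(1)]]
          Der_mult_real[OF sum i(1)] Der_add[OF dq[OF u] ss2(1)] i(2) lw ss2(2) by simp
    qed
    show "F (x (\<phi> u)) = vector [s u * ((l u $ 2 / s u)\<^sup>2 + (l u $ 3 / s u)\<^sup>2) / 2 + s u + g u, s u * (l u $ 2 / s u),
        s u * (l u $ 3 / s u), s u * ((l u $ 2 / s u)\<^sup>2 + (l u $ 3 / s u)\<^sup>2) / 2 + g u]"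
      if u: "u \<in> C" for u
    proof -
      have nz: "s u \<noteq> 0" by (rule nzs[OF u])
      have l1: "l u $ 1 = s u + l u $ 4" by (simp add: s_def)
      have g: "2 * s u * g u = - (l u \<diamond> l u + s u * s u)" using nz by (simp add: g_def field_simps)
      have "2 * s u * (s u * ((l u $ 2 / s u)\<^sup>2 + (l u $ 3 / s u)\<^sup>2) / 2 + g u)
          = (l u $ 2)\<^sup>2 + (l u $ 3)\<^sup>2 + 2 * s u * g u"
        using nz by (simp add: field_simps power2_eq_square)
      also have "\<dots> = 2 * s u * l u $ 4"
        unfolding g minkowski_def l1 by (simp add: algebra_simps power2_eq_square)
      finally have "s u * ((l u $ 2 / s u)\<^sup>2 + (l u $ 3 / s u)\<^sup>2) / 2 + g u = l u $ 4"
        using nz by simp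
      then show ?thesis using Fl[of u] u C(3) nz l1 by (auto simp: vec_eq_iff forall_4)
    qed
  qed
qed

end

section \<open>Lorentz frames\<close>

text \<open>The coordinates of \<open>z - c0\<close> with respect to a Lorentz frame; the sign of the first one accounts
  for \<open>v1 \<diamond> v1 = - 1\<close>.\<close>

lemma lorentz_frame_isometry:
  fixes c0 :: "real^4"
  assumes v: "v1 \<diamond> v1 = - 1" "v2 \<diamond> v2 = 1" "v3 \<diamond> v3 = 1" "v4 \<diamond> v4 = 1"
    "v1 \<diamond> v2 = 0" "v1 \<diamond> v3 = 0" "v1 \<diamond> v4 = 0" "v2 \<diamond> v3 = 0" "v2 \<diamond> v4 = 0" "v3 \<diamond> v4 = 0"
  defines "F \<equiv> \<lambda>z. vector [- ((z - c0) \<diamond> v1), (z - c0) \<diamond> v2, (z - c0) \<diamond> v3, (z - c0) \<diamond> v4]"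
  shows "minkowski_isometry F" "smooth_on F UNIV" "F a \<diamond> F b = (a - c0) \<diamond> (b - c0)"
proof -
  have v': "v2 \<diamond> v1 = 0" "v3 \<diamond> v1 = 0" "v4 \<diamond> v1 = 0" "v3 \<diamond> v2 = 0" "v4 \<diamond> v2 = 0" "v4 \<diamond> v3 = 0"
    using v minkowski_commute by metis+
  define L :: "real^4 \<Rightarrow> real^4" where "L z = vector [- (z \<diamond> v1), z \<diamond> v2, z \<diamond> v3, z \<diamond> v4]" for z
  define K :: "real^4 \<Rightarrow> real^4" where
    "K r = (r $ 1) *\<^sub>R v1 + (r $ 2) *\<^sub>R v2 + (r $ 3) *\<^sub>R v3 + (r $ 4) *\<^sub>R v4" for r
  have linL: "bounded_linear L" and linK: "bounded_linear K"
    unfolding linear_conv_bounded_linear[symmetric]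
    by (rule linearI; simp add: L_def K_def vec_eq_iff forall_4 minkowski_simps algebra_simps)+
  have LK: "L (K r) = r" for r
    by (simp add: L_def K_def vec_eq_iff forall_4 minkowski_simps v v')
  have KL: "K (L z) = z" for z
  proof -
    obtain r1 r2 r3 r4 where z: "z = r1 *\<^sub>R v1 + r2 *\<^sub>R v2 + r3 *\<^sub>R v3 + r4 *\<^sub>R v4"
      using minkowski_orthogonal_basis[of v1 v2 v3 v4 z] v by auto
    show ?thesis by (simp add: L_def K_def z minkowski_simps v v')
  qed
  have LL: "L a \<diamond> L b = a \<diamond> b" for a b
  proof -
    have "L (K r) \<diamond> L (K t) = K r \<diamond> K t" for r t
      unfolding LK by (simp add: K_def minkowski_simps v v') (simp add: minkowski_def)
    from this[of "L a" "L b"] show ?thesis by (simp add: KL)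
  qed
  have F: "F = (\<lambda>z. L z - L c0)"
    by (simp add: F_def L_def fun_eq_iff vec_eq_iff forall_4 minkowski_simps)
  define G where "G r = K r + c0" for r
  have FG: "F (G r) = r" and GF: "G (F z) = z" for r z
    using LK KL bounded_linear.linear[OF linL] bounded_linear.linear[OF linK]
    by (simp_all add: F G_def linear_add linear_diff)
  have bij: "bij F" by (rule o_bij[of G]) (simp_all add: fun_eq_iff FG GF)
  have inv: "inv F = G" by (rule inv_equality) (simp_all add: FG GF)
  show sF: "smooth_on F UNIV"
    unfolding F by (intro smooth_on_diff smooth_on_const smooth_on_bounded_linear[OF linL]) simp
  have sG: "smooth_on G UNIV"
    unfolding G_def[abs_def] by (intro smooth_on_add smooth_on_const smooth_on_bounded_linear[OF linK]) simp
  have "(F has_derivative L) (at p)" for p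
    unfolding F by (auto intro!: derivative_eq_intros bounded_linear_imp_has_derivative[OF linL])
  then have "Der F p = L" for p by (rule Der_eqI)
  then show "minkowski_isometry F"
    unfolding minkowski_isometry_def inv using bij sF sG LL by simp
  show "F a \<diamond> F b = (a - c0) \<diamond> (b - c0)"
    using LL[of "a - c0" "b - c0"] bounded_linear.linear[OF linL] by (simp add: F linear_diff)
qed

text \<open>By the Cauchy-Schwarz inequality for the spatial parts.\<close>

lemma orthogonal_to_timelike:
  assumes t: "t \<diamond> t < 0" and w: "t \<diamond> w = 0" "w \<diamond> w \<noteq> 0"
  shows "w \<diamond> w > 0"
proof (rule ccontr)
  assume "\<not> w \<diamond> w > 0"
  then have w2: "w \<diamond> w < 0" using w(2) by simp
  define P where "P a b = a$2 * b$2 + a$3 * b$3 + a$4 * b$4" for a b :: "real^4"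
  have m: "a \<diamond> b = - (a$1 * b$1) + P a b" for a b by (simp add: minkowski_def P_def)
  have CS: "(P t w)\<^sup>2 \<le> P t t * P w w"
  proof -
    have "P t t * P w w - (P t w)\<^sup>2 = (t$2 * w$3 - t$3 * w$2)\<^sup>2 + (t$2 * w$4 - t$4 * w$2)\<^sup>2 + (t$3 * w$4 - t$4 * w$3)\<^sup>2"
      by (simp add: P_def power2_eq_square algebra_simps)
    then show ?thesis by (smt (verit) zero_le_power2)
  qed
  have nonneg: "P t t \<ge> 0" "P w w \<ge> 0" by (simp_all add: P_def)
  have "P t t < (t$1)\<^sup>2" "P w w < (w$1)\<^sup>2" "P t w = t$1 * w$1"
    using t w(1) w2 by (simp_all add: m power2_eq_square)
  then have "P t t * P w w < (t$1)\<^sup>2 * (w$1)\<^sup>2"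
    using nonneg by (intro mult_strict_mono') auto
  then show False using CS \<open>P t w = t$1 * w$1\<close> by (simp add: power_mult_distrib)
qed

lemma unit_orthogonal_to_timelike:
  assumes "t \<diamond> t = - 1" "t \<diamond> w = 0" "\<bar>w \<diamond> w\<bar> = 1"
  shows "w \<diamond> w = 1"
proof -
  have "w \<diamond> w \<noteq> 0" using assms(3) by auto
  then show ?thesis using orthogonal_to_timelike[of t w] assms by simp
qed

text \<open>Otherwise the Minkowski form would be positive definite.\<close>

lemma timelike_in_orthonormal_frame:
  assumes o: "v1 \<diamond> v2 = 0" "v1 \<diamond> v3 = 0" "v1 \<diamond> v4 = 0" "v2 \<diamond> v3 = 0" "v2 \<diamond> v4 = 0" "v3 \<diamond> v4 = 0"
    and pos: "v1 \<diamond> v1 > 0" "v2 \<diamond> v2 > 0" "v3 \<diamond> v3 > 0"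
    and "v4 \<diamond> v4 \<noteq> 0"
  shows "v4 \<diamond> v4 < 0"
proof (rule ccontr)
  assume "\<not> v4 \<diamond> v4 < 0"
  then have pos4: "v4 \<diamond> v4 > 0" using assms by simp
  have o': "v2 \<diamond> v1 = 0" "v3 \<diamond> v1 = 0" "v4 \<diamond> v1 = 0" "v3 \<diamond> v2 = 0" "v4 \<diamond> v2 = 0" "v4 \<diamond> v3 = 0"
    using o minkowski_commute by metis+
  define e :: "real^4" where "e = axis 1 1"
  obtain r1 r2 r3 r4 where e: "e = r1 *\<^sub>R v1 + r2 *\<^sub>R v2 + r3 *\<^sub>R v3 + r4 *\<^sub>R v4"
    using minkowski_orthogonal_basis[OF o, of e] pos pos4 by auto
  have "e \<diamond> e = r1\<^sup>2 * (v1 \<diamond> v1) + r2\<^sup>2 * (v2 \<diamond> v2) + r3\<^sup>2 * (v3 \<diamond> v3) + r4\<^sup>2 * (v4 \<diamond> v4)"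
    unfolding e by (simp add: minkowski_simps o o' power2_eq_square algebra_simps)
  moreover have "\<dots> \<ge> 0" using pos pos4 by (intro add_nonneg_nonneg mult_nonneg_nonneg) auto
  moreover have "e \<diamond> e = - 1" by (simp add: e_def minkowski_def axis_def)
  ultimately show False by simp
qed

lemma lorentz_axial_chart:
  assumes \<phi>: "local_param M x U \<phi>" and B: "open B" "u0 \<in> B" "B \<subseteq> U"
    and v: "v1 \<diamond> v1 = - 1" "v2 \<diamond> v2 = 1" "v3 \<diamond> v3 = 1" "v4 \<diamond> v4 = 1"
    "v1 \<diamond> v2 = 0" "v1 \<diamond> v3 = 0" "v1 \<diamond> v4 = 0" "v2 \<diamond> v3 = 0" "v2 \<diamond> v4 = 0" "v3 \<diamond> v4 = 0"
  obtains F l where "axial_chart M x U B \<phi> F l u0"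
    "\<And>u. l u $ 1 = - ((x (\<phi> u) - c0) \<diamond> v1)" "\<And>u. l u $ 2 = (x (\<phi> u) - c0) \<diamond> v2"
    "\<And>u. l u $ 3 = (x (\<phi> u) - c0) \<diamond> v3" "\<And>u. l u $ 4 = (x (\<phi> u) - c0) \<diamond> v4"
    "\<And>u. l u \<diamond> l u = (x (\<phi> u) - c0) \<diamond> (x (\<phi> u) - c0)"
proof -
  define F :: "real^4 \<Rightarrow> real^4" where
    "F z = vector [- ((z - c0) \<diamond> v1), (z - c0) \<diamond> v2, (z - c0) \<diamond> v3, (z - c0) \<diamond> v4]" for z
  note iso = lorentz_frame_isometry[OF v, where ?c0.0 = c0, folded F_def[abs_def]]
  have "smooth_on (\<lambda>u. F ((x \<circ> \<phi>) u)) B"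
    by (rule smooth_on_compose[OF B(1) iso(2) smooth_on_subset[OF local_paramD(4)[OF \<phi>] B(3)]]) simp
  then have ax: "axial_chart M x U B \<phi> F (\<lambda>u. F (x (\<phi> u))) u0"
    using \<phi> B iso(1) by unfold_locales auto
  have FF: "F a \<diamond> F b = (a - c0) \<diamond> (b - c0)" for a b
    using iso(3) by (simp add: F_def)
  show ?thesis
    by (rule that[OF ax]) (simp add: F_def, simp add: F_def, simp add: F_def, simp add: F_def, rule FF)
qed

section \<open>Choice of the model\<close>

text \<open>Let \<open>z\<close> be the position vector relative to \<open>c0\<close>. It is orthogonal to the leaves, like the axis
  \<open>A\<close>, and the Lorentz frame is built from \<open>A\<close>, the component of \<open>z\<close> orthogonal to \<open>A\<close>, and the two
  principal directions tangent to the leaf; if \<open>A\<close> is null, the first two are replaced by the normal and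
  the simple direction. There are four cases: \<open>A\<close> is null; \<open>A\<close> is timelike, and
  the leaf lies in a Euclidean hyperplane; \<open>A\<close> is spacelike and the orthogonal component of \<open>z\<close> is
  timelike or spacelike, and the leaf is a piece of a hyperbolic plane or of a de Sitter surface.\<close>

lemma (in rotational_chart) congruent_to_model:
  assumes \<phi>: "local_param M x U \<phi>" and yx: "y = x \<circ> \<phi>" and u0: "u0 \<in> U"
  shows "\<exists>f I. open I \<and> is_interval I \<and> smooth_on f I \<and>
    (\<exists>Y\<in>{model1 f, model2 f, model3 f, model4 f}. congruent_near M x (\<phi> u0) I Y)"
proof -
  obtain r c0 A where r: "r > 0" "ball u0 r \<subseteq> U" and A: "A \<noteq> 0"
    and ex: "\<And>u. u \<in> ball u0 r \<Longrightarrow> \<exists>\<zeta>. y u - c0 = \<zeta> *\<^sub>R A - inverse (b * h u) *\<^sub>R n u"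
    and An: "\<And>u. u \<in> ball u0 r \<Longrightarrow> A \<diamond> n u \<noteq> 0"
    and Ay: "\<And>u v. u \<in> ball u0 r \<Longrightarrow> A \<diamond> Der y u v = 0 \<longleftrightarrow> Der h u v = 0"
    by (rule rotation_axis[OF u0]) (rule that, assumption+)
  define B where "B = ball u0 r"
  have B: "open B" "u0 \<in> B" "B \<subseteq> U" using r by (auto simp: B_def)
  define z where "z u = y u - c0" for u
  define k where "k u = inverse (b * h u)" for u
  have kn: "k u \<noteq> 0" if "u \<in> B" for u
    using h_nonzero[of u] ab that B by (auto simp: k_def)
  obtain \<zeta> where \<zeta>: "\<And>u. u \<in> B \<Longrightarrow> z u = \<zeta> u *\<^sub>R A - k u *\<^sub>R n u"
    using ex unfolding z_def k_def B_def by metis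
  have xz: "x (\<phi> u) - c0 = z u" for u by (simp add: z_def yx)
  have dz: "z differentiable (at u)" "Der z u v = Der y u v" if "u \<in> B" for u v
  proof -
    have "(z has_derivative Der y u) (at u)"
      unfolding z_def[abs_def] using Der_works[OF dy, of u] that B by (auto intro!: derivative_eq_intros)
    then show "z differentiable (at u)" "Der z u v = Der y u v"
      by (rule differentiableI, rule fun_cong[OF Der_eqI])
  qed
  have Dzw: "Der (\<lambda>u. z u \<diamond> w) u v = Der y u v \<diamond> w" "(\<lambda>u. z u \<diamond> w) differentiable (at u)" if "u \<in> B" for u v w
    using Der_minkowski[OF dz(1)[OF that] differentiable_const, of w v] dz(2)[OF that]
      minkowski.FDERIV[OF Der_works[OF dz(1)[OF that]] has_derivative_const[of w]]
    by (auto simp: minkowski_simps intro: differentiableI)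
  have Dzz: "Der (\<lambda>u. z u \<diamond> z u) u v = 2 * \<zeta> u * (A \<diamond> Der y u v)"
    "(\<lambda>u. z u \<diamond> z u) differentiable (at u)" if u: "u \<in> B" for u v
  proof -
    have "Der (\<lambda>u. z u \<diamond> z u) u v = 2 * (z u \<diamond> Der y u v)"
      using Der_minkowski[OF dz(1)[OF u] dz(1)[OF u], of v] dz(2)[OF u, of v]
        minkowski_commute[of "Der y u v" "z u"] by simp
    also have "z u \<diamond> Der y u v = \<zeta> u * (A \<diamond> Der y u v)"
      using ny[of u v] u B by (auto simp: \<zeta>[OF u] minkowski_simps)
    finally show "Der (\<lambda>u. z u \<diamond> z u) u v = 2 * \<zeta> u * (A \<diamond> Der y u v)" by simp
    show "(\<lambda>u. z u \<diamond> z u) differentiable (at u)"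
      using minkowski.FDERIV[OF Der_works[OF dz(1)[OF u]] Der_works[OF dz(1)[OF u]]] by (rule differentiableI)
  qed
  obtain w1 w2 w3 where W: "adapted u0 w1 w2 w3" using adapted_frame[OF u0] by blast
  define e1 e2 e3 N where "e1 = Der y u0 w1" and "e2 = Der y u0 w2" and "e3 = Der y u0 w3" and "N = n u0"
  have e: "\<bar>e1 \<diamond> e1\<bar> = 1" "\<bar>e2 \<diamond> e2\<bar> = 1" "\<bar>e3 \<diamond> e3\<bar> = 1" "e1 \<diamond> e2 = 0" "e1 \<diamond> e3 = 0" "e2 \<diamond> e3 = 0"
    using W by (auto simp: adapted_def principal_frame_def e1_def e2_def e3_def)
  have NN: "N \<diamond> N = \<epsilon>" and Ne: "N \<diamond> e1 = 0" "N \<diamond> e2 = 0" "N \<diamond> e3 = 0"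
    using nn[OF u0] ny[OF u0] by (simp_all add: N_def e1_def e2_def e3_def)
  have sym: "e2 \<diamond> e1 = 0" "e3 \<diamond> e1 = 0" "e3 \<diamond> e2 = 0" "e1 \<diamond> N = 0" "e2 \<diamond> N = 0" "e3 \<diamond> N = 0"
    using e Ne minkowski_commute by metis+
  have Ae: "A \<diamond> e1 \<noteq> 0" "A \<diamond> e2 = 0" "A \<diamond> e3 = 0" "A \<diamond> N \<noteq> 0"
    using Ay[of u0] An[of u0] B W by (auto simp: adapted_def e1_def e2_def e3_def N_def B_def)
  have z0: "z u0 = \<zeta> u0 *\<^sub>R A - k u0 *\<^sub>R N" using \<zeta>[OF B(2)] by (simp add: N_def)
  have z0e: "z u0 \<diamond> e2 = 0" "z u0 \<diamond> e3 = 0" by (simp_all add: z0 minkowski_simps Ae Ne)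
  obtain a1 a4 where Aex: "A = a1 *\<^sub>R e1 + a4 *\<^sub>R N"
  proof -
    obtain r1 r2 r3 r4 where A: "A = r1 *\<^sub>R e1 + r2 *\<^sub>R e2 + r3 *\<^sub>R e3 + r4 *\<^sub>R N"
      using minkowski_orthogonal_basis[of e1 e2 e3 N A] e sym NN eps by force
    have "r2 = 0" "r3 = 0" using Ae(2,3) e by (auto simp: A minkowski_simps sym Ne)
    then show ?thesis using that A by simp
  qed
  have a: "a1 \<noteq> 0" "a4 \<noteq> 0" "A \<diamond> N = a4 * \<epsilon>" "A \<diamond> A = a1\<^sup>2 * (e1 \<diamond> e1) + a4\<^sup>2 * \<epsilon>"
    using Ae(1,4) by (auto simp: Aex minkowski_simps sym Ne NN power2_eq_square)
  show ?thesis
  proof (cases "A \<diamond> A = 0")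
    case True
    \<comment> \<open>A null axis lies in the plane of the normal and the simple direction, of which one is timelike.\<close>
    obtain T S where TS: "T \<diamond> T = - 1" "S \<diamond> S = 1" "T \<diamond> S = 0" and To: "T \<diamond> e2 = 0" "T \<diamond> e3 = 0" "S \<diamond> e2 = 0" "S \<diamond> e3 = 0"
      and ATS: "\<exists>t s. A = t *\<^sub>R T + s *\<^sub>R S \<and> t \<noteq> 0 \<and> s \<noteq> 0"
    proof (cases "\<epsilon> = - 1")
      case eps1: True
      have "e1 \<diamond> e1 \<noteq> - 1"
      proof
        assume e1: "e1 \<diamond> e1 = - 1"
        have "a1\<^sup>2 + a4\<^sup>2 = 0" using a(4) unfolding True eps1 e1 by linarith
        then show False using a(1) by (simp add: sum_power2_eq_zero_iff)
      qed
      then have "e1 \<diamond> e1 = 1" using e(1) by (simp add: abs_if split: if_splits)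
      then show ?thesis
        using that[of N e1] NN eps1 Ne sym e Aex a by (metis add.commute)
    next
      case False
      then have eps1: "\<epsilon> = 1" using eps by blast
      then have "e1 \<diamond> e1 = - 1" using True a e(1) zero_less_power2[of a1] zero_less_power2[of a4]
        by (auto simp: abs_if add_pos_pos split: if_splits)
      then show ?thesis
        using that[of e1 N] NN eps1 Ne sym e Aex a by metis
    qed
    then obtain t s where A': "A = t *\<^sub>R T + s *\<^sub>R S" "t \<noteq> 0" "s \<noteq> 0" by blast
    have "S \<diamond> T = 0" using TS minkowski_commute by metis
    then have "t\<^sup>2 = s\<^sup>2" using True TS by (simp add: A' minkowski_simps power2_eq_square)
    \<comment> \<open>The sign of \<open>S\<close> is chosen such that \<open>A\<close> is a multiple of \<open>T + S'\<close>.\<close>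
    define S' where "S' = (s / t) *\<^sub>R S"
    have S': "S' \<diamond> S' = 1" "T \<diamond> S' = 0" "S' \<diamond> e2 = 0" "S' \<diamond> e3 = 0"
      using TS To \<open>t\<^sup>2 = s\<^sup>2\<close> A'(2,3) by (simp_all add: S'_def minkowski_simps field_simps power2_eq_square)
    have AT: "T + S' = (1 / t) *\<^sub>R A" using A' by (simp add: S'_def scaleR_add_right)
    have pos: "e2 \<diamond> e2 = 1" "e3 \<diamond> e3 = 1"
      using unit_orthogonal_to_timelike[OF TS(1)] To e by simp_all
    have oS: "e2 \<diamond> S' = 0" "e3 \<diamond> S' = 0" using S' minkowski_commute by metis+
    obtain F l where ax: "axial_chart M x U B \<phi> F l u0"
      and l: "\<And>u. l u $ 1 = - (z u \<diamond> T)" "\<And>u. l u $ 4 = z u \<diamond> S'" "\<And>u. l u \<diamond> l u = z u \<diamond> z u"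
      by (rule lorentz_axial_chart[OF \<phi> B TS(1) pos S'(1) To(1,2) S'(2) e(6) oS, of c0, unfolded xz])
        (rule that, assumption+)
    have l14: "l u $ 1 - l u $ 4 = - (z u \<diamond> ((1 / t) *\<^sub>R A))" for u
      unfolding AT[symmetric] by (simp add: l minkowski_simps)
    have D: "Der (\<lambda>u. l u $ 1 - l u $ 4) u v = - ((1 / t) * (A \<diamond> Der y u v))" if "u \<in> B" for u v
      unfolding l14 Der_bounded_linear_comp[OF bounded_linear_minus[OF bounded_linear_ident] Dzw(2)[OF that]] Dzw(1)[OF that]
      using minkowski_commute[of A "Der y u v"] by (simp add: minkowski_simps)
    have "\<exists>f I. open I \<and> is_interval I \<and> smooth_on f I \<and> congruent_near M x (\<phi> u0) I (model4 f)"
    proof (rule axial_chart.near_model4[OF ax, where v = w1])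
      have "z u0 \<diamond> A = - k u0 * (A \<diamond> N)"
        using True minkowski_commute[of A N] by (simp add: z0 minkowski_simps)
      then have "l u0 $ 1 - l u0 $ 4 \<noteq> 0"
        using kn[OF B(2)] Ae(4) A'(2) by (simp add: l14 minkowski_simps)
      then show "l u0 $ 1 \<noteq> l u0 $ 4" by simp
      show "Der (\<lambda>u. l u $ 1 - l u $ 4) u0 w1 \<noteq> 0"
        using D[OF B(2)] Ae(1) A'(2) by (simp add: e1_def)
      show "Der (\<lambda>u. l u \<diamond> l u) u w = 0" if "u \<in> B" "Der (\<lambda>u. l u $ 1 - l u $ 4) u w = 0" for u w
        unfolding l(3) Dzz(1)[OF that(1)] using that(2) A'(2) by (simp add: D[OF that(1)])
    qed
    then show ?thesis by blast
  next
    case nonnull: False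
    define d where "d = sqrt \<bar>A \<diamond> A\<bar>"
    define \<sigma> where "\<sigma> = sgn (A \<diamond> A)"
    have d: "d > 0" "A \<diamond> A = \<sigma> * (d * d)" and \<sigma>: "\<sigma> * \<sigma> = 1" "\<sigma> = 1 \<or> \<sigma> = - 1"
      using nonnull by (auto simp: d_def \<sigma>_def sgn_if)
    define A1 where "A1 = (1 / d) *\<^sub>R A"
    have A1: "A1 \<diamond> A1 = \<sigma>" using d by (simp add: A1_def minkowski_simps)
    have A1o: "A1 \<diamond> e2 = 0" "A1 \<diamond> e3 = 0" "e2 \<diamond> A1 = 0" "e3 \<diamond> A1 = 0"
      using Ae minkowski_commute[of A] by (simp_all add: A1_def minkowski_simps)
    have A1y: "A1 \<diamond> Der y u v = 0 \<longleftrightarrow> A \<diamond> Der y u v = 0" for u v using d by (simp add: A1_def minkowski_simps)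
    \<comment> \<open>The signed square of the distance from the axis. It is regular because \<open>n\<close> is not orthogonal to the axis.\<close>
    define Q where "Q u = z u \<diamond> z u - \<sigma> * ((z u \<diamond> A1) * (z u \<diamond> A1))" for u
    have DQ: "Der Q u v = 2 * \<sigma> * k u * (n u \<diamond> A1) * (A1 \<diamond> Der y u v)" and dQ: "Q differentiable (at u)"
      if u: "u \<in> B" for u v
    proof -
      have m: "(\<lambda>u. (z u \<diamond> A1) * (z u \<diamond> A1)) differentiable (at u)"
        using Dzw(2)[OF u] Dzw(2)[OF u] by (rule differentiable_mult)
      have m': "(\<lambda>u. \<sigma> * ((z u \<diamond> A1) * (z u \<diamond> A1))) differentiable (at u)"
        using differentiable_const m by (rule differentiable_mult)
      show "Q differentiable (at u)"
        unfolding Q_def[abs_def] using Dzz(2)[OF u] m' by (rule differentiable_diff)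
      have AA1: "A = d *\<^sub>R A1" using d by (simp add: A1_def)
      have zA: "z u \<diamond> A1 = \<zeta> u * d * \<sigma> - k u * (n u \<diamond> A1)"
        unfolding \<zeta>[OF u] by (simp add: AA1 minkowski_simps A1)
      have "2 * \<zeta> u * d - 2 * \<sigma> * (z u \<diamond> A1) = 2 * \<zeta> u * d - 2 * (\<sigma> * \<sigma>) * \<zeta> u * d + 2 * \<sigma> * k u * (n u \<diamond> A1)"
        unfolding zA by (simp add: algebra_simps)
      then have c: "2 * \<zeta> u * d - 2 * \<sigma> * (z u \<diamond> A1) = 2 * \<sigma> * k u * (n u \<diamond> A1)" by (simp add: \<sigma>(1))
      have "Der Q u v = 2 * \<zeta> u * (A \<diamond> Der y u v) - \<sigma> * ((z u \<diamond> A1) * (Der y u v \<diamond> A1) + (Der y u v \<diamond> A1) * (z u \<diamond> A1))"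
        unfolding Q_def[abs_def] Der_diff[OF Dzz(2)[OF u] m'] Der_bounded_linear_comp[OF bounded_linear_mult_right m]
          Der_mult_real[OF Dzw(2)[OF u] Dzw(2)[OF u]] Dzw(1)[OF u] Dzz(1)[OF u] ..
      also have "\<dots> = (2 * \<zeta> u * d - 2 * \<sigma> * (z u \<diamond> A1)) * (A1 \<diamond> Der y u v)"
        unfolding minkowski_commute[of "Der y u v" A1] by (simp add: AA1 minkowski_simps algebra_simps)
      finally show "Der Q u v = 2 * \<sigma> * k u * (n u \<diamond> A1) * (A1 \<diamond> Der y u v)" unfolding c .
    qed
    have nA1: "n u \<diamond> A1 \<noteq> 0" if "u \<in> B" for u
      using An[of u] that d minkowski_commute[of A "n u"] by (simp add: B_def A1_def minkowski_simps)
    have DQ0: "Der Q u v = 0 \<longleftrightarrow> A1 \<diamond> Der y u v = 0" if "u \<in> B" for u v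
      using DQ[OF that] kn[OF that] nA1[OF that] \<sigma>(2) by auto
    have DQw1: "Der Q u0 w1 \<noteq> 0" using DQ0[OF B(2)] Ae(1) A1y by (simp add: e1_def)
    \<comment> \<open>The component of the position vector orthogonal to the axis. It is not null: in the nondegenerate plane of the normal and the simple direction it is orthogonal to \<open>A\<close>, which is neither null nor normal.\<close>
    define p where "p = z u0 - (\<sigma> * (z u0 \<diamond> A1)) *\<^sub>R A1"
    have pA: "p \<diamond> A1 = 0" using \<sigma>(1) by (simp add: p_def minkowski_simps A1)
    have pe: "p \<diamond> e2 = 0" "p \<diamond> e3 = 0" by (simp_all add: p_def minkowski_simps z0e A1o)
    have zp: "z u0 \<diamond> w = p \<diamond> w + \<sigma> * (z u0 \<diamond> A1) * (A1 \<diamond> w)" for w by (simp add: p_def minkowski_simps)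
    have pp: "p \<diamond> p \<noteq> 0"
    proof
      assume null: "p \<diamond> p = 0"
      have AA1: "A = d *\<^sub>R A1" using d by (simp add: A1_def)
      have zA: "z u0 \<diamond> A1 = \<zeta> u0 * d * \<sigma> - k u0 * (N \<diamond> A1)"
        unfolding z0 by (simp add: AA1 minkowski_simps A1)
      have "\<sigma> * (z u0 \<diamond> A1) = (\<sigma> * \<sigma>) * (\<zeta> u0 * d) - k u0 * (\<sigma> * (N \<diamond> A1))"
        unfolding zA by (simp add: algebra_simps)
      then have zA': "\<sigma> * (z u0 \<diamond> A1) = \<zeta> u0 * d - k u0 * (\<sigma> * (N \<diamond> A1))"
        by (simp add: \<sigma>(1))
      define c where "c = N \<diamond> A1"
      have c: "A1 \<diamond> N = c" "N \<diamond> A1 = c" using minkowski_commute by (simp_all add: c_def)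
      have "p = (- k u0) *\<^sub>R (N - (\<sigma> * c) *\<^sub>R A1)"
        unfolding p_def zA' c_def unfolding z0 AA1 by (simp add: algebra_simps)
      then have "p \<diamond> p = k u0 * k u0 * (\<epsilon> - 2 * (\<sigma> * c) * c + (\<sigma> * c) * (\<sigma> * c) * \<sigma>)"
        by (simp only: minkowski.scaleR_left minkowski.scaleR_right minkowski.diff_left minkowski.diff_right
            NN A1 c real_scaleR_def) (simp add: algebra_simps)
      also have "(\<sigma> * c) * (\<sigma> * c) * \<sigma> = (\<sigma> * \<sigma>) * (\<sigma> * c * c)" by (simp add: algebra_simps)
      finally have "p \<diamond> p = k u0 * k u0 * (\<epsilon> - \<sigma> * (N \<diamond> A1) * (N \<diamond> A1))"
        unfolding \<sigma>(1) c by (simp add: algebra_simps)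
      then have "\<epsilon> = \<sigma> * (N \<diamond> A1) * (N \<diamond> A1)" using null kn[OF B(2)] by simp
      moreover have "N \<diamond> A1 = a4 * \<epsilon> / d" using a(3) minkowski_commute[of A N] by (simp add: A1_def minkowski_simps)
      ultimately have "\<epsilon> * (d * d) = \<sigma> * (a4 * \<epsilon>) * (a4 * \<epsilon>)" using d(1) by (simp add: field_simps)
      then have "\<epsilon> * (\<sigma> * (d * d)) = (\<sigma> * \<sigma>) * (a4 * \<epsilon>) * (a4 * \<epsilon>)" by (metis mult.assoc mult.commute)
      then have "\<epsilon> * (A \<diamond> A) = a4\<^sup>2 * (\<epsilon> * \<epsilon>)" using d(2) \<sigma>(1) by (simp add: power2_eq_square)
      then have "\<epsilon> * (a1\<^sup>2 * (e1 \<diamond> e1)) = 0" unfolding a(4) by (simp add: algebra_simps)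
      then show False using a(1) e(1) eps by auto
    qed
    define s0 where "s0 = sqrt \<bar>p \<diamond> p\<bar>"
    define \<tau> where "\<tau> = sgn (p \<diamond> p)"
    have s0: "s0 > 0" "p \<diamond> p = \<tau> * (s0 * s0)" and \<tau>: "\<tau> = 1 \<or> \<tau> = - 1"
      using pp by (auto simp: s0_def \<tau>_def sgn_if)
    define m where "m = (1 / s0) *\<^sub>R p"
    have m: "m \<diamond> m = \<tau>" "m \<diamond> A1 = 0" "m \<diamond> e2 = 0" "m \<diamond> e3 = 0"
      using s0 pA pe by (simp_all add: m_def minkowski_simps)
    have m': "A1 \<diamond> m = 0" "e2 \<diamond> m = 0" "e3 \<diamond> m = 0" using m minkowski_commute by metis+
    have zm: "z u0 \<diamond> m = \<tau> * s0" using s0 zp[of m] m'(1) by (simp add: m_def minkowski_simps)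
    note charts = lorentz_axial_chart[OF \<phi> B, of _ _ _ _ c0, unfolded xz]
    consider "\<sigma> = - 1" | "\<sigma> = 1" "\<tau> = - 1" | "\<sigma> = 1" "\<tau> = 1" using \<sigma>(2) \<tau> by blast
    then show ?thesis
    proof cases
      case 1
      have pos: "m \<diamond> m = 1" "e2 \<diamond> e2 = 1" "e3 \<diamond> e3 = 1"
        using unit_orthogonal_to_timelike[of A1 m] unit_orthogonal_to_timelike[of A1 e2]
          unit_orthogonal_to_timelike[of A1 e3] A1 1 A1o m m' e \<tau> by auto
      obtain F l where ax: "axial_chart M x U B \<phi> F l u0"
        and l: "\<And>u. l u $ 1 = - (z u \<diamond> A1)" "\<And>u. l u $ 2 = z u \<diamond> m" "\<And>u. l u \<diamond> l u = z u \<diamond> z u"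
        using charts[of A1 m e2 e3] A1 1 pos m'(1) A1o(1,2) m(3,4) e(6) by metis
      have Q: "(\<lambda>u. (l u $ 2)\<^sup>2 + (l u $ 3)\<^sup>2 + (l u $ 4)\<^sup>2) = Q"
      proof
        fix u
        have "(l u $ 2)\<^sup>2 + (l u $ 3)\<^sup>2 + (l u $ 4)\<^sup>2 = l u \<diamond> l u + (l u $ 1) * (l u $ 1)"
          by (simp add: minkowski_def power2_eq_square)
        then show "(l u $ 2)\<^sup>2 + (l u $ 3)\<^sup>2 + (l u $ 4)\<^sup>2 = Q u" by (simp add: Q_def 1 l)
      qed
      have "\<exists>f I. open I \<and> is_interval I \<and> smooth_on f I \<and> congruent_near M x (\<phi> u0) I (model1 f)"
      proof (rule axial_chart.near_model1[OF ax, where v = w1, unfolded Q])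
        show "l u0 $ 2 > 0" using s0 pos m(1) by (simp add: l zm)
        show "Der Q u0 w1 \<noteq> 0" by (rule DQw1)
        show "Der (\<lambda>u. l u $ 1) u w = 0" if u: "u \<in> B" and Qw: "Der Q u w = 0" for u w
          unfolding l Der_bounded_linear_comp[OF bounded_linear_minus[OF bounded_linear_ident] Dzw(2)[OF u]] Dzw(1)[OF u]
          using DQ0[OF u, of w] Qw minkowski_commute[of A1] by simp
      qed
      then show ?thesis by blast
    next
      case 2
      have pos: "e2 \<diamond> e2 = 1" "e3 \<diamond> e3 = 1"
        using unit_orthogonal_to_timelike[of m] m 2 e by simp_all
      \<comment> \<open>The model is singular at the pole \<open>t = 0\<close>; a boost moves the given point to \<open>t = 1\<close>.\<close>
      define v1 v3 where "v1 = cosh 1 *\<^sub>R m - sinh 1 *\<^sub>R e3" and "v3 = cosh 1 *\<^sub>R e3 - sinh 1 *\<^sub>R m"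
      have ch: "cosh 1 * cosh 1 = 1 + sinh 1 * sinh (1::real)"
        using cosh_square_eq[of "1::real"] by (simp add: power2_eq_square)
      have v: "v1 \<diamond> v1 = - 1" "v3 \<diamond> v3 = 1" "v1 \<diamond> e2 = 0" "v1 \<diamond> v3 = 0" "v1 \<diamond> A1 = 0" "e2 \<diamond> v3 = 0" "v3 \<diamond> A1 = 0"
        using m m' A1o pos e sym 2 by (simp_all add: v1_def v3_def minkowski_simps algebra_simps ch)
      obtain F l where ax: "axial_chart M x U B \<phi> F l u0"
        and l: "\<And>u. l u $ 1 = - (z u \<diamond> v1)" "\<And>u. l u $ 2 = z u \<diamond> e2" "\<And>u. l u $ 3 = z u \<diamond> v3"
          "\<And>u. l u $ 4 = z u \<diamond> A1" "\<And>u. l u \<diamond> l u = z u \<diamond> z u"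
        using charts[of v1 e2 v3 A1] v pos(1) A1 2 A1o(3) by metis
      have Q: "(\<lambda>u. (l u $ 1)\<^sup>2 - (l u $ 2)\<^sup>2 - (l u $ 3)\<^sup>2) = (\<lambda>u. - Q u)"
      proof
        fix u
        have "(l u $ 1)\<^sup>2 - (l u $ 2)\<^sup>2 - (l u $ 3)\<^sup>2 = (l u $ 4) * (l u $ 4) - l u \<diamond> l u"
          by (simp add: minkowski_def power2_eq_square)
        then show "(l u $ 1)\<^sup>2 - (l u $ 2)\<^sup>2 - (l u $ 3)\<^sup>2 = - Q u" by (simp add: Q_def 2 l)
      qed
      have DmQ: "Der (\<lambda>u. - Q u) u v = - Der Q u v" if "u \<in> B" for u v
        by (rule Der_bounded_linear_comp[OF bounded_linear_minus[OF bounded_linear_ident] dQ[OF that]])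
      have z13: "z u0 \<diamond> v1 = - (s0 * cosh 1)" "z u0 \<diamond> v3 = s0 * sinh 1"
        using 2 by (simp_all add: v1_def v3_def minkowski_simps zm z0e)
      have "\<exists>f I. open I \<and> is_interval I \<and> smooth_on f I \<and> congruent_near M x (\<phi> u0) I (model3 f)"
      proof (rule axial_chart.near_model3[OF ax, where v = w1, unfolded Q])
        show "l u0 $ 1 > 0" "l u0 $ 3 > 0" using s0 by (simp_all add: l z13)
        have "(s0 * cosh 1)\<^sup>2 = (s0 * sinh 1)\<^sup>2 + s0\<^sup>2"
          by (simp add: power_mult_distrib cosh_square_eq algebra_simps)
        then show "(l u0 $ 2)\<^sup>2 + (l u0 $ 3)\<^sup>2 < (l u0 $ 1)\<^sup>2"
          using s0(1) by (simp add: l z13 z0e)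
        show "Der (\<lambda>u. - Q u) u0 w1 \<noteq> 0" using DQw1 DmQ[OF B(2)] by simp
        show "Der (\<lambda>u. l u $ 4) u w = 0" if u: "u \<in> B" and Qw: "Der (\<lambda>u. - Q u) u w = 0" for u w
          unfolding l Dzw(1)[OF u]
          using DQ0[OF u, of w] Qw DmQ[OF u, of w] minkowski_commute[of A1] by simp
      qed
      then show ?thesis by blast
    next
      case 3
      obtain T S where TS: "T \<diamond> T = - 1" "S \<diamond> S = 1" "T \<diamond> S = 0" "T \<diamond> m = 0" "m \<diamond> S = 0" "T \<diamond> A1 = 0" "S \<diamond> A1 = 0"
        and zT: "z u0 \<diamond> T = 0"
      proof (cases "e2 \<diamond> e2 < 0")
        case True
        then have "e2 \<diamond> e2 = - 1" using e by auto
        then have "e3 \<diamond> e3 = 1" "e2 \<diamond> e2 = - 1" using unit_orthogonal_to_timelike[of e2 e3] e by auto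
        then show ?thesis using that[of e2 e3] e m m' A1o z0e by blast
      next
        case False
        then have e2: "e2 \<diamond> e2 = 1" using e by auto
        have "e3 \<diamond> e3 < 0"
          using timelike_in_orthonormal_frame[of A1 m e2 e3] A1 m m' A1o e e2 3 by auto
        then have "e3 \<diamond> e3 = - 1" using e by auto
        then show ?thesis using that[of e3 e2] e2 sym m m' A1o z0e by blast
      qed
      obtain F l where ax: "axial_chart M x U B \<phi> F l u0"
        and l: "\<And>u. l u $ 1 = - (z u \<diamond> T)" "\<And>u. l u $ 2 = z u \<diamond> m"
          "\<And>u. l u $ 4 = z u \<diamond> A1" "\<And>u. l u \<diamond> l u = z u \<diamond> z u"
        using charts[of T m S A1] TS m 3 A1 by metis
      have Q: "(\<lambda>u. (l u $ 2)\<^sup>2 - (l u $ 1)\<^sup>2 + (l u $ 3)\<^sup>2) = Q"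
      proof
        fix u
        have "(l u $ 2)\<^sup>2 - (l u $ 1)\<^sup>2 + (l u $ 3)\<^sup>2 = l u \<diamond> l u - (l u $ 4) * (l u $ 4)"
          by (simp add: minkowski_def power2_eq_square)
        then show "(l u $ 2)\<^sup>2 - (l u $ 1)\<^sup>2 + (l u $ 3)\<^sup>2 = Q u" by (simp add: Q_def 3 l)
      qed
      have "\<exists>f I. open I \<and> is_interval I \<and> smooth_on f I \<and> congruent_near M x (\<phi> u0) I (model2 f)"
      proof (rule axial_chart.near_model2[OF ax, where v = w1, unfolded Q])
        show "l u0 $ 2 > 0" "(l u0 $ 1)\<^sup>2 < (l u0 $ 2)\<^sup>2" using s0 3 by (simp_all add: l zm zT)
        show "Der Q u0 w1 \<noteq> 0" by (rule DQw1)
        show "Der (\<lambda>u. l u $ 4) u w = 0" if u: "u \<in> B" and Qw: "Der Q u w = 0" for u w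
          unfolding l Dzw(1)[OF u] using DQ0[OF u, of w] Qw minkowski_commute[of A1] by simp
      qed
      then show ?thesis by blast
    qed
  qed
qed

section \<open>Curvature data in a chart\<close>

lemma local_param_subset:
  assumes \<phi>: "local_param M x U \<phi>" and V: "open V" "V \<subseteq> U"
  shows "local_param M x V \<phi>"
proof -
  have "local_param M x V (\<phi> \<circ> id)"
    using local_paramD[OF \<phi>] V
    by (intro local_param_reparametrize[OF \<phi> V V(1), where \<theta> = id])
      (auto simp: homeomorphism_def intro: smooth_on_subset)
  then show ?thesis by simp
qed

text \<open>The symmetric version of \<open>principal_frame\<close>, with a curvature for each direction, as it is read off
  from a diagonalizing basis before it is known which two of the curvatures agree.\<close>

definition eigenframe ::
  "(real^3 \<Rightarrow> real^4) \<Rightarrow> (real^3 \<Rightarrow> real^4) \<Rightarrow> real^3 \<Rightarrow> real \<Rightarrow> real \<Rightarrow> real \<Rightarrow> real^3 \<Rightarrow> real^3 \<Rightarrow> real^3 \<Rightarrow> bool"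
  where
  "eigenframe y n u k1 k2 k3 w1 w2 w3 \<longleftrightarrow>
     (\<forall>w. \<exists>a b c. w = a *\<^sub>R w1 + b *\<^sub>R w2 + c *\<^sub>R w3) \<and>
     \<bar>Der y u w1 \<diamond> Der y u w1\<bar> = 1 \<and> \<bar>Der y u w2 \<diamond> Der y u w2\<bar> = 1 \<and> \<bar>Der y u w3 \<diamond> Der y u w3\<bar> = 1 \<and>
     Der y u w1 \<diamond> Der y u w2 = 0 \<and> Der y u w1 \<diamond> Der y u w3 = 0 \<and> Der y u w2 \<diamond> Der y u w3 = 0 \<and>
     Der n u w1 = - (k1 *\<^sub>R Der y u w1) \<and> Der n u w2 = - (k2 *\<^sub>R Der y u w2) \<and>
     Der n u w3 = - (k3 *\<^sub>R Der y u w3)"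

lemma principal_frame_eq: "principal_frame y n u \<mu> \<kappa> = eigenframe y n u \<mu> \<kappa> \<kappa>"
  by (simp add: fun_eq_iff principal_frame_def eigenframe_def)

lemma eigenframe_swap:
  assumes "eigenframe y n u k1 k2 k3 w1 w2 w3"
  shows "eigenframe y n u k2 k1 k3 w2 w1 w3" "eigenframe y n u k3 k2 k1 w3 w2 w1"
proof -
  have sp: "\<exists>a b c. w = a *\<^sub>R w2 + b *\<^sub>R w1 + c *\<^sub>R w3" "\<exists>a b c. w = a *\<^sub>R w3 + b *\<^sub>R w2 + c *\<^sub>R w1" for w
    using assms unfolding eigenframe_def by (metis add.commute add.left_commute)+
  show "eigenframe y n u k2 k1 k3 w2 w1 w3" "eigenframe y n u k3 k2 k1 w3 w2 w1"
    using assms sp minkowski_commute[of "Der y u w2" "Der y u w1"] minkowski_commute[of "Der y u w3" "Der y u w1"]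
      minkowski_commute[of "Der y u w3" "Der y u w2"]
    unfolding eigenframe_def by auto
qed

locale parametrized_hypersurface =
  fixes M :: "'m topology" and x N :: "'m \<Rightarrow> real^4" and \<epsilon> :: real
    and U :: "(real^3) set" and \<phi> :: "real^3 \<Rightarrow> 'm"
  assumes hyp: "nondegenerate_hypersurface M x"
    and normal: "unit_normal M x N \<epsilon>"
    and diag: "diagonalizable_shape M x N"
    and two: "\<forall>p\<in>topspace M. card (principal_curvatures M x N p) = 2"
    and \<phi>: "local_param M x U \<phi>"
begin

abbreviation "y \<equiv> x \<circ> \<phi>"
abbreviation "n \<equiv> N \<circ> \<phi>"
abbreviation "h \<equiv> mean_curvature M x N \<circ> \<phi>"

lemma in_M: "u \<in> U \<Longrightarrow> \<phi> u \<in> topspace M"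
  using openin_subset[OF local_paramD(2)[OF \<phi>]] by blast

lemma tangent: "u \<in> U \<Longrightarrow> tangent_space M x (\<phi> u) = range (Der y u)"
  by (rule tangent_space_chart[OF \<phi>])

lemma smooth_y: "smooth_on y U" and smooth_n: "smooth_on n U"
  using local_paramD[OF \<phi>] normal \<phi> by (auto simp: unit_normal_def smooth_map_def)

lemma lin_y: "u \<in> U \<Longrightarrow> linear (Der y u)" and lin_n: "u \<in> U \<Longrightarrow> linear (Der n u)"
  using Der_linear smooth_on_differentiable smooth_y smooth_n by blast+

lemma inj_y: "u \<in> U \<Longrightarrow> inj (Der y u)"
  by (rule local_paramD(5)[OF \<phi>])

lemma shape: "u \<in> U \<Longrightarrow> shape_op M x N (\<phi> u) (Der y u w) = - Der n u w"
  unfolding shape_op_def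
  using tangent_deriv_chart[OF \<phi> _ smooth_on_differentiable[OF smooth_n]] by simp

lemma trace_representation:
  assumes u: "u \<in> U" and C: "independent C" "span C = range (Der y u)"
    and A: "\<And>w. \<exists>z. - Der n u w = Der y u z"
  shows "3 * h u = (\<Sum>c\<in>C. representation C (shape_op M x N (\<phi> u) c) c)"
proof -
  have "trace_on (range (Der y u)) (shape_op M x N (\<phi> u)) = (\<Sum>c\<in>C. representation C (shape_op M x N (\<phi> u) c) c)"
  proof (rule trace_on_eq[OF C])
    show "shape_op M x N (\<phi> u) a \<in> range (Der y u)" if a: "a \<in> range (Der y u)" for a
    proof -
      obtain v where v: "a = Der y u v" using a by blast
      obtain z where z: "- Der n u v = Der y u z" using A by blast
      show ?thesis unfolding v shape[OF u] z by (rule rangeI)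
    qed
    show "shape_op M x N (\<phi> u) (a + b) = shape_op M x N (\<phi> u) a + shape_op M x N (\<phi> u) b"
      if "a \<in> range (Der y u)" "b \<in> range (Der y u)" for a b
    proof -
      obtain v w where "a = Der y u v" "b = Der y u w" using \<open>a \<in> _\<close> \<open>b \<in> _\<close> by blast
      then show ?thesis
        using shape[OF u, of v] shape[OF u, of w] shape[OF u, of "v + w"]
        by (simp add: linear_add[OF lin_y[OF u]] linear_add[OF lin_n[OF u]])
    qed
    show "shape_op M x N (\<phi> u) (r *\<^sub>R a) = r *\<^sub>R shape_op M x N (\<phi> u) a" if a: "a \<in> range (Der y u)" for r a
    proof -
      obtain v where "a = Der y u v" using a by blast
      then show ?thesis
        using shape[OF u, of v] shape[OF u, of "r *\<^sub>R v"]
        by (simp add: linear_scale[OF lin_y[OF u]] linear_scale[OF lin_n[OF u]])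
    qed
  qed
  then show ?thesis by (simp add: mean_curvature_def tangent[OF u])
qed

text \<open>The trace is the sum of the curvatures of a diagonalizing basis, and every principal curvature is
  one of these three numbers.\<close>

lemma exists_eigenframe:
  assumes u: "u \<in> U"
  shows "\<exists>k1 k2 k3 w1 w2 w3. eigenframe y n u k1 k2 k3 w1 w2 w3 \<and> card {k1, k2, k3} = 2 \<and> 3 * h u = k1 + k2 + k3"
proof -
  note l = lin_y[OF u] lin_n[OF u]
  obtain B where B: "independent B" "span B = range (Der y u)"
    and B1: "\<And>b. b \<in> B \<Longrightarrow> \<bar>b \<diamond> b\<bar> = 1 \<and> (\<exists>k. shape_op M x N (\<phi> u) b = k *\<^sub>R b)"
    and B2: "\<And>b c. b \<in> B \<Longrightarrow> c \<in> B \<Longrightarrow> b \<noteq> c \<Longrightarrow> b \<diamond> c = 0"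
    using diag in_M[OF u] tangent[OF u] unfolding diagonalizable_shape_def by metis
  have "card B = dim (range (Der y u))"
    using dim_span_eq_card_independent[OF B(1)] B(2) by simp
  also have "\<dots> = dim (UNIV :: (real^3) set)"
    using inj_y[OF u] by (intro dim_image_eq[OF l(1)]) (auto intro: inj_on_subset)
  finally have "card B = 3" by simp
  then obtain b1 b2 b3 where Bb: "B = {b1, b2, b3}" and ne: "b1 \<noteq> b2" "b2 \<noteq> b3" "b1 \<noteq> b3"
    unfolding card_3_iff by blast
  obtain k1 k2 k3 where k: "shape_op M x N (\<phi> u) b1 = k1 *\<^sub>R b1" "shape_op M x N (\<phi> u) b2 = k2 *\<^sub>R b2"
    "shape_op M x N (\<phi> u) b3 = k3 *\<^sub>R b3"
  proof -
    have "b1 \<in> B" "b2 \<in> B" "b3 \<in> B" using Bb by simp_all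
    then show ?thesis using B1 that by metis
  qed
  have bT: "b1 \<in> range (Der y u)" "b2 \<in> range (Der y u)" "b3 \<in> range (Der y u)"
    using span_superset[of B] Bb B(2) by auto
  then obtain w1 w2 w3 where w: "b1 = Der y u w1" "b2 = Der y u w2" "b3 = Der y u w3" by blast
  have nk: "Der n u w1 = - (k1 *\<^sub>R b1)" "Der n u w2 = - (k2 *\<^sub>R b2)" "Der n u w3 = - (k3 *\<^sub>R b3)"
    using k shape[OF u, of w1] shape[OF u, of w2] shape[OF u, of w3] by (simp_all flip: w)
  have o: "b1 \<diamond> b2 = 0" "b1 \<diamond> b3 = 0" "b2 \<diamond> b3 = 0" "b2 \<diamond> b1 = 0" "b3 \<diamond> b1 = 0" "b3 \<diamond> b2 = 0"
    using B2 Bb ne by auto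
  have one: "\<bar>b1 \<diamond> b1\<bar> = 1" "\<bar>b2 \<diamond> b2\<bar> = 1" "\<bar>b3 \<diamond> b3\<bar> = 1" using B1 Bb by auto
  then have b0: "b1 \<noteq> 0" "b2 \<noteq> 0" "b3 \<noteq> 0" by (auto simp: minkowski_simps)
  have sp: "\<exists>a b c. w = a *\<^sub>R w1 + b *\<^sub>R w2 + c *\<^sub>R w3" for w
  proof -
    have "Der y u w \<in> span {b1, b2, b3}" using B(2) Bb by blast
    then obtain a b c where "Der y u w = a *\<^sub>R b1 + b *\<^sub>R b2 + c *\<^sub>R b3"
      by (auto simp: span_insert algebra_simps)
    then have "Der y u w = Der y u (a *\<^sub>R w1 + b *\<^sub>R w2 + c *\<^sub>R w3)"
      by (simp add: w linear_add[OF l(1)] linear_scale[OF l(1)])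
    then show ?thesis using injD[OF inj_y[OF u]] by blast
  qed
  have EF: "eigenframe y n u k1 k2 k3 w1 w2 w3"
    unfolding eigenframe_def using sp o one nk by (simp flip: w)
  have "principal_curvatures M x N (\<phi> u) = {k1, k2, k3}"
  proof
    show "{k1, k2, k3} \<subseteq> principal_curvatures M x N (\<phi> u)"
      unfolding principal_curvatures_def tangent[OF u] using k b0 bT by blast
    show "principal_curvatures M x N (\<phi> u) \<subseteq> {k1, k2, k3}"
    proof
      fix \<kappa> assume "\<kappa> \<in> principal_curvatures M x N (\<phi> u)"
      then obtain v where v: "v \<in> range (Der y u)" "v \<noteq> 0" "shape_op M x N (\<phi> u) v = \<kappa> *\<^sub>R v"
        unfolding principal_curvatures_def tangent[OF u] by blast
      obtain w where vw: "v = Der y u w" using v(1) by blast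
      obtain a b c where abc: "w = a *\<^sub>R w1 + b *\<^sub>R w2 + c *\<^sub>R w3" using sp by blast
      have v': "v = a *\<^sub>R b1 + b *\<^sub>R b2 + c *\<^sub>R b3"
        unfolding vw abc w by (simp add: linear_add[OF l(1)] linear_scale[OF l(1)])
      have "shape_op M x N (\<phi> u) v = (a * k1) *\<^sub>R b1 + (b * k2) *\<^sub>R b2 + (c * k3) *\<^sub>R b3"
        unfolding vw shape[OF u] unfolding abc
        by (simp add: linear_add[OF l(2)] linear_scale[OF l(2)] nk)
      then have eq: "(a * k1) *\<^sub>R b1 + (b * k2) *\<^sub>R b2 + (c * k3) *\<^sub>R b3 = \<kappa> *\<^sub>R (a *\<^sub>R b1 + b *\<^sub>R b2 + c *\<^sub>R b3)"
        using v(3) v' by simp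
      have bb: "b1 \<diamond> b1 \<noteq> 0" "b2 \<diamond> b2 \<noteq> 0" "b3 \<diamond> b3 \<noteq> 0" using one by auto
      have "a * k1 = \<kappa> * a" "b * k2 = \<kappa> * b" "c * k3 = \<kappa> * c"
        using arg_cong[OF eq, of "\<lambda>v. v \<diamond> b1"] arg_cong[OF eq, of "\<lambda>v. v \<diamond> b2"] arg_cong[OF eq, of "\<lambda>v. v \<diamond> b3"] bb
        by (simp_all add: minkowski_simps o)
      moreover have "a \<noteq> 0 \<or> b \<noteq> 0 \<or> c \<noteq> 0" using v(2) v' by auto
      ultimately show "\<kappa> \<in> {k1, k2, k3}" by (auto simp: mult.commute)
    qed
  qed
  then have card: "card {k1, k2, k3} = 2" using two in_M[OF u] by metis
  have A: "\<exists>z. - Der n u w = Der y u z" for w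
  proof -
    obtain a b c where abc: "w = a *\<^sub>R w1 + b *\<^sub>R w2 + c *\<^sub>R w3" using sp by blast
    have "- Der n u w = Der y u ((a * k1) *\<^sub>R w1 + (b * k2) *\<^sub>R w2 + (c * k3) *\<^sub>R w3)"
      unfolding abc by (simp add: linear_add[OF l(1)] linear_scale[OF l(1)] linear_add[OF l(2)] linear_scale[OF l(2)] nk w)
    then show ?thesis by blast
  qed
  have rep: "representation B (k *\<^sub>R b) b = k" if "b \<in> B" for k b
    using real_vector.representation_scale[OF B(1) span_base[OF that]] real_vector.representation_basis[OF B(1) that]
    by simp
  have "3 * h u = (\<Sum>c\<in>B. representation B (shape_op M x N (\<phi> u) c) c)"
    by (rule trace_representation[OF u B A])
  also have "\<dots> = k1 + k2 + k3"
    unfolding Bb using ne rep[unfolded Bb] by (simp add: k)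
  finally show ?thesis using EF card by blast
qed

lemma exists_principal_frame:
  assumes u: "u \<in> U"
  shows "\<exists>\<mu> \<kappa> w1 w2 w3. principal_frame y n u \<mu> \<kappa> w1 w2 w3 \<and> \<mu> \<noteq> \<kappa> \<and> 3 * h u = \<mu> + 2 * \<kappa>"
proof -
  obtain k1 k2 k3 w1 w2 w3 where E: "eigenframe y n u k1 k2 k3 w1 w2 w3" "card {k1, k2, k3} = 2" "3 * h u = k1 + k2 + k3"
    using exists_eigenframe[OF u] by blast
  have "k2 = k3 \<and> k1 \<noteq> k2 \<or> k1 = k3 \<and> k2 \<noteq> k1 \<or> k1 = k2 \<and> k3 \<noteq> k2"
    using E(2) by (auto simp: card_insert_if split: if_splits)
  then show ?thesis
  proof (elim disjE conjE)
    assume "k2 = k3" "k1 \<noteq> k2"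
    then show ?thesis using E unfolding principal_frame_eq
      by (intro exI[of _ k1] exI[of _ k2] exI[of _ w1] exI[of _ w2] exI[of _ w3]) simp
  next
    assume "k1 = k3" "k2 \<noteq> k1"
    then show ?thesis using E(3) eigenframe_swap(1)[OF E(1)] unfolding principal_frame_eq
      by (intro exI[of _ k2] exI[of _ k1] exI[of _ w2] exI[of _ w1] exI[of _ w3]) simp
  next
    assume "k1 = k2" "k3 \<noteq> k2"
    then show ?thesis using E(3) eigenframe_swap(2)[OF E(1)] unfolding principal_frame_eq
      by (intro exI[of _ k3] exI[of _ k2] exI[of _ w3] exI[of _ w2] exI[of _ w1]) simp
  qed
qed

text \<open>In coordinates the shape operator is the solution of a linear system with smooth coefficients.\<close>

lemma smooth_h: "smooth_on h U"
proof -
  note U = local_paramD(1)[OF \<phi>]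
  define z where "z i u = (SOME z. Der y u z = - Der n u (axis i 1))" for i u
  have ex: "\<exists>z. - Der n u w = Der y u z" if u: "u \<in> U" for u w
  proof -
    note l = lin_y[OF u] lin_n[OF u]
    obtain k1 k2 k3 w1 w2 w3 where E: "eigenframe y n u k1 k2 k3 w1 w2 w3" using exists_eigenframe[OF u] by blast
    then obtain a b c where abc: "w = a *\<^sub>R w1 + b *\<^sub>R w2 + c *\<^sub>R w3" unfolding eigenframe_def by blast
    have "- Der n u w = Der y u ((a * k1) *\<^sub>R w1 + (b * k2) *\<^sub>R w2 + (c * k3) *\<^sub>R w3)"
      unfolding abc using E unfolding eigenframe_def
      by (simp add: linear_add[OF l(1)] linear_scale[OF l(1)] linear_add[OF l(2)] linear_scale[OF l(2)])
    then show ?thesis by blast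
  qed
  have z: "Der y u (z i u) = - Der n u (axis i 1)" if "u \<in> U" for i u
    unfolding z_def using someI_ex[of "\<lambda>z. Der y u z = - Der n u (axis i 1)"] ex[OF that, of "axis i 1"] by metis
  have sz: "smooth_on (\<lambda>u. z i u $ j) U" for i j
    by (rule smooth_on_solution[OF U smooth_y inj_y smooth_on_minus[OF U smooth_on_Der[OF smooth_n]] z])
  have hz: "h u = (\<Sum>i\<in>UNIV. z i u $ i) / 3" if u: "u \<in> U" for u
  proof -
    define c where "c i = Der y u (axis i 1)" for i
    note l = lin_y[OF u]
    have inj_c: "inj c"
      unfolding c_def by (auto intro!: injI dest!: injD[OF inj_y[OF u]] simp: axis_eq_axis)
    have C: "range c = Der y u ` (Basis :: (real^3) set)"
      by (auto simp: c_def Basis_vec_def)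
    have indep: "independent (range c)"
      unfolding C using inj_y[OF u]
      by (intro linear_independent_injective_image[OF l independent_Basis]) (auto intro: inj_on_subset)
    have span: "span (range c) = range (Der y u)"
      unfolding C by (simp add: linear_span_image[OF l])
    have "representation (range c) (shape_op M x N (\<phi> u) (c i)) (c i) = z i u $ i" for i
    proof -
      have "shape_op M x N (\<phi> u) (c i) = Der y u (\<Sum>j\<in>UNIV. (z i u $ j) *\<^sub>R axis j 1)"
        unfolding c_def shape[OF u] z[OF u, symmetric]
        by (simp add: basis_expansion flip: scalar_mult_eq_scaleR)
      also have "\<dots> = (\<Sum>j\<in>UNIV. (z i u $ j) *\<^sub>R c j)"
        by (simp add: linear_sum[OF l] linear_scale[OF l] c_def)
      finally have "representation (range c) (shape_op M x N (\<phi> u) (c i)) (c i)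
          = (\<Sum>j\<in>UNIV. z i u $ j * representation (range c) (c j) (c i))"
        by (simp add: real_vector.representation_sum[OF indep] real_vector.representation_scale[OF indep]
            span_base span_scale)
      also have "\<dots> = (\<Sum>j\<in>UNIV. if j = i then z i u $ j else 0)"
        using inj_c by (intro sum.cong refl) (auto simp: real_vector.representation_basis[OF indep] inj_eq)
      also have "\<dots> = z i u $ i" by simp
      finally show ?thesis .
    qed
    then have "3 * h u = (\<Sum>i\<in>UNIV. z i u $ i)"
      using trace_representation[OF u indep span ex[OF u]] inj_c by (simp add: sum.reindex)
    then show ?thesis by simp
  qed
  have "smooth_on (\<lambda>u. (\<Sum>i\<in>UNIV. z i u $ i) / 3) U"
    by (intro smooth_on_divide[OF U] smooth_on_sum[OF U] sz smooth_on_const) simp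
  then show ?thesis by (rule iffD2[OF smooth_on_cong[OF U hz], rotated])
qed

lemma hypersurface_chart: "hypersurface_chart U y n h \<epsilon>"
proof unfold_locales
  show "open U" by (rule local_paramD(1)[OF \<phi>])
  show "smooth_on y U" "smooth_on n U" "smooth_on h U" by (fact smooth_y smooth_n smooth_h)+
  show "\<epsilon> = - 1 \<or> \<epsilon> = 1" using normal by (auto simp: unit_normal_def)
  show "n u \<diamond> n u = \<epsilon>" "n u \<diamond> Der y u w = 0" if "u \<in> U" for u w
    using normal in_M[OF that] tangent[OF that] by (auto simp: unit_normal_def)
qed

text \<open>Solving the defining equations of the gradient in an orthonormal frame shows that it exists, and it
  is unique since the induced metric is nondegenerate.\<close>

lemma grad_H_chart:
  assumes u: "u \<in> U"
  shows "\<exists>w. grad_H M x N (\<phi> u) = Der y u w" "grad_H M x N (\<phi> u) \<diamond> Der y u v = Der h u v"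
proof -
  note l = lin_y[OF u]
  have dh: "h differentiable (at u)" by (rule smooth_on_differentiable[OF smooth_h u])
  note lh = Der_linear[OF dh]
  have td: "tangent_deriv M x (mean_curvature M x N) (\<phi> u) (Der y u w) = Der h u w" for w
    by (rule tangent_deriv_chart[OF \<phi> u dh])
  define P where "P G \<longleftrightarrow> G \<in> tangent_space M x (\<phi> u) \<and>
    (\<forall>v\<in>tangent_space M x (\<phi> u). G \<diamond> v = tangent_deriv M x (mean_curvature M x N) (\<phi> u) v)" for G
  obtain k1 k2 k3 w1 w2 w3 where E: "eigenframe y n u k1 k2 k3 w1 w2 w3" using exists_eigenframe[OF u] by blast
  define e1 e2 e3 where "e1 = Der y u w1" and "e2 = Der y u w2" and "e3 = Der y u w3"
  have o: "e1 \<diamond> e2 = 0" "e1 \<diamond> e3 = 0" "e2 \<diamond> e3 = 0" "e2 \<diamond> e1 = 0" "e3 \<diamond> e1 = 0" "e3 \<diamond> e2 = 0"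
    using E minkowski_commute[of e2 e1] minkowski_commute[of e3 e1] minkowski_commute[of e3 e2]
    by (auto simp: eigenframe_def e1_def e2_def e3_def)
  have one: "(e1 \<diamond> e1) * (e1 \<diamond> e1) = 1" "(e2 \<diamond> e2) * (e2 \<diamond> e2) = 1" "(e3 \<diamond> e3) * (e3 \<diamond> e3) = 1"
    using E by (auto simp: eigenframe_def e1_def e2_def e3_def abs_if split: if_splits)
  define g where "g = ((e1 \<diamond> e1) * Der h u w1) *\<^sub>R w1 + ((e2 \<diamond> e2) * Der h u w2) *\<^sub>R w2 + ((e3 \<diamond> e3) * Der h u w3) *\<^sub>R w3"
  have PG: "P (Der y u g)"
    unfolding P_def tangent[OF u]
  proof (intro conjI ballI)
    show "Der y u g \<in> range (Der y u)" by blast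
    fix v assume "v \<in> range (Der y u)"
    then obtain w where w: "v = Der y u w" by blast
    obtain a b c where abc: "w = a *\<^sub>R w1 + b *\<^sub>R w2 + c *\<^sub>R w3" using E unfolding eigenframe_def by blast
    have "Der y u g \<diamond> Der y u w = a * Der h u w1 * ((e1 \<diamond> e1) * (e1 \<diamond> e1)) + b * Der h u w2 * ((e2 \<diamond> e2) * (e2 \<diamond> e2))
        + c * Der h u w3 * ((e3 \<diamond> e3) * (e3 \<diamond> e3))"
      unfolding g_def abc linear_add[OF l] linear_scale[OF l] e1_def[symmetric] e2_def[symmetric] e3_def[symmetric]
      by (simp add: minkowski_simps o)
    also have "\<dots> = Der h u w" unfolding one abc by (simp add: linear_add[OF lh] linear_scale[OF lh])
    finally show "Der y u g \<diamond> v = tangent_deriv M x (mean_curvature M x N) (\<phi> u) v" by (simp add: w td)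
  qed
  have "grad_H M x N (\<phi> u) = Der y u g"
    unfolding grad_H_def gradient_def
  proof (rule the_equality)
    show "Der y u g \<in> tangent_space M x (\<phi> u) \<and>
      (\<forall>v\<in>tangent_space M x (\<phi> u). Der y u g \<diamond> v = tangent_deriv M x (mean_curvature M x N) (\<phi> u) v)"
      using PG by (simp add: P_def)
    fix G assume "G \<in> tangent_space M x (\<phi> u) \<and>
      (\<forall>v\<in>tangent_space M x (\<phi> u). G \<diamond> v = tangent_deriv M x (mean_curvature M x N) (\<phi> u) v)"
    then have "P G" by (simp add: P_def)
    obtain w where "G = Der y u w" using \<open>P G\<close> unfolding P_def tangent[OF u] by blast
    then have "G - Der y u g = Der y u (w - g)" by (simp add: linear_diff[OF l])
    then have "G - Der y u g \<in> tangent_space M x (\<phi> u)" unfolding tangent[OF u] by (rule range_eqI)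
    moreover have "\<forall>v\<in>tangent_space M x (\<phi> u). (G - Der y u g) \<diamond> v = 0"
      using \<open>P G\<close> PG by (simp add: P_def minkowski_simps)
    ultimately have "G - Der y u g = 0"
      using hyp in_M[OF u] unfolding nondegenerate_hypersurface_def by blast
    then show "G = Der y u g" by simp
  qed
  then show "\<exists>w. grad_H M x N (\<phi> u) = Der y u w" "grad_H M x N (\<phi> u) \<diamond> Der y u v = Der h u v"
    using PG tangent[OF u] td by (auto simp: P_def)
qed

text \<open>The component of the biconservative equation along each principal direction says that either the
  gradient has no component there or the curvature is \<open>- (3 * \<epsilon> / 2) * h\<close>.\<close>

lemma biconservative_chart:
  assumes nz: "\<forall>p\<in>topspace M. grad_H M x N p \<noteq> 0" and bic: "biconservative M x N \<epsilon>"
  shows "biconservative_chart U y n h \<epsilon>"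
proof -
  interpret hypersurface_chart U y n h \<epsilon> by (rule hypersurface_chart)
  show ?thesis
  proof unfold_locales
    fix u assume u: "u \<in> U"
    note l = lin_y[OF u] lin_n[OF u]
    obtain \<mu> \<kappa> w1 w2 w3 where F: "principal_frame y n u \<mu> \<kappa> w1 w2 w3" "\<mu> \<noteq> \<kappa>" "3 * h u = \<mu> + 2 * \<kappa>"
      using exists_principal_frame[OF u] by blast
    define e1 e2 e3 where "e1 = Der y u w1" and "e2 = Der y u w2" and "e3 = Der y u w3"
    have o: "e1 \<diamond> e2 = 0" "e1 \<diamond> e3 = 0" "e2 \<diamond> e3 = 0" "e2 \<diamond> e1 = 0" "e3 \<diamond> e1 = 0" "e3 \<diamond> e2 = 0"
      using F(1) minkowski_commute[of e2 e1] minkowski_commute[of e3 e1] minkowski_commute[of e3 e2]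
      by (auto simp: principal_frame_def e1_def e2_def e3_def)
    have e0: "e1 \<diamond> e1 \<noteq> 0" "e2 \<diamond> e2 \<noteq> 0" "e3 \<diamond> e3 \<noteq> 0"
      using F(1) by (auto simp: principal_frame_def e1_def e2_def e3_def)
    obtain g where g: "grad_H M x N (\<phi> u) = Der y u g" using grad_H_chart(1)[OF u] by blast
    obtain a b c where abc: "g = a *\<^sub>R w1 + b *\<^sub>R w2 + c *\<^sub>R w3" using F(1) unfolding principal_frame_def by blast
    have G: "Der y u g = a *\<^sub>R e1 + b *\<^sub>R e2 + c *\<^sub>R e3"
      unfolding abc by (simp add: linear_add[OF l(1)] linear_scale[OF l(1)] e1_def e2_def e3_def)
    have Dh: "Der h u w1 = a * (e1 \<diamond> e1)" "Der h u w2 = b * (e2 \<diamond> e2)" "Der h u w3 = c * (e3 \<diamond> e3)"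
      unfolding grad_H_chart(2)[OF u, symmetric] g G e1_def[symmetric] e2_def[symmetric] e3_def[symmetric]
      by (simp_all add: minkowski_simps o)
    have SG: "shape_op M x N (\<phi> u) (Der y u g) = (a * \<mu>) *\<^sub>R e1 + (b * \<kappa>) *\<^sub>R e2 + (c * \<kappa>) *\<^sub>R e3"
      unfolding shape[OF u] unfolding abc using F(1)
      by (simp add: linear_add[OF l(2)] linear_scale[OF l(2)] principal_frame_def e1_def e2_def e3_def)
    define q where "q = \<epsilon> * (3 * h u / 2)"
    have "shape_op M x N (\<phi> u) (Der y u g) + q *\<^sub>R Der y u g = 0"
      using bic in_M[OF u] by (simp add: biconservative_def q_def flip: g)
    then have eq: "((a * \<mu>) *\<^sub>R e1 + (b * \<kappa>) *\<^sub>R e2 + (c * \<kappa>) *\<^sub>R e3) + q *\<^sub>R (a *\<^sub>R e1 + b *\<^sub>R e2 + c *\<^sub>R e3) = 0"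
      unfolding SG unfolding G .
    have "(a * \<mu> + q * a) * (e1 \<diamond> e1) = 0" "(b * \<kappa> + q * b) * (e2 \<diamond> e2) = 0"
      "(c * \<kappa> + q * c) * (e3 \<diamond> e3) = 0"
      using arg_cong[OF eq, of "\<lambda>v. v \<diamond> e1"] arg_cong[OF eq, of "\<lambda>v. v \<diamond> e2"] arg_cong[OF eq, of "\<lambda>v. v \<diamond> e3"]
      by (simp_all add: minkowski_simps o distrib_right mult.assoc)
    then have c0: "a * \<mu> + q * a = 0" "b * \<kappa> + q * b = 0" "c * \<kappa> + q * c = 0"
      using e0 by simp_all
    then have c: "a = 0 \<or> \<mu> = - q" "b = 0 \<or> \<kappa> = - q" "c = 0 \<or> \<kappa> = - q"
      by (simp_all add: mult.commute[of q] eq_neg_iff_add_eq_0 flip: distrib_left)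
    have nz': "a \<noteq> 0 \<or> b \<noteq> 0 \<or> c \<noteq> 0"
      using nz in_M[OF u] g G by force
    have q: "- q = - (3 * \<epsilon> / 2) * h u" by (simp add: q_def)
    have "\<mu> = - q \<and> Der h u w1 \<noteq> 0 \<and> Der h u w2 = 0 \<and> Der h u w3 = 0 \<or>
       \<kappa> = - q \<and> Der h u w1 = 0 \<and> (Der h u w2 \<noteq> 0 \<or> Der h u w3 \<noteq> 0)"
      using c nz' F(2) e0 unfolding Dh by auto
    then show "\<exists>\<mu> \<kappa> w1 w2 w3. principal_frame y n u \<mu> \<kappa> w1 w2 w3 \<and>
      \<mu> \<noteq> \<kappa> \<and> 3 * h u = \<mu> + 2 * \<kappa> \<and>
      (\<mu> = - (3 * \<epsilon> / 2) * h u \<and> Der h u w1 \<noteq> 0 \<and> Der h u w2 = 0 \<and> Der h u w3 = 0 \<or>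
       \<kappa> = - (3 * \<epsilon> / 2) * h u \<and> Der h u w1 = 0 \<and> (Der h u w2 \<noteq> 0 \<or> Der h u w3 \<noteq> 0))"
      using F unfolding q by blast
  qed
qed

text \<open>For \<open>\<epsilon> = 1\<close> the curvatures are \<open>- 3/2 h\<close> and \<open>9/4 h\<close>, for \<open>\<epsilon> = - 1\<close> they are \<open>3/2 h\<close> and \<open>3/4 h\<close>.\<close>

lemma model_near_point:
  assumes nz: "\<forall>p\<in>topspace M. grad_H M x N p \<noteq> 0" and bic: "biconservative M x N \<epsilon>" and u0: "u0 \<in> U"
  shows "\<exists>f I. open I \<and> is_interval I \<and> smooth_on f I \<and>
    (\<exists>Y\<in>{model1 f, model2 f, model3 f, model4 f}. congruent_near M x (\<phi> u0) I Y)"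
proof -
  interpret biconservative_chart U y n h \<epsilon> by (rule biconservative_chart[OF nz bic])
  obtain w0 where w0: "Der h u0 w0 \<noteq> 0" using gradient_in_simple_direction[OF u0] by blast
  define V where "V = {u \<in> U. Der h u w0 \<noteq> 0}"
  have V: "open V" "u0 \<in> V" "V \<subseteq> U"
    using continuous_open_preimage[OF smooth_on_imp_continuous_on[OF smooth_on_Der[OF smooth_h, of w0]] U, of "- {0}"]
      u0 w0 by (auto simp: V_def vimage_def Int_def open_Compl)
  have "rotational_chart V y n h \<epsilon> (- (3 * \<epsilon> / 2)) (3/2 + 3 * \<epsilon> / 4) w0"
  proof unfold_locales
    show "open V" by (rule V)
    show "smooth_on y V" "smooth_on n V" "smooth_on h V"
      using smooth_y smooth_n smooth_h smooth_on_subset V(3) by blast+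
    show "\<epsilon> = - 1 \<or> \<epsilon> = 1" by (rule eps)
    show "n u \<diamond> n u = \<epsilon>" "n u \<diamond> Der y u w = 0" if "u \<in> V" for u w
      using nn ny that V(3) by blast+
    show "- (3 * \<epsilon> / 2) \<noteq> 3/2 + 3 * \<epsilon> / 4" "3/2 + 3 * \<epsilon> / 4 \<noteq> 0" using eps by auto
    show "Der h u w0 \<noteq> 0" if "u \<in> V" for u using that by (simp add: V_def)
    show "\<exists>w1 w2 w3. principal_frame y n u (- (3 * \<epsilon> / 2) * h u) ((3/2 + 3 * \<epsilon> / 4) * h u) w1 w2 w3 \<and>
      h u \<noteq> 0 \<and> Der h u w1 \<noteq> 0 \<and> Der h u w2 = 0 \<and> Der h u w3 = 0" if "u \<in> V" for u
      using gradient_in_simple_direction that V(3) by blast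
  qed
  then show ?thesis
    using rotational_chart.congruent_to_model[OF _ local_param_subset[OF \<phi> V(1,3)] refl V(2)] by blast
qed

end

section \<open>The classification\<close>

theorem theorem1:
  fixes M :: "'m topology" and x N :: "'m \<Rightarrow> real^4" and \<epsilon> :: real
  assumes "nondegenerate_hypersurface M x"
    and "unit_normal M x N \<epsilon>"
    and "diagonalizable_shape M x N"
    and "\<forall>p\<in>topspace M. card (principal_curvatures M x N p) = 2"
    and "\<forall>p\<in>topspace M. grad_H M x N p \<noteq> 0"
    and "biconservative M x N \<epsilon>"
  shows "locally_congruent_to_model M x"
proof -
  have "\<exists>f I. open I \<and> is_interval I \<and> smooth_on f I \<and>
      (\<exists>Y\<in>{model1 f, model2 f, model3 f, model4 f}. congruent_near M x p I Y)" if p: "p \<in> topspace M" for p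
  proof -
    obtain U \<phi> where \<phi>: "local_param M x U \<phi>" "p \<in> \<phi> ` U"
      using assms(1) p unfolding nondegenerate_hypersurface_def by meson
    then obtain u0 where u0: "u0 \<in> U" "p = \<phi> u0" by blast
    have "parametrized_hypersurface M x N \<epsilon> U \<phi>"
      by (rule parametrized_hypersurface.intro[OF assms(1-4) \<phi>(1)])
    from parametrized_hypersurface.model_near_point[OF this assms(5,6) u0(1)]
    show ?thesis unfolding u0(2) .
  qed
  then show ?thesis
    unfolding locally_congruent_to_model_def
    by (intro exI[of _ "topspace M"] conjI openin_topspace closure_of_topspace) blast
qed

end
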